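(* Let $0<p,q<\infty$ and let $\mu$ be a $(p,q)$-Bergman-Carleson measure on the unit disk $\mathbb D$ supported on an infinite subset of $\mathbb D$. The following are equivalent: (i) The range of the embedding operator $J_{p,q}(\mu):A^p\hookrightarrow L^q(\mu)$ is closed in $L^q(\mu)$; (ii) $p=q$ and one of the following two conditions holds: either $\mu$ is a sampling measure for $A^p$, or $\mu$ has the form $\sum_n a_n\delta_{z_n}$, where $\{z_n\}$ is an $A^p$-interpolating sequence in $\mathbb D$ and the positive numbers $a_n$ satisfy $a_n\asymp(1-|z_n|)^2$.
   Context: $\mathbb D=\{z\in\mathbb C:|z|<1\}$ and $\sigma$ is normalized area measure on $\mathbb D$. For a positive Borel measure $\mu$ on $\mathbb D$ and $0<q<\infty$, $L^q(\mu)=L^q(\mathbb D,\mu)$ is the usual (quasi-)normed Lebesgue space of (classes of) complex-valued Borel measurable functions on $\mathbb D$. For $0<p<\infty$, the Bergman space $A^p$ is the set of holomorphic functions on $\mathbb D$ that are in $L^p(\sigma)$, with $\|f\|_{A^p}=\|f\|_{L^p(\sigma)}$. A $(p,q)$-Bergman-Carleson measure is a positive Borel measure $\mu$ on $\mathbb D$ with $A^p\subset L^q(\mu)$. For such $\mu$, $J_{p,q}(\mu):A^p\to L^q(\mu)$ is the (automatically bounded) linear operator sending $f\in A^p$ to its restriction to the support of $\mu$, i.e. to $f$ viewed as an element of $L^q(\mu)$. A Bergman-Carleson measure is a positive Borel measure $\mu$ on $\mathbb D$ with $A^p\subset L^p(\mu)$ for some (equivalently, every) $p\in(0,\infty)$.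 "Supported on an infinite subset" means that the case where $\mu$ is supported on (i.e. concentrated on) a finite set of points of $\mathbb D$ is excluded. A Bergman-Carleson measure $\mu$ is a sampling measure for $A^p$ if there is a constant $c>0$ such that $\|f\|_{L^p(\mu)}\ge c\|f\|_{A^p}$ for all $f\in A^p$. A sequence $\{z_n\}$ of pairwise distinct points in $\mathbb D$ is an $A^p$-interpolating sequence if the set of sequences $\{\,\{f(z_n)\}:f\in A^p\}$ coincides with $\left\{\{w_n\}\subset\mathbb C:\sum_n|w_n|^p(1-|z_n|)^2<\infty\right\}$. $\delta_z$ is the unit point mass at $z$. The relation $a_n\asymp(1-|z_n|)^2$ means $0<\inf_n\frac{a_n}{(1-|z_n|)^2}\le\sup_n\frac{a_n}{(1-|z_n|)^2}<\infty$. *)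

theory Defs
  imports "HOL-Complex_Analysis.Complex_Analysis"
begin

abbreviation unit_disk :: "complex set" where
  "unit_disk \<equiv> ball 0 1"

definition borel_measure_on_disk :: "complex measure \<Rightarrow> bool" where
  "borel_measure_on_disk \<mu> \<longleftrightarrow> sets \<mu> = sets (restrict_space borel unit_disk)"

definition area_measure :: "complex measure" where
  "area_measure = scale_measure (ennreal (1 / pi)) (restrict_space lborel unit_disk)"


subsection \<open>The spaces \<open>L\<^sup>q(\<mu>)\<close>\<close>

definition Lq_fun :: "real \<Rightarrow> complex measure \<Rightarrow> (complex \<Rightarrow> complex) set" where
  "Lq_fun q \<mu> = {f \<in> borel_measurable \<mu>. integrable \<mu> (\<lambda>z. norm (f z) powr q)}"

definition Lq_norm :: "real \<Rightarrow> complex measure \<Rightarrow> (complex \<Rightarrow> complex) \<Rightarrow> real" where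
  "Lq_norm q \<mu> f = (\<integral>z. norm (f z) powr q \<partial>\<mu>) powr (1 / q)"

definition ae_rel :: "complex measure \<Rightarrow> ((complex \<Rightarrow> complex) \<times> (complex \<Rightarrow> complex)) set" where
  "ae_rel \<mu> = {(f, g). f \<in> borel_measurable \<mu> \<and> g \<in> borel_measurable \<mu> \<and> (AE z in \<mu>. f z = g z)}"

definition ae_class :: "complex measure \<Rightarrow> (complex \<Rightarrow> complex) \<Rightarrow> (complex \<Rightarrow> complex) set" where
  "ae_class \<mu> f = ae_rel \<mu> `` {f}"

definition Lq_space :: "real \<Rightarrow> complex measure \<Rightarrow> (complex \<Rightarrow> complex) set set" where
  "Lq_space q \<mu> = Lq_fun q \<mu> // ae_rel \<mu>"

lemma equiv_ae_rel: "equiv (borel_measurable \<mu>) (ae_rel \<mu>)"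
  by (rule equivI) (auto simp: ae_rel_def refl_on_def sym_def trans_def elim: AE_mp)

lemma Lq_space_eq_image: "Lq_space q \<mu> = ae_class \<mu> ` Lq_fun q \<mu>"
  by (auto simp: Lq_space_def ae_class_def quotient_def)

text \<open>
  The topology of the (quasi-)norm, described through representatives: a set of classes is open
  if around each of its points it contains a (quasi-)norm ball. This works uniformly for
  \<open>0 < q < 1\<close>, where the triangle inequality fails, and for \<open>q \<ge> 1\<close>.
\<close>

definition Lq_open :: "real \<Rightarrow> complex measure \<Rightarrow> (complex \<Rightarrow> complex) set set \<Rightarrow> bool" where
  "Lq_open q \<mu> U \<longleftrightarrow> U \<subseteq> Lq_space q \<mu> \<and>
     (\<forall>f\<in>Lq_fun q \<mu>. ae_class \<mu> f \<in> U \<longrightarrow>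
        (\<exists>e>0. \<forall>g\<in>Lq_fun q \<mu>. Lq_norm q \<mu> (\<lambda>z. g z - f z) < e \<longrightarrow> ae_class \<mu> g \<in> U))"

definition Lq_topology :: "real \<Rightarrow> complex measure \<Rightarrow> (complex \<Rightarrow> complex) set topology" where
  "Lq_topology q \<mu> = topology (Lq_open q \<mu>)"

lemma istopology_Lq_open: "istopology (Lq_open q \<mu>)"
  unfolding istopology_def
proof (intro conjI allI impI)
  fix S T assume S: "Lq_open q \<mu> S" and T: "Lq_open q \<mu> T"
  show "Lq_open q \<mu> (S \<inter> T)"
    unfolding Lq_open_def
  proof (intro conjI ballI impI)
    show "S \<inter> T \<subseteq> Lq_space q \<mu>"
      using S by (auto simp: Lq_open_def)
  next
    fix f assume f: "f \<in> Lq_fun q \<mu>" "ae_class \<mu> f \<in> S \<inter> T"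
    obtain d where d: "d > 0"
      "\<forall>g\<in>Lq_fun q \<mu>. Lq_norm q \<mu> (\<lambda>z. g z - f z) < d \<longrightarrow> ae_class \<mu> g \<in> S"
      using S f unfolding Lq_open_def by blast
    obtain e where e: "e > 0"
      "\<forall>g\<in>Lq_fun q \<mu>. Lq_norm q \<mu> (\<lambda>z. g z - f z) < e \<longrightarrow> ae_class \<mu> g \<in> T"
      using T f unfolding Lq_open_def by blast
    show "\<exists>e>0. \<forall>g\<in>Lq_fun q \<mu>. Lq_norm q \<mu> (\<lambda>z. g z - f z) < e \<longrightarrow> ae_class \<mu> g \<in> S \<inter> T"
      using d e by (intro exI[of _ "min d e"]) auto
  qed
next
  fix K assume K: "\<forall>S\<in>K. Lq_open q \<mu> S"
  show "Lq_open q \<mu> (\<Union>K)"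
    unfolding Lq_open_def
  proof (intro conjI ballI impI)
    show "\<Union>K \<subseteq> Lq_space q \<mu>"
      using K by (auto simp: Lq_open_def)
  next
    fix f assume f: "f \<in> Lq_fun q \<mu>" "ae_class \<mu> f \<in> \<Union>K"
    then obtain S where S: "S \<in> K" "ae_class \<mu> f \<in> S" by blast
    then obtain e where "e > 0"
      "\<forall>g\<in>Lq_fun q \<mu>. Lq_norm q \<mu> (\<lambda>z. g z - f z) < e \<longrightarrow> ae_class \<mu> g \<in> S"
      using K f unfolding Lq_open_def by blast
    with S show "\<exists>e>0. \<forall>g\<in>Lq_fun q \<mu>. Lq_norm q \<mu> (\<lambda>z. g z - f z) < e \<longrightarrow> ae_class \<mu> g \<in> \<Union>K"
      by blast
  qed
qed

lemma openin_Lq_topology: "openin (Lq_topology q \<mu>) U \<longleftrightarrow> Lq_open q \<mu> U"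
  by (simp add: Lq_topology_def topology_inverse' istopology_Lq_open)

lemma topspace_Lq_topology: "topspace (Lq_topology q \<mu>) = Lq_space q \<mu>"
proof -
  have "Lq_open q \<mu> (Lq_space q \<mu>)"
    by (auto simp: Lq_open_def Lq_space_eq_image intro: exI[of _ 1])
  then show ?thesis
    unfolding topspace_def openin_Lq_topology by (auto simp: Lq_open_def)
qed


subsection \<open>Bergman spaces and Carleson measures\<close>

text \<open>
  Elements of the Bergman space are total functions whose values outside the disk are irrelevant.
\<close>

definition bergman_space :: "real \<Rightarrow> (complex \<Rightarrow> complex) set" where
  "bergman_space p = {f. f holomorphic_on unit_disk \<and> f \<in> Lq_fun p area_measure}"

definition bergman_norm :: "real \<Rightarrow> (complex \<Rightarrow> complex) \<Rightarrow> real" where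
  "bergman_norm p f = Lq_norm p area_measure f"

definition pq_bergman_carleson :: "real \<Rightarrow> real \<Rightarrow> complex measure \<Rightarrow> bool" where
  "pq_bergman_carleson p q \<mu> \<longleftrightarrow>
     borel_measure_on_disk \<mu> \<and> bergman_space p \<subseteq> Lq_fun q \<mu>"

definition bergman_carleson :: "complex measure \<Rightarrow> bool" where
  "bergman_carleson \<mu> \<longleftrightarrow> (\<exists>r>0. pq_bergman_carleson r r \<mu>)"

text \<open>
  The embedding of the Bergman space into \<open>L\<^sup>q(\<mu>)\<close>; the exponent \<open>q\<close> enters only through
  the codomain, hence is not an argument.
\<close>

definition bergman_embedding ::
  "real \<Rightarrow> complex measure \<Rightarrow> (complex \<Rightarrow> complex) \<Rightarrow> (complex \<Rightarrow> complex) set" where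
  "bergman_embedding p \<mu> = restrict (ae_class \<mu>) (bergman_space p)"

definition finitely_supported :: "complex measure \<Rightarrow> bool" where
  "finitely_supported \<mu> \<longleftrightarrow>
     (\<exists>F. finite F \<and> F \<subseteq> unit_disk \<and> emeasure \<mu> (unit_disk - F) = 0)"

definition sampling_measure :: "real \<Rightarrow> complex measure \<Rightarrow> bool" where
  "sampling_measure p \<mu> \<longleftrightarrow> bergman_carleson \<mu> \<and>
     (\<exists>c>0. \<forall>f\<in>bergman_space p. Lq_norm p \<mu> f \<ge> c * bergman_norm p f)"

definition interpolating_seq :: "real \<Rightarrow> (nat \<Rightarrow> complex) \<Rightarrow> bool" where
  "interpolating_seq p z \<longleftrightarrow> inj z \<and> range z \<subseteq> unit_disk \<and>
     {\<lambda>n. f (z n) | f. f \<in> bergman_space p} =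
     {w. summable (\<lambda>n. norm (w n) powr p * (1 - norm (z n))\<^sup>2)}"

text \<open>\<open>\<mu> = \<Sum>\<^sub>n a\<^sub>n \<delta>\<^bsub>z\<^sub>n\<^esub>\<close>, where \<open>indicator A (z n)\<close> is the mass that \<open>\<delta>\<^bsub>z\<^sub>n\<^esub>\<close> gives to \<open>A\<close>.\<close>

definition is_point_mass_sum :: "complex measure \<Rightarrow> (nat \<Rightarrow> real) \<Rightarrow> (nat \<Rightarrow> complex) \<Rightarrow> bool" where
  "is_point_mass_sum \<mu> a z \<longleftrightarrow> borel_measure_on_disk \<mu> \<and>
     (\<forall>A\<in>sets \<mu>. emeasure \<mu> A = (\<Sum>n. ennreal (a n) * indicator A (z n)))"

definition comparable_weights :: "(nat \<Rightarrow> real) \<Rightarrow> (nat \<Rightarrow> complex) \<Rightarrow> bool" where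
  "comparable_weights a z \<longleftrightarrow>
     0 < (INF n. ereal (a n / (1 - norm (z n))\<^sup>2)) \<and>
     (SUP n. ereal (a n / (1 - norm (z n))\<^sup>2)) < \<infinity>"


lemma sets_area_measure: "sets area_measure = sets (restrict_space borel unit_disk)"
  by (simp add: area_measure_def sets_restrict_space)

lemma emeasure_area_measure_disk: "emeasure area_measure unit_disk = 1"
proof -
  have "emeasure lborel unit_disk = ennreal pi"
    by (simp add: emeasure_ball unit_ball_vol_2)
  then show ?thesis
    by (simp add: area_measure_def emeasure_restrict_space flip: ennreal_mult)
qed

end

theory Submission imports Defs begin

text \<open>
  The embedding is bounded, and if its range is closed then it is open onto its range; both
  facts come from one gliding hump argument, which needs no convexity and so covers all exponents.
  If \<open>u\<^sub>n \<rightarrow> 0\<close> pointwise while the moments \<open>\<integral>\<bar>u\<^sub>n\<bar>\<^sup>p d\<sigma>\<close> and \<open>\<integral>\<bar>u\<^sub>n\<bar>\<^sup>q d\<mu>\<close> stay between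
  positive constants, then by the Brezis--Lieb lemma one can add up \<open>N\<close> of the \<open>u\<^sub>n\<close> so that both
  moments of the sum are of the order \<open>N\<close>; comparing powers of \<open>N\<close> in a norm inequality
  compares \<open>p\<close> with \<open>q\<close>.

  If the embedding is injective, openness is the lower sampling inequality, and normalised powers
  of \<open>z\<close> give \<open>p = q\<close>. Otherwise \<open>\<mu>\<close> is carried by the zeros of a nonzero Bergman function
  \<open>f\<close>, so \<open>\<mu>\<close> consists of atoms of mass \<open>a\<^sub>n\<close> at points \<open>z\<^sub>n\<close>. Dividing \<open>f\<close> by powers of \<open>z - z\<^sub>n\<close>
  yields functions that are \<open>1\<close> at \<open>z\<^sub>n\<close> and \<open>0\<close> at the other atoms, hence the range is dense and
  so everything. Openness at these functions and boundedness at kernel functions give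
  \<open>a\<^sub>n \<asymp> (1 - \<bar>z\<^sub>n\<bar>)\<^bsup>2q/p\<^esup>\<close>. Sums of kernels give \<open>p \<le> q\<close>, and interpolation on a subsequence with
  disjoint disks around the \<open>z\<^sub>n\<close>, with the sub-mean-value property, gives \<open>q \<le> p\<close>.
\<close>

section \<open>Moments of measurable functions\<close>

text \<open>For exponents below 1 there is no triangle inequality and no duality, so estimates are
  made for moments, that is for powers of the quasi-norms: they are subadditive up to a constant for
  each exponent. The exponent 2q/p in the masses comes from point evaluation. At z its size on A^p
  is of order (1-|z|)^(-2/p), so an atom of mass a weighs the same in L^q(\<mu>) as in A^p only if
  a^(1/q) is of order (1-|z|)^(2/p). When the embedding has a kernel, openness bounds only some
  function h that agrees \<mu>-almost everywhere with the given f, and h may be much smaller than f.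
  A lower bound for the A^p moment of one sum of kernels is then useless for q \<le> p. What is
  needed is a lower bound shared by all functions with prescribed values at the atoms, and disjoint
  disks with the sub-mean-value property provide it. Removing a single zero at a time is enough,
  since density of the range only takes finite sums.\<close>

definition qmom :: "real \<Rightarrow> 'a measure \<Rightarrow> ('a \<Rightarrow> complex) \<Rightarrow> ennreal" where
  "qmom r M f = (\<integral>\<^sup>+z. ennreal (norm (f z) powr r) \<partial>M)"

lemma Lq_fun_iff_qmom: "f \<in> Lq_fun r M \<longleftrightarrow> f \<in> borel_measurable M \<and> qmom r M f < \<infinity>"
  unfolding Lq_fun_def qmom_def by (auto simp: integrable_iff_bounded)

lemma qmom_zero [simp]: "qmom r M (\<lambda>z. 0) = 0"
  by (simp add: qmom_def)

lemma qmom_scale: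
  assumes "f \<in> borel_measurable M"
  shows "qmom r M (\<lambda>z. c * f z) = ennreal (norm c powr r) * qmom r M f"
  unfolding qmom_def using assms
  by (subst nn_integral_cmult[symmetric]) (auto simp: norm_mult powr_mult ennreal_mult)

lemma qmom_uminus [simp]: "qmom r M (\<lambda>z. - f z) = qmom r M f"
  by (simp add: qmom_def)

lemma qmom_minus_commute: "qmom r M (\<lambda>z. f z - g z) = qmom r M (\<lambda>z. g z - f z)"
  by (simp add: qmom_def norm_minus_commute)

lemma qmom_cong_AE: "AE z in M. f z = g z \<Longrightarrow> qmom r M f = qmom r M g"
  unfolding qmom_def by (rule nn_integral_cong_AE) auto

lemma powr_add_le:
  fixes a b r :: real
  assumes "0 \<le> a" "0 \<le> b" "0 < r"
  shows "(a + b) powr r \<le> 2 powr r * (a powr r + b powr r)"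
proof -
  have "(a + b) powr r \<le> (2 * max a b) powr r"
    using assms by (intro powr_mono2) auto
  also have "\<dots> = 2 powr r * max a b powr r"
    using assms by (simp add: powr_mult)
  also have "max a b powr r \<le> a powr r + b powr r"
    by (auto simp: max_def)
  finally show ?thesis by simp
qed

lemma qmom_add_le:
  assumes [measurable]: "f \<in> borel_measurable M" "g \<in> borel_measurable M" and "0 < r"
  shows "qmom r M (\<lambda>z. f z + g z) \<le> ennreal (2 powr r) * (qmom r M f + qmom r M g)"
proof -
  have "qmom r M (\<lambda>z. f z + g z)
      \<le> (\<integral>\<^sup>+z. ennreal (2 powr r) * (ennreal (norm (f z) powr r) + ennreal (norm (g z) powr r)) \<partial>M)"
    unfolding qmom_def
  proof (rule nn_integral_mono)
    fix z
    have "norm (f z + g z) powr r \<le> (norm (f z) + norm (g z)) powr r"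
      using \<open>0 < r\<close> by (intro powr_mono2) (auto simp: norm_triangle_ineq)
    also have "\<dots> \<le> 2 powr r * (norm (f z) powr r + norm (g z) powr r)"
      using \<open>0 < r\<close> by (intro powr_add_le) auto
    finally show "ennreal (norm (f z + g z) powr r)
        \<le> ennreal (2 powr r) * (ennreal (norm (f z) powr r) + ennreal (norm (g z) powr r))"
      by (simp flip: ennreal_plus ennreal_mult)
  qed
  also have "\<dots> = ennreal (2 powr r) * (qmom r M f + qmom r M g)"
    unfolding qmom_def by (subst nn_integral_cmult) (auto simp: nn_integral_add)
  finally show ?thesis .
qed

lemma qmom_diff_le:
  assumes "f \<in> borel_measurable M" "g \<in> borel_measurable M" and "0 < r"
  shows "qmom r M (\<lambda>z. f z - g z) \<le> ennreal (2 powr r) * (qmom r M f + qmom r M g)"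
  using qmom_add_le[OF assms(1) borel_measurable_uminus[OF assms(2)] assms(3)] by simp

text \<open>Since 2f = (g + f) - (g - f), the larger of |g + f| and |g - f| dominates |f|, for every
  exponent and without a constant. In the gliding hump this shows that one of g + f and g - f has a
  large moment if f has.\<close>

lemma qmom_le_plus_minus:
  assumes [measurable]: "f \<in> borel_measurable M" "g \<in> borel_measurable M" and "0 < r"
  shows "qmom r M f \<le> qmom r M (\<lambda>z. g z + f z) + qmom r M (\<lambda>z. g z - f z)"
proof -
  have "qmom r M f \<le> (\<integral>\<^sup>+z. ennreal (norm (g z + f z) powr r) + ennreal (norm (g z - f z) powr r) \<partial>M)"
    unfolding qmom_def
  proof (rule nn_integral_mono)
    fix z
    have "2 * norm (f z) = norm ((g z + f z) - (g z - f z))"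
      by (simp flip: mult_2 add: norm_mult)
    also have "\<dots> \<le> norm (g z + f z) + norm (g z - f z)"
      by (rule norm_triangle_ineq4)
    finally have "norm (f z) \<le> max (norm (g z + f z)) (norm (g z - f z))"
      by linarith
    then have "norm (f z) powr r \<le> max (norm (g z + f z)) (norm (g z - f z)) powr r"
      using \<open>0 < r\<close> by (intro powr_mono2) auto
    also have "\<dots> \<le> norm (g z + f z) powr r + norm (g z - f z) powr r"
      by (auto simp: max_def)
    finally show "ennreal (norm (f z) powr r)
        \<le> ennreal (norm (g z + f z) powr r) + ennreal (norm (g z - f z) powr r)"
      by (simp flip: ennreal_plus)
  qed
  also have "\<dots> = qmom r M (\<lambda>z. g z + f z) + qmom r M (\<lambda>z. g z - f z)"
    unfolding qmom_def by (rule nn_integral_add) auto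
  finally show ?thesis .
qed

lemma Lq_fun_lincomb:
  assumes "f \<in> Lq_fun r M" "g \<in> Lq_fun r M" "0 < r"
  shows "(\<lambda>z. f z + g z) \<in> Lq_fun r M" "(\<lambda>z. f z - g z) \<in> Lq_fun r M" "(\<lambda>z. c * f z) \<in> Lq_fun r M"
proof -
  have *: "ennreal (2 powr r) * (qmom r M f + qmom r M g) < \<infinity>"
    using assms by (auto simp: Lq_fun_iff_qmom ennreal_mult_less_top)
  show "(\<lambda>z. f z + g z) \<in> Lq_fun r M"
    using assms le_less_trans[OF qmom_add_le *] by (auto simp: Lq_fun_iff_qmom)
  show "(\<lambda>z. f z - g z) \<in> Lq_fun r M"
    using assms le_less_trans[OF qmom_diff_le *] by (auto simp: Lq_fun_iff_qmom)
  show "(\<lambda>z. c * f z) \<in> Lq_fun r M"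
    using assms by (auto simp: Lq_fun_iff_qmom qmom_scale ennreal_mult_less_top)
qed

lemma Lq_fun_if_bounded:
  assumes [measurable]: "f \<in> borel_measurable M" and fin: "emeasure M (space M) < \<infinity>"
    and "\<And>z. z \<in> space M \<Longrightarrow> norm (f z) \<le> B" "0 < r"
  shows "f \<in> Lq_fun r M"
proof -
  have "qmom r M f \<le> (\<integral>\<^sup>+z. ennreal (B powr r) \<partial>M)"
    unfolding qmom_def using assms by (intro nn_integral_mono ennreal_leI powr_mono2) auto
  also have "\<dots> < \<infinity>"
    using fin by (simp add: ennreal_mult_less_top)
  finally show ?thesis by (simp add: Lq_fun_iff_qmom)
qed

lemma qmom_le_limit:
  assumes [measurable]: "\<And>n. F n \<in> borel_measurable M" "f \<in> borel_measurable M"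
    and lim: "AE z in M. (\<lambda>n. F n z) \<longlonglongrightarrow> f z"
    and bound: "eventually (\<lambda>n. qmom r M (F n) \<le> B) sequentially" and "0 < r"
  shows "qmom r M f \<le> B"
proof -
  have "qmom r M f = (\<integral>\<^sup>+z. liminf (\<lambda>n. ennreal (norm (F n z) powr r)) \<partial>M)"
    unfolding qmom_def
  proof (rule nn_integral_cong_AE)
    show "AE z in M. ennreal (norm (f z) powr r) = liminf (\<lambda>n. ennreal (norm (F n z) powr r))"
      using lim
    proof eventually_elim
      case (elim z)
      have "(\<lambda>n. ennreal (norm (F n z) powr r)) \<longlonglongrightarrow> ennreal (norm (f z) powr r)"
        using \<open>0 < r\<close> elim by (intro tendsto_ennrealI tendsto_powr' tendsto_norm) auto
      then show ?case
        by (intro lim_imp_Liminf[symmetric]) auto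
    qed
  qed
  also have "\<dots> \<le> liminf (\<lambda>n. qmom r M (F n))"
    unfolding qmom_def by (rule nn_integral_liminf) auto
  also have "\<dots> \<le> B"
    using bound by (intro Liminf_le) auto
  finally show ?thesis .
qed

lemma qmom_eq_0_iff:
  assumes "f \<in> borel_measurable M"
  shows "qmom r M f = 0 \<longleftrightarrow> (AE z in M. f z = 0)"
  unfolding qmom_def using assms by (subst nn_integral_0_iff_AE) (auto simp: ennreal_eq_0_iff)

text \<open>The geometric decay of the bounds makes the sequence converge almost everywhere, so that no
  subsequence has to be chosen.\<close>

lemma Lq_complete:
  fixes \<rho> :: "nat \<Rightarrow> real"
  assumes S: "\<And>n. S n \<in> Lq_fun r M" and "0 < r"
    and pos: "\<And>k. 0 < \<rho> k" and decay: "\<And>k. \<rho> (Suc k) \<le> \<rho> k / (2 * 2 powr r)"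
    and cauchy: "\<And>k n. k \<le> n \<Longrightarrow> qmom r M (\<lambda>z. S n z - S k z) \<le> ennreal (\<rho> k)"
  obtains g where "g \<in> Lq_fun r M" "\<And>k. qmom r M (\<lambda>z. g z - S k z) \<le> ennreal (\<rho> k)"
proof -
  have [measurable]: "S n \<in> borel_measurable M" for n
    using S by (auto simp: Lq_fun_iff_qmom)
  have geo: "(2 powr r) ^ k * \<rho> k \<le> (1 / 2) ^ k * \<rho> 0" for k
  proof (induction k)
    case (Suc k)
    have "(2 powr r) ^ Suc k * \<rho> (Suc k) \<le> (2 powr r) ^ Suc k * (\<rho> k / (2 * 2 powr r))"
      using decay by (intro mult_left_mono) auto
    also have "\<dots> = (2 powr r) ^ k * \<rho> k / 2" by simp
    also have "\<dots> \<le> (1 / 2) ^ k * \<rho> 0 / 2" using Suc by simp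
    finally show ?case by simp
  qed auto
  \<comment> \<open>The weight \<open>(2 powr r) ^ k\<close> is the r-th power of 2^k: finiteness of
    the weighted sum at z bounds the k-th increment there by a constant times 2^(-k), which is
    summable for every r. The assumed decay pays for the weight and leaves a factor 1/2.\<close>
  let ?t = "\<lambda>k z. ennreal ((2 powr r) ^ k * norm (S (Suc k) z - S k z) powr r)"
  have "(\<integral>\<^sup>+z. (\<Sum>k. ?t k z) \<partial>M) = (\<Sum>k. \<integral>\<^sup>+z. ?t k z \<partial>M)"
    by (rule nn_integral_suminf) auto
  also have "\<dots> \<le> (\<Sum>k. ennreal ((1 / 2) ^ k * \<rho> 0))"
  proof (intro suminf_le summableI)
    fix k
    have "(\<integral>\<^sup>+z. ?t k z \<partial>M) = ennreal ((2 powr r) ^ k) * qmom r M (\<lambda>z. S (Suc k) z - S k z)"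
      unfolding qmom_def by (subst nn_integral_cmult[symmetric]) (auto simp: ennreal_mult)
    also have "\<dots> \<le> ennreal ((2 powr r) ^ k) * ennreal (\<rho> k)"
      by (intro mult_left_mono cauchy) auto
    also have "\<dots> \<le> ennreal ((1 / 2) ^ k * \<rho> 0)"
      using geo by (simp flip: ennreal_mult add: less_imp_le[OF pos])
    finally show "(\<integral>\<^sup>+z. ?t k z \<partial>M) \<le> ennreal ((1 / 2) ^ k * \<rho> 0)" .
  qed
  also have "\<dots> < \<infinity>"
  proof -
    have "summable (\<lambda>k. (1 / 2) ^ k * \<rho> 0)"
      by (intro summable_mult2 summable_geometric) auto
    then show ?thesis
      using less_imp_le[OF pos] by (subst suminf_ennreal2) auto
  qed
  finally have "(\<integral>\<^sup>+z. (\<Sum>k. ?t k z) \<partial>M) \<noteq> \<infinity>" by simp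
  then have "AE z in M. (\<Sum>k. ?t k z) \<noteq> \<infinity>"
    by (intro nn_integral_PInf_AE) auto
  then have conv: "AE z in M. convergent (\<lambda>n. S n z)"
  proof eventually_elim
    case (elim z)
    have pow: "(2 powr r) ^ k = (2 ^ k) powr r" for k
      by (induction k) (simp_all add: powr_mult)
    define T where "T = (\<lambda>k. ?t k z)"
    have bd: "T k \<le> suminf T" for k
      using sum_le_suminf[of T "{k}"] by (simp add: summableI)
    obtain B where B: "suminf T = ennreal B" "0 \<le> B"
      using elim unfolding T_def[symmetric] by (cases "suminf T") auto
    have small: "norm (S (Suc k) z - S k z) \<le> B powr (1 / r) * (1 / 2) ^ k" for k
    proof -
      have "(2 powr r) ^ k * norm (S (Suc k) z - S k z) powr r \<le> B"
        using bd[of k] B unfolding T_def by simp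
      then have "(2 ^ k * norm (S (Suc k) z - S k z)) powr r \<le> B"
        by (simp only: pow powr_mult)
      then have "((2 ^ k * norm (S (Suc k) z - S k z)) powr r) powr (1 / r) \<le> B powr (1 / r)"
        using \<open>0 < r\<close> by (intro powr_mono2) auto
      then show ?thesis
        using \<open>0 < r\<close> by (simp add: powr_powr power_one_over field_simps)
    qed
    have "summable (\<lambda>k. S (Suc k) z - S k z)"
      by (rule summable_comparison_test'[of "\<lambda>k. B powr (1 / r) * (1 / 2) ^ k" 0])
        (use small in \<open>auto intro!: summable_mult summable_geometric\<close>)
    then have "(\<lambda>n. \<Sum>k<n. S (Suc k) z - S k z) \<longlonglongrightarrow> (\<Sum>k. S (Suc k) z - S k z)"
      by (rule summable_LIMSEQ)
    then have "(\<lambda>n. S n z - S 0 z) \<longlonglongrightarrow> (\<Sum>k. S (Suc k) z - S k z)"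
      by (subst (asm) sum_lessThan_telescope)
    from tendsto_add[OF this tendsto_const[of "S 0 z"]] show "convergent (\<lambda>n. S n z)"
      by (auto simp: convergent_def)
  qed
  define g where "g = (\<lambda>z. lim (\<lambda>n. S n z))"
  have [measurable]: "g \<in> borel_measurable M"
    unfolding g_def by measurable
  have lim: "AE z in M. (\<lambda>n. S n z) \<longlonglongrightarrow> g z"
    using conv by eventually_elim (simp add: g_def convergent_LIMSEQ_iff)
  have dist: "qmom r M (\<lambda>z. g z - S k z) \<le> ennreal (\<rho> k)" for k
  proof (rule qmom_le_limit)
    show "AE z in M. (\<lambda>n. S n z - S k z) \<longlonglongrightarrow> g z - S k z"
      using lim by eventually_elim (auto intro: tendsto_diff)
    show "\<forall>\<^sub>F n in sequentially. qmom r M (\<lambda>z. S n z - S k z) \<le> ennreal (\<rho> k)"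
      by (rule eventually_mono[OF eventually_ge_at_top[of k]]) (rule cauchy)
  qed (use \<open>0 < r\<close> in auto)
  have "(\<lambda>z. g z - S 0 z) \<in> Lq_fun r M"
    using le_less_trans[OF dist] by (auto simp: Lq_fun_iff_qmom)
  from Lq_fun_lincomb(1)[OF this S[of 0] \<open>0 < r\<close>] have "g \<in> Lq_fun r M"
    by simp
  with dist show ?thesis by (rule that[rotated])
qed

section \<open>Asymptotic additivity of moments\<close>

text \<open>If |a| is small against |b|, continuity of (1 + x)^r at 0 gives the term with
  \<epsilon>; otherwise |b| is at most |a| / \<delta> and everything is absorbed in a constant times
  |a|^r. The asymmetry is deliberate: b will be the varying function, whose moments are only
  bounded, and a the fixed one.\<close>

lemma powr_add_asymp:
  fixes r \<epsilon> :: real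
  assumes "0 < r" "0 < \<epsilon>"
  obtains C where "0 \<le> C"
    "\<And>a b :: complex. \<bar>norm (a + b) powr r - norm a powr r - norm b powr r\<bar> \<le> \<epsilon> * norm b powr r + C * norm a powr r"
proof -
  have "((\<lambda>x. \<bar>(1 + x) powr r - 1\<bar>) \<longlongrightarrow> \<bar>(1 + 0) powr r - 1\<bar>) (at (0::real))"
    by (intro tendsto_intros) auto
  then have "eventually (\<lambda>x. \<bar>(1 + x) powr r - 1\<bar> < \<epsilon>) (at (0::real))"
    using \<open>0 < \<epsilon>\<close> by (intro order_tendstoD(2)[where a = \<epsilon>]) auto
  then obtain d where d: "d > 0" "\<And>x. x \<noteq> 0 \<Longrightarrow> \<bar>x\<bar> < d \<Longrightarrow> \<bar>(1 + x) powr r - 1\<bar> < \<epsilon>"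
    unfolding eventually_at by (auto simp: dist_real_def)
  define \<delta> where "\<delta> = min (d / 2) 1"
  have \<delta>: "0 < \<delta>" "\<delta> \<le> 1" "\<delta> < d" using d by (auto simp: \<delta>_def)
  have near: "\<bar>(1 + x) powr r - 1\<bar> \<le> \<epsilon>" if "\<bar>x\<bar> \<le> \<delta>" for x
    using d(2)[of x] that \<delta> \<open>0 < \<epsilon>\<close> by (cases "x = 0") auto
  define C where "C = (1 + 1 / \<delta>) powr r + 1 + (1 / \<delta>) powr r"
  have "\<bar>norm (a + b) powr r - norm a powr r - norm b powr r\<bar> \<le> \<epsilon> * norm b powr r + C * norm a powr r"
    for a b :: complex
  proof (cases "norm a \<le> \<delta> * norm b")
    case True
    have "\<bar>norm (a + b) powr r - norm b powr r\<bar> \<le> \<epsilon> * norm b powr r"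
    proof (cases "b = 0")
      case False
      define x where "x = norm (a + b) / norm b - 1"
      have "\<bar>norm (a + b) - norm b\<bar> \<le> norm a"
        using norm_triangle_ineq3[of "a + b" b] by simp
      also note True
      finally have "\<bar>x\<bar> \<le> \<delta>"
        using False by (auto simp: x_def abs_le_iff divide_simps algebra_simps)
      then have "\<bar>(1 + x) powr r - 1\<bar> \<le> \<epsilon>" by (rule near)
      moreover have "(1 + x) powr r * norm b powr r = norm (a + b) powr r"
        using False by (simp add: x_def powr_divide)
      moreover have "\<bar>(1 + x) powr r * norm b powr r - norm b powr r\<bar> = \<bar>(1 + x) powr r - 1\<bar> * norm b powr r"
        using abs_mult[of "(1 + x) powr r - 1" "norm b powr r"] by (simp add: left_diff_distrib)
      ultimately show ?thesis by (metis mult_right_mono powr_ge_zero)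
    qed (use True in auto)
    moreover have "norm a powr r \<le> C * norm a powr r"
      using mult_right_mono[of 1 C "norm a powr r"] by (simp add: C_def)
    moreover have "0 \<le> norm a powr r" by simp
    ultimately show ?thesis by linarith
  next
    case False
    then have b: "norm b \<le> (1 / \<delta>) * norm a" using \<delta> by (simp add: field_simps)
    have "norm b powr r \<le> ((1 / \<delta>) * norm a) powr r"
      using b \<open>0 < r\<close> by (intro powr_mono2) auto
    then have 1: "norm b powr r \<le> (1 / \<delta>) powr r * norm a powr r"
      using \<delta> by (simp add: powr_divide)
    have "norm (a + b) \<le> (1 + 1 / \<delta>) * norm a"
      using norm_triangle_ineq[of a b] b by (simp add: algebra_simps)
    then have "norm (a + b) powr r \<le> ((1 + 1 / \<delta>) * norm a) powr r"
      using \<open>0 < r\<close> by (intro powr_mono2) auto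
    then have 2: "norm (a + b) powr r \<le> (1 + 1 / \<delta>) powr r * norm a powr r"
      using \<delta> by (simp add: powr_mult)
    have "0 \<le> \<epsilon> * norm b powr r" using \<open>0 < \<epsilon>\<close> by simp
    moreover have "C * norm a powr r = (1 + 1 / \<delta>) powr r * norm a powr r + norm a powr r + (1 / \<delta>) powr r * norm a powr r"
      by (simp add: C_def algebra_simps)
    moreover have "0 \<le> norm (a + b) powr r" "0 \<le> norm a powr r" "0 \<le> norm b powr r" by auto
    ultimately show ?thesis using 1 2 by linarith
  qed
  moreover have "0 \<le> C" by (simp add: C_def)
  ultimately show ?thesis by (rule that[rotated])
qed

text \<open>The Brezis--Lieb lemma for a sequence tending to zero.\<close>

lemma Lq_asymp_additive:
  assumes S: "S \<in> Lq_fun r M" and u: "\<And>n. u n \<in> Lq_fun r M" and "0 < r"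
    and lim: "\<And>z. z \<in> space M \<Longrightarrow> (\<lambda>n. u n z) \<longlonglongrightarrow> 0"
    and bound: "\<And>n. (\<integral>z. norm (u n z) powr r \<partial>M) \<le> B" and "0 < \<eta>"
  shows "eventually (\<lambda>n. \<bar>(\<integral>z. norm (S z + u n z) powr r \<partial>M) - (\<integral>z. norm (S z) powr r \<partial>M)
    - (\<integral>z. norm (u n z) powr r \<partial>M)\<bar> < \<eta>) sequentially"
proof -
  define I where "I = (\<lambda>f. \<integral>z. norm (f z :: complex) powr r \<partial>M)"
  have [measurable]: "S \<in> borel_measurable M" "u n \<in> borel_measurable M" for n
    using S u by (auto simp: Lq_fun_def)
  have iS [simp]: "integrable M (\<lambda>z. norm (S z) powr r)"
    and iu [simp]: "integrable M (\<lambda>z. norm (u n z) powr r)" for n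
    using S u by (auto simp: Lq_fun_def)
  have iSu [simp]: "integrable M (\<lambda>z. norm (S z + u n z) powr r)" for n
    using Lq_fun_lincomb(1)[OF S u \<open>0 < r\<close>] by (auto simp: Lq_fun_def)
  have "0 \<le> B" using order_trans[OF _ bound[of 0]] by simp
  define \<epsilon> where "\<epsilon> = \<eta> / (2 * (B + 1))"
  have "0 < \<epsilon>" "\<epsilon> * B < \<eta> / 2"
    using \<open>0 < \<eta>\<close> \<open>0 \<le> B\<close> by (auto simp: \<epsilon>_def field_simps)
  obtain C where C: "0 \<le> C" "\<And>a b :: complex. \<bar>norm (a + b) powr r - norm a powr r - norm b powr r\<bar> \<le> \<epsilon> * norm b powr r + C * norm a powr r"
    using powr_add_asymp[OF \<open>0 < r\<close> \<open>0 < \<epsilon>\<close>] by blast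
  \<comment> \<open>The part of the defect exceeding \<epsilon> |u_n|^r is dominated by C |S|^r,
    which is integrable and independent of n, so dominated convergence applies to it. The rest is
    small because the moments of u_n are bounded.\<close>
  define W where "W = (\<lambda>n z. max 0 (\<bar>norm (S z + u n z) powr r - norm (S z) powr r - norm (u n z) powr r\<bar> - \<epsilon> * norm (u n z) powr r))"
  have [measurable]: "W n \<in> borel_measurable M" for n
    unfolding W_def by measurable
  have Wle: "norm (W n z) \<le> C * norm (S z) powr r" for n z
    using C(1) C(2)[of "S z" "u n z"] by (auto simp: W_def max_def)
  have iW: "integrable M (W n)" for n
    by (rule Bochner_Integration.integrable_bound[of M "\<lambda>z. C * norm (S z) powr r"]) (use Wle C(1) in auto)
  have "(\<lambda>n. \<integral>z. W n z \<partial>M) \<longlonglongrightarrow> (\<integral>z. 0 \<partial>M)"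
  proof (rule integral_dominated_convergence[where w = "\<lambda>z. C * norm (S z) powr r"])
    show "AE z in M. (\<lambda>n. W n z) \<longlonglongrightarrow> 0"
    proof (rule AE_I2)
      fix z assume "z \<in> space M"
      then have 1: "(\<lambda>n. u n z) \<longlonglongrightarrow> 0" by (rule lim)
      have 2: "(\<lambda>n. norm (u n z) powr r) \<longlonglongrightarrow> norm (0::complex) powr r"
        using \<open>0 < r\<close> by (intro tendsto_powr' tendsto_norm 1) auto
      have 3: "(\<lambda>n. norm (S z + u n z) powr r) \<longlonglongrightarrow> norm (S z + 0) powr r"
        using \<open>0 < r\<close> by (intro tendsto_powr' tendsto_intros 1) auto
      have "(\<lambda>n. W n z) \<longlonglongrightarrow> max 0 (\<bar>norm (S z + 0) powr r - norm (S z) powr r - norm (0::complex) powr r\<bar> - \<epsilon> * norm (0::complex) powr r)"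
        unfolding W_def by (intro tendsto_intros 2 3)
      then show "(\<lambda>n. W n z) \<longlonglongrightarrow> 0" by simp
    qed
  qed (use Wle in auto)
  then have "eventually (\<lambda>n. (\<integral>z. W n z \<partial>M) < \<eta> / 2) sequentially"
    using \<open>0 < \<eta>\<close> by (intro order_tendstoD(2)[where a = "\<eta> / 2"]) auto
  then show ?thesis
  proof eventually_elim
    case (elim n)
    have "\<bar>I (\<lambda>z. S z + u n z) - I S - I (u n)\<bar>
        = \<bar>\<integral>z. norm (S z + u n z) powr r - norm (S z) powr r - norm (u n z) powr r \<partial>M\<bar>"
      unfolding I_def by simp
    also have "\<dots> \<le> (\<integral>z. W n z + \<epsilon> * norm (u n z) powr r \<partial>M)"
      using iW by (intro order_trans[OF integral_abs_bound] integral_mono) (auto simp: W_def)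
    also have "\<dots> = (\<integral>z. W n z \<partial>M) + \<epsilon> * I (u n)"
      unfolding I_def using iW by simp
    also have "\<epsilon> * I (u n) \<le> \<epsilon> * B"
      unfolding I_def using bound \<open>0 < \<epsilon>\<close> by (intro mult_left_mono) auto
    finally show ?case using elim \<open>\<epsilon> * B < \<eta> / 2\<close> by (simp add: I_def)
  qed
qed

section \<open>The sub-mean-value property\<close>

text \<open>Cauchy's formula at a point a other than the centre: as the centre is off by at most
  r/2, the circle keeps the distance r/2 from a, and the Cauchy kernel exceeds the one for the
  centre by a factor of at most 2.\<close>

lemma circle_mean_bound:
  fixes f :: "complex \<Rightarrow> complex"
  assumes f: "f holomorphic_on cball (a + w) r" and "0 < r" and w: "norm w \<le> r / 2"
  shows "ennreal (norm (f a))
    \<le> 2 * (\<integral>\<^sup>+t. ennreal (norm (f (a + w + of_real r * exp (2 * of_real pi * \<i> * of_real t)))) * indicator {0..1} t \<partial>lborel)"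
proof -
  define \<gamma> where "\<gamma> = (\<lambda>t::real. a + w + of_real r * exp (2 * of_real pi * \<i> * of_real t))"
  have n1: "norm (exp (2 * of_real pi * \<i> * of_real t)) = 1" for t :: real
    by (simp add: norm_exp_eq_Re)
  have \<gamma>_in: "\<gamma> t \<in> cball (a + w) r" for t
    using \<open>0 < r\<close> by (simp add: \<gamma>_def dist_norm norm_mult n1)
  have cont: "continuous_on {0..1} (\<lambda>t. norm (f (\<gamma> t)))"
    by (intro continuous_on_norm continuous_on_compose2[OF holomorphic_on_imp_continuous_on[OF f]])
      (use \<gamma>_in in \<open>auto simp: \<gamma>_def intro!: continuous_intros\<close>)
  have "((\<lambda>u. f u / (u - a)) has_contour_integral (2 * of_real pi * \<i> * f a)) (circlepath (a + w) r)"
    using w \<open>0 < r\<close> by (intro Cauchy_integral_circlepath_simple f) (auto simp: dist_norm)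
  then have "((\<lambda>t. f (\<gamma> t) / (\<gamma> t - a) * vector_derivative (circlepath (a + w) r) (at t within {0..1}))
      has_integral (2 * of_real pi * \<i> * f a)) {0..1}"
    unfolding has_contour_integral_def by (simp add: circlepath_def \<gamma>_def part_circlepath_def linepath_def algebra_simps)
  then have hi: "((\<lambda>t. f (\<gamma> t) / (\<gamma> t - a) * (2 * of_real pi * \<i> * of_real r * exp (2 * of_real pi * \<i> * of_real t)))
      has_integral (2 * of_real pi * \<i> * f a)) {0..1}"
    by (rule has_integral_eq[rotated]) (auto simp: vector_derivative_circlepath01)
  have "norm (integral {0..1} (\<lambda>t. f (\<gamma> t) / (\<gamma> t - a) * (2 * of_real pi * \<i> * of_real r * exp (2 * of_real pi * \<i> * of_real t))))
    \<le> integral {0..1} (\<lambda>t. 4 * pi * norm (f (\<gamma> t)))"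
  proof (rule integral_norm_bound_integral)
    show "(\<lambda>t. 4 * pi * norm (f (\<gamma> t))) integrable_on {0..1}"
      by (intro integrable_continuous_real continuous_intros cont)
    fix t
    have "r = norm (of_real r * exp (2 * of_real pi * \<i> * of_real t))"
      using \<open>0 < r\<close> by (simp add: norm_mult n1)
    also have "\<dots> \<le> norm (\<gamma> t - a) + norm w"
      using norm_triangle_ineq4[of "\<gamma> t - a" w] by (simp add: \<gamma>_def)
    finally have far: "r / 2 \<le> norm (\<gamma> t - a)" using w by simp
    have "norm (f (\<gamma> t) / (\<gamma> t - a) * (2 * of_real pi * \<i> * of_real r * exp (2 * of_real pi * \<i> * of_real t)))
        = norm (f (\<gamma> t)) / norm (\<gamma> t - a) * (2 * pi * r)"
      using \<open>0 < r\<close> by (simp add: norm_mult norm_divide n1)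
    also have "\<dots> \<le> norm (f (\<gamma> t)) / (r / 2) * (2 * pi * r)"
      using far \<open>0 < r\<close> by (intro mult_right_mono divide_left_mono mult_pos_pos) auto
    also have "\<dots> = 4 * pi * norm (f (\<gamma> t))"
      using \<open>0 < r\<close> by simp
    finally show "norm (f (\<gamma> t) / (\<gamma> t - a) * (2 * of_real pi * \<i> * of_real r * exp (2 * of_real pi * \<i> * of_real t)))
        \<le> 4 * pi * norm (f (\<gamma> t))" .
  qed (use hi in auto)
  then have "norm (f a) \<le> 2 * integral {0..1} (\<lambda>t. norm (f (\<gamma> t)))"
    using integral_unique[OF hi] by (simp add: norm_mult)
  then have "ennreal (norm (f a)) \<le> ennreal (2 * integral {0..1} (\<lambda>t. norm (f (\<gamma> t))))"
    by (rule ennreal_leI)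
  also have "\<dots> = 2 * ennreal (integral {0..1} (\<lambda>t. norm (f (\<gamma> t))))"
    by (simp add: ennreal_mult')
  also have "ennreal (integral {0..1} (\<lambda>t. norm (f (\<gamma> t))))
      = (\<integral>\<^sup>+t. ennreal (norm (f (\<gamma> t))) * indicator {0..1} t \<partial>lborel)"
  proof -
    have si: "set_integrable lborel {0..1} (\<lambda>t. norm (f (\<gamma> t)))"
      by (rule borel_integrable_atLeastAtMost'[OF cont])
    have "integral {0..1} (\<lambda>t. norm (f (\<gamma> t))) = (LINT t:{0..1}|lborel. norm (f (\<gamma> t)))"
      using set_borel_integral_eq_integral(2)[OF si] by simp
    also have "ennreal \<dots> = (\<integral>\<^sup>+t. ennreal (indicator {0..1} t *\<^sub>R norm (f (\<gamma> t))) \<partial>lborel)"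
      unfolding set_lebesgue_integral_def using si
      by (intro nn_integral_eq_integral[symmetric]) (auto simp: set_integrable_def)
    also have "\<dots> = (\<integral>\<^sup>+t. ennreal (norm (f (\<gamma> t))) * indicator {0..1} t \<partial>lborel)"
      by (intro nn_integral_cong) (auto simp: indicator_def)
    finally show ?thesis .
  qed
  finally show ?thesis
    by (simp only: \<gamma>_def)
qed

lemma measurable_indicator_continuous_on [measurable]:
  fixes f :: "complex \<Rightarrow> complex"
  assumes "continuous_on A f" "A \<in> sets borel" "0 < r"
  shows "(\<lambda>z. ennreal (norm (f z) powr r) * indicator A z) \<in> borel_measurable borel"
proof -
  have "(\<lambda>z. indicator A z *\<^sub>R f z) \<in> borel_measurable borel"
    using assms by (intro borel_measurable_continuous_on_indicator) auto
  then have "(\<lambda>z. ennreal (norm (indicator A z *\<^sub>R f z) powr r)) \<in> borel_measurable borel"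
    by measurable
  also have "(\<lambda>z. ennreal (norm (indicator A z *\<^sub>R f z) powr r)) = (\<lambda>z. ennreal (norm (f z) powr r) * indicator A z)"
    by (auto simp: indicator_def)
  finally show ?thesis .
qed

lemma nn_integral_lborel_translate:
  fixes h :: "complex \<Rightarrow> ennreal"
  assumes [measurable]: "h \<in> borel_measurable borel"
  shows "(\<integral>\<^sup>+w. h (c + w) \<partial>lborel) = (\<integral>\<^sup>+w. h w \<partial>lborel)"
proof -
  have "(\<integral>\<^sup>+w. h w \<partial>lborel) = (\<integral>\<^sup>+w. h w \<partial>distr lborel borel ((+) c))"
    by (simp add: lborel_distr_plus)
  also have "\<dots> = (\<integral>\<^sup>+w. h (c + w) \<partial>lborel)"
    by (subst nn_integral_distr) auto
  finally show ?thesis ..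
qed

lemma emeasure_ball_complex:
  "0 \<le> r \<Longrightarrow> emeasure lborel (ball (c::complex) r) = ennreal (pi * r\<^sup>2)"
  by (simp add: emeasure_ball unit_ball_vol_2)

text \<open>Cauchy's formula at \<open>a\<close> on circles of fixed radius whose centre \<open>a + w\<close> varies: after
  integration over \<open>w\<close>, Tonelli and translation invariance give an area mean without polar
  coordinates.\<close>

lemma area_mean_bound:
  fixes f :: "complex \<Rightarrow> complex"
  assumes f: "f holomorphic_on ball a R" and "0 < R"
  shows "ennreal (norm (f a) * R\<^sup>2) \<le> 32 * (\<integral>\<^sup>+z. ennreal (norm (f z)) * indicator (ball a R) z \<partial>lborel)"
proof -
  define h where "h = (\<lambda>z. ennreal (norm (f z)) * indicator (ball a R) z)"
  \<comment> \<open>Radius R/2 with centres a + w, |w| < R/4, keeps the circles inside the disk of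
    radius 3R/4 and meets the requirement of \<open>circle_mean_bound\<close> that the centre is off
    by at most half the radius.\<close>
  define e where "e = (\<lambda>t::real. of_real (R / 2) * exp (2 * of_real pi * \<i> * of_real t) :: complex)"
  have "(\<lambda>z. ennreal (norm (f z) powr 1) * indicator (ball a R) z) \<in> borel_measurable borel"
    by (rule measurable_indicator_continuous_on) (use holomorphic_on_imp_continuous_on[OF f] in auto)
  then have [measurable]: "h \<in> borel_measurable borel" by (simp add: h_def)
  have [measurable]: "e \<in> borel_measurable borel"
    unfolding e_def by (intro borel_measurable_continuous_onI continuous_intros)
  have pw: "ennreal (norm (f a)) * indicator (ball 0 (R / 4)) w
    \<le> 2 * (\<integral>\<^sup>+t. h (a + e t + w) * indicator {0..1} t \<partial>lborel)" for w
  proof (cases "w \<in> ball 0 (R / 4)")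
    case True
    have sub: "cball (a + w) (R / 2) \<subseteq> ball a R"
      using True \<open>0 < R\<close> by (subst cball_subset_ball_iff) (auto simp: dist_norm)
    have "ennreal (norm (f a)) \<le> 2 * (\<integral>\<^sup>+t. ennreal (norm (f (a + w + e t))) * indicator {0..1} t \<partial>lborel)"
      unfolding e_def using True \<open>0 < R\<close>
      by (intro circle_mean_bound holomorphic_on_subset[OF f sub]) auto
    also have "(\<integral>\<^sup>+t. ennreal (norm (f (a + w + e t))) * indicator {0..1} t \<partial>lborel)
        = (\<integral>\<^sup>+t. h (a + e t + w) * indicator {0..1} t \<partial>lborel)"
    proof (intro nn_integral_cong)
      fix t
      have "norm (e t) = R / 2" using \<open>0 < R\<close> by (simp add: e_def norm_mult norm_exp_eq_Re)
      then have "a + w + e t \<in> cball (a + w) (R / 2)" by (simp add: dist_norm)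
      then have "a + w + e t \<in> ball a R" using sub by blast
      then have "a + e t + w \<in> ball a R" by (simp only: add_ac)
      then show "ennreal (norm (f (a + w + e t))) * indicator {0..1} t = h (a + e t + w) * indicator {0..1} t"
        by (simp add: h_def add_ac)
    qed
    finally show ?thesis using True by simp
  qed auto

  have "ennreal (norm (f a)) * ennreal (pi * (R / 4)\<^sup>2)
      = (\<integral>\<^sup>+w. ennreal (norm (f a)) * indicator (ball 0 (R / 4)) w \<partial>(lborel :: complex measure))"
    using \<open>0 < R\<close> emeasure_ball_complex[of "R / 4" 0]
    by (subst nn_integral_cmult_indicator) auto
  also have "\<dots> \<le> (\<integral>\<^sup>+w. 2 * (\<integral>\<^sup>+t. h (a + e t + w) * indicator {0..1} t \<partial>lborel) \<partial>lborel)"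
    by (intro nn_integral_mono pw)
  also have "\<dots> = 2 * (\<integral>\<^sup>+w. (\<integral>\<^sup>+t. h (a + e t + w) * indicator {0..1} t \<partial>lborel) \<partial>lborel)"
    by (rule nn_integral_cmult) measurable
  also have "(\<integral>\<^sup>+w. (\<integral>\<^sup>+t. h (a + e t + w) * indicator {0..1} t \<partial>lborel) \<partial>lborel)
      = (\<integral>\<^sup>+t. (\<integral>\<^sup>+w. h (a + e t + w) * indicator {0..1} t \<partial>lborel) \<partial>lborel)"
    by (rule lborel_pair.Fubini'[symmetric]) measurable
  also have "\<dots> = (\<integral>\<^sup>+t. (\<integral>\<^sup>+z. h z \<partial>lborel) * indicator {0..1} t \<partial>(lborel::real measure))"
    by (intro nn_integral_cong) (simp add: nn_integral_multc nn_integral_lborel_translate)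
  also have "\<dots> = (\<integral>\<^sup>+z. h z \<partial>lborel)"
    by (simp add: nn_integral_cmult)
  finally have main: "ennreal (norm (f a) * (pi * (R / 4)\<^sup>2)) \<le> 2 * (\<integral>\<^sup>+z. h z \<partial>lborel)"
    by (simp add: ennreal_mult)
  \<comment> \<open>The constant 32 is 16, from (R/4)^2, times the 2 of the circle bound; of pi only
    the bound pi \<ge> 1 enters.\<close>
  have "ennreal (norm (f a) * R\<^sup>2) \<le> ennreal (16 * (norm (f a) * (pi * (R / 4)\<^sup>2)))"
    using pi_gt3 mult_right_mono[of 1 pi "R\<^sup>2"]
    by (intro ennreal_leI) (auto simp: power_divide intro!: mult_left_mono)
  also have "\<dots> = 16 * ennreal (norm (f a) * (pi * (R / 4)\<^sup>2))"
    by (subst ennreal_mult) auto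
  also have "\<dots> \<le> 16 * (2 * (\<integral>\<^sup>+z. h z \<partial>lborel))"
    by (intro mult_left_mono main) auto
  finally show ?thesis by (simp add: h_def mult.assoc[symmetric])
qed

text \<open>For \<open>r \<le> 1\<close> the mean value bound is applied at a maximum point of
  \<open>\<lambda>z. \<bar>f z\<bar>\<^sup>r (R - \<bar>z - a\<bar>)\<^sup>2\<close>, near which \<open>\<bar>f\<bar>\<close> is controlled by its value at that point.\<close>

lemma submean_le_1:
  fixes f :: "complex \<Rightarrow> complex"
  assumes cont: "continuous_on (cball a R) f" and hol: "f holomorphic_on ball a R" and "0 < R"
    and r: "0 < r" "r \<le> 1"
  shows "ennreal (norm (f a) powr r * R\<^sup>2)
    \<le> ennreal (128 * 4 powr (1 / r)) * (\<integral>\<^sup>+z. ennreal (norm (f z) powr r) * indicator (ball a R) z \<partial>lborel)"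
    (is "_ \<le> _ * ?J")
proof -
  define \<phi> where "\<phi> = (\<lambda>z. norm (f z) powr r * (R - norm (z - a))\<^sup>2)"
  have "continuous_on (cball a R) \<phi>"
    unfolding \<phi>_def using cont r by (intro continuous_intros continuous_on_powr') auto
  moreover have "cball a R \<noteq> {}" using \<open>0 < R\<close> by auto
  ultimately obtain z0 where z0: "z0 \<in> cball a R" "\<And>z. z \<in> cball a R \<Longrightarrow> \<phi> z \<le> \<phi> z0"
    using continuous_attains_sup[OF compact_cball] by blast
  define \<rho> where "\<rho> = R - norm (z0 - a)"
  have max: "norm (f a) powr r * R\<^sup>2 \<le> norm (f z0) powr r * \<rho>\<^sup>2"
    using z0(2)[of a] \<open>0 < R\<close> by (simp add: \<phi>_def \<rho>_def)
  show ?thesis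
  proof (cases "norm (f z0) powr r * \<rho>\<^sup>2 = 0")
    case True
    then have "norm (f a) powr r * R\<^sup>2 = 0"
      using max by (intro antisym) auto
    then have "ennreal (norm (f a) powr r * R\<^sup>2) = 0" by (simp only: ennreal_0)
    then show ?thesis by (simp only: zero_le)
  next
    case False
    define m where "m = norm (f z0)"
    have "0 \<le> \<rho>" using z0 by (simp add: \<rho>_def dist_norm norm_minus_commute)
    with False have "0 < \<rho>" "0 < m" by (auto simp: m_def)
    have sub: "ball z0 (\<rho> / 2) \<subseteq> ball a R"
      using \<open>0 < \<rho>\<close> by (subst ball_subset_ball_iff) (auto simp: \<rho>_def dist_norm field_simps)
    \<comment> \<open>On the disk of radius \<rho>/2 the distance R - |z - a| is at least \<rho>/2,
      so maximality gives |f|^r \<le> 4 m^r there, hence |f| \<le> 4^(1/r) m. The constant \<kappa>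
      is the (1 - r)-th power of this bound, and |f| = |f|^(1-r) |f|^r yields
      \<open>le\<close>.\<close>
    define \<kappa> where "\<kappa> = (4 powr (1 / r)) powr (1 - r) * m powr (1 - r)"
    have "0 \<le> \<kappa>" by (simp add: \<kappa>_def)
    have le: "norm (f z) \<le> \<kappa> * norm (f z) powr r" if "z \<in> ball z0 (\<rho> / 2)" for z
    proof (cases "f z = 0")
      case nz: False
      have "norm (z - a) \<le> norm (z - z0) + norm (z0 - a)"
        using norm_triangle_ineq[of "z - z0" "z0 - a"] by simp
      also have "norm (z - z0) < \<rho> / 2"
        using that by (simp add: dist_norm norm_minus_commute)
      finally have "\<rho> / 2 \<le> R - norm (z - a)" using \<rho>_def by linarith
      then have "(\<rho> / 2)\<^sup>2 \<le> (R - norm (z - a))\<^sup>2"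
        using \<open>0 < \<rho>\<close> by (intro power_mono) auto
      then have "norm (f z) powr r * (\<rho> / 2)\<^sup>2 \<le> \<phi> z"
        unfolding \<phi>_def by (intro mult_left_mono) auto
      also have "\<phi> z \<le> m powr r * \<rho>\<^sup>2"
        using z0(2)[of z] that sub ball_subset_cball by (auto simp: \<phi>_def m_def \<rho>_def)
      finally have "norm (f z) powr r \<le> 4 * m powr r"
        using \<open>0 < \<rho>\<close> by (simp add: power_divide field_simps)
      then have "(norm (f z) powr r) powr (1 / r) \<le> (4 * m powr r) powr (1 / r)"
        using r by (intro powr_mono2) auto
      then have "norm (f z) \<le> 4 powr (1 / r) * m"
        using r \<open>0 < m\<close> by (simp add: powr_mult powr_powr)
      then have "norm (f z) powr (1 - r) \<le> (4 powr (1 / r) * m) powr (1 - r)"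
        using r by (intro powr_mono2) auto
      also have "\<dots> = \<kappa>" using \<open>0 < m\<close> by (simp add: \<kappa>_def powr_mult)
      finally have "norm (f z) powr (1 - r) * norm (f z) powr r \<le> \<kappa> * norm (f z) powr r"
        by (intro mult_right_mono) auto
      then show ?thesis using nz by (simp flip: powr_add)
    qed auto
    have "ennreal (m * (\<rho> / 2)\<^sup>2) \<le> 32 * (\<integral>\<^sup>+z. ennreal (norm (f z)) * indicator (ball z0 (\<rho> / 2)) z \<partial>lborel)"
      unfolding m_def using \<open>0 < \<rho>\<close> by (intro area_mean_bound holomorphic_on_subset[OF hol sub]) auto
    also have "(\<integral>\<^sup>+z. ennreal (norm (f z)) * indicator (ball z0 (\<rho> / 2)) z \<partial>lborel)
        \<le> (\<integral>\<^sup>+z. ennreal \<kappa> * (ennreal (norm (f z) powr r) * indicator (ball a R) z) \<partial>lborel)"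
    proof (intro nn_integral_mono)
      fix z
      show "ennreal (norm (f z)) * indicator (ball z0 (\<rho> / 2)) z
        \<le> ennreal \<kappa> * (ennreal (norm (f z) powr r) * indicator (ball a R) z)"
        using le[of z] sub \<open>0 \<le> \<kappa>\<close>
        by (auto simp: indicator_def simp flip: ennreal_mult intro!: ennreal_leI)
    qed
    also have "\<dots> = ennreal \<kappa> * ?J"
      using hol r by (intro nn_integral_cmult)
        (auto intro!: measurable_indicator_continuous_on holomorphic_on_imp_continuous_on)
    finally have *: "ennreal (m * (\<rho> / 2)\<^sup>2) \<le> 32 * (ennreal \<kappa> * ?J)" by (simp add: mult_left_mono)
    show ?thesis
    proof (cases ?J)
      case (real j)
      have "ennreal (m * (\<rho> / 2)\<^sup>2) \<le> ennreal (32 * (\<kappa> * j))"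
        using * real \<open>0 \<le> \<kappa>\<close> by (simp add: ennreal_mult)
      then have "m * (\<rho> / 2)\<^sup>2 \<le> 32 * (\<kappa> * j)"
        using real \<open>0 \<le> \<kappa>\<close> by (subst (asm) ennreal_le_iff) auto
      then have "m * \<rho>\<^sup>2 \<le> 128 * \<kappa> * j" by (simp add: power_divide)
      then have "m powr (r - 1) * (m * \<rho>\<^sup>2) \<le> m powr (r - 1) * (128 * \<kappa> * j)"
        by (intro mult_left_mono) auto
      moreover have "m powr (r - 1) * (m * \<rho>\<^sup>2) = m powr r * \<rho>\<^sup>2"
        using \<open>0 < m\<close> by (simp add: powr_diff)
      moreover have "m powr (r - 1) * (128 * \<kappa> * j) = 128 * (4 powr (1 / r)) powr (1 - r) * j"
        using \<open>0 < m\<close> by (simp add: \<kappa>_def mult_ac flip: powr_add)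
      moreover have "(4 powr (1 / r)) powr (1 - r) \<le> (4 powr (1 / r)) powr (1::real)"
        using r by (intro powr_mono) (auto intro!: ge_one_powr_ge_zero)
      then have "128 * (4 powr (1 / r)) powr (1 - r) * j \<le> 128 * 4 powr (1 / r) * j"
        using real by (intro mult_right_mono) auto
      ultimately have "norm (f a) powr r * R\<^sup>2 \<le> 128 * 4 powr (1 / r) * j"
        using max[folded m_def] by linarith
      then show ?thesis using real by (simp flip: ennreal_mult)
    qed (simp add: ennreal_mult_top)
  qed
qed

text \<open>The exponent is brought down to at most 1 by passing to the holomorphic function f^k
  with k \<ge> r, because |f|^r = |f^k|^(r/k).\<close>

lemma submean:
  assumes "0 < r"
  obtains C :: real where "0 < C"
    "\<And>f a R. 0 < R \<Longrightarrow> continuous_on (cball a R) f \<Longrightarrow> f holomorphic_on ball a R \<Longrightarrow>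
       ennreal (norm (f a) powr r * R\<^sup>2)
         \<le> ennreal C * (\<integral>\<^sup>+z. ennreal (norm (f z) powr r) * indicator (ball a R) z \<partial>lborel)"
proof -
  define k where "k = nat \<lceil>r\<rceil>"
  have k: "0 < k" "r \<le> real k" using assms by (auto simp: k_def)
  define s where "s = r / real k"
  have s: "0 < s" "s \<le> 1" using k assms by (auto simp: s_def)
  have eq: "norm (w ^ k) powr s = norm w powr r" for w :: complex
  proof (cases "w = 0")
    case False
    then have "norm (w ^ k) = norm w powr real k" by (simp add: norm_power powr_realpow)
    then show ?thesis using k by (simp add: s_def powr_powr)
  qed (use k in \<open>simp add: power_0_left\<close>)
  show ?thesis
  proof (rule that[of "128 * 4 powr (1 / s)"])
    fix f :: "complex \<Rightarrow> complex" and a and R :: real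
    assume "0 < R" "continuous_on (cball a R) f" "f holomorphic_on ball a R"
    then show "ennreal (norm (f a) powr r * R\<^sup>2)
         \<le> ennreal (128 * 4 powr (1 / s)) * (\<integral>\<^sup>+z. ennreal (norm (f z) powr r) * indicator (ball a R) z \<partial>lborel)"
      using submean_le_1[of a R "\<lambda>z. f z ^ k" s] s
      by (simp add: eq continuous_on_power holomorphic_on_power)
  qed auto
qed

section \<open>Bergman spaces\<close>

lemma space_area_measure [simp]: "space area_measure = unit_disk"
  using sets_eq_imp_space_eq[OF sets_area_measure] by (simp add: space_restrict_space)

lemma borel_measure_on_disk_area: "borel_measure_on_disk area_measure"
  by (simp add: borel_measure_on_disk_def sets_area_measure)

lemma space_borel_measure_on_disk: "borel_measure_on_disk \<mu> \<Longrightarrow> space \<mu> = unit_disk"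
  unfolding borel_measure_on_disk_def
  by (drule sets_eq_imp_space_eq) (simp add: space_restrict_space)

lemma sets_borel_measure_on_disk:
  "borel_measure_on_disk \<mu> \<Longrightarrow> A \<in> sets \<mu> \<longleftrightarrow> A \<subseteq> unit_disk \<and> A \<in> sets borel"
  by (auto simp: borel_measure_on_disk_def sets_restrict_space_iff)

lemma holomorphic_measurable_disk:
  assumes "f holomorphic_on unit_disk" "borel_measure_on_disk \<mu>"
  shows "f \<in> borel_measurable \<mu>"
proof -
  have "f \<in> borel_measurable (restrict_space borel unit_disk)"
    using assms(1) by (intro borel_measurable_continuous_on_restrict holomorphic_on_imp_continuous_on)
  then show ?thesis
    using assms(2) measurable_cong_sets[of \<mu> "restrict_space borel unit_disk" borel borel]
    by (simp add: borel_measure_on_disk_def)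
qed

lemma nn_integral_area_measure:
  assumes "h \<in> borel_measurable area_measure"
  shows "(\<integral>\<^sup>+z. h z \<partial>area_measure) = ennreal (1 / pi) * (\<integral>\<^sup>+z. h z * indicator unit_disk z \<partial>lborel)"
proof -
  have "h \<in> borel_measurable (restrict_space lborel unit_disk)"
    using assms by (simp add: area_measure_def)
  then show ?thesis
    unfolding area_measure_def
    by (subst nn_integral_scale_measure) (auto simp: nn_integral_restrict_space)
qed

lemma bergman_space_iff:
  "f \<in> bergman_space p \<longleftrightarrow> f holomorphic_on unit_disk \<and> qmom p area_measure f < \<infinity>"
  using holomorphic_measurable_disk[OF _ borel_measure_on_disk_area]
  by (auto simp: bergman_space_def Lq_fun_iff_qmom)

lemma bergman_measurable:
  "f \<in> bergman_space p \<Longrightarrow> borel_measure_on_disk \<mu> \<Longrightarrow> f \<in> borel_measurable \<mu>"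
  by (auto simp: bergman_space_iff intro: holomorphic_measurable_disk)

lemmas bergman_measurable_area = bergman_measurable[OF _ borel_measure_on_disk_area]

lemma bergman_lincomb:
  assumes "f \<in> bergman_space p" "g \<in> bergman_space p" "0 < p"
  shows "(\<lambda>z. f z + g z) \<in> bergman_space p" "(\<lambda>z. f z - g z) \<in> bergman_space p"
    "(\<lambda>z. c * f z) \<in> bergman_space p"
  using Lq_fun_lincomb[of f p area_measure g] assms
  by (auto simp: bergman_space_def intro!: holomorphic_intros)

lemma zero_in_bergman [simp]: "(\<lambda>z. 0) \<in> bergman_space p"
  by (simp add: bergman_space_iff)

lemma bergman_if_bounded:
  assumes "f holomorphic_on unit_disk" "\<And>z. z \<in> unit_disk \<Longrightarrow> norm (f z) \<le> B" "0 < p"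
  shows "f \<in> bergman_space p"
  using assms Lq_fun_if_bounded[of f area_measure B p]
    holomorphic_measurable_disk[OF assms(1) borel_measure_on_disk_area]
  by (simp add: bergman_space_def emeasure_area_measure_disk)

text \<open>The integral is kept local because \<open>q_le_p\<close> adds up such integrals over
  disjoint disks. Taking half the distance to the boundary keeps the closed disk inside the unit
  disk and costs a factor 4.\<close>

lemma bergman_submean:
  assumes "0 < p"
  obtains C :: real where "0 < C"
    "\<And>f a. f holomorphic_on unit_disk \<Longrightarrow> a \<in> unit_disk \<Longrightarrow>
       ennreal (norm (f a) powr p * (1 - norm a)\<^sup>2) \<le> ennreal C *
         (\<integral>\<^sup>+z. ennreal (norm (f z) powr p) * indicator (ball a ((1 - norm a) / 2)) z \<partial>area_measure)"
proof -
  obtain C0 :: real where C0: "0 < C0" "\<And>f a R. 0 < R \<Longrightarrow> continuous_on (cball a R) f \<Longrightarrow> f holomorphic_on ball a R \<Longrightarrow>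
       ennreal (norm (f a) powr p * R\<^sup>2)
         \<le> ennreal C0 * (\<integral>\<^sup>+z. ennreal (norm (f z) powr p) * indicator (ball a R) z \<partial>lborel)"
    using submean[OF assms] by blast
  show ?thesis
  proof (rule that[of "4 * C0 * pi"])
    fix f :: "complex \<Rightarrow> complex" and a :: complex
    assume f: "f holomorphic_on unit_disk" and a: "a \<in> unit_disk"
    define R where "R = (1 - norm a) / 2"
    have "0 < R" using a by (simp add: R_def)
    have sub: "cball a R \<subseteq> unit_disk"
      using a by (subst cball_subset_ball_iff) (auto simp: R_def dist_norm field_simps)
    then have sub': "ball a R \<subseteq> unit_disk" using ball_subset_cball by blast
    let ?J = "\<integral>\<^sup>+z. ennreal (norm (f z) powr p) * indicator (ball a R) z \<partial>lborel"
    have [measurable]: "f \<in> borel_measurable area_measure"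
      by (rule holomorphic_measurable_disk[OF f borel_measure_on_disk_area])
    have [measurable]: "ball a R \<in> sets area_measure"
      using sub' by (simp add: sets_borel_measure_on_disk[OF borel_measure_on_disk_area])
    have "(\<integral>\<^sup>+z. ennreal (norm (f z) powr p) * indicator (ball a R) z \<partial>area_measure)
        = ennreal (1 / pi) * (\<integral>\<^sup>+z. ennreal (norm (f z) powr p) * indicator (ball a R) z * indicator unit_disk z \<partial>lborel)"
      by (rule nn_integral_area_measure) measurable
    also have "(\<integral>\<^sup>+z. ennreal (norm (f z) powr p) * indicator (ball a R) z * indicator unit_disk z \<partial>lborel) = ?J"
      using sub' by (intro nn_integral_cong) (auto simp: indicator_def)
    finally have "ennreal (4 * C0 * pi) * (\<integral>\<^sup>+z. ennreal (norm (f z) powr p) * indicator (ball a R) z \<partial>area_measure)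
        = ennreal (4 * C0 * pi) * ennreal (1 / pi) * ?J"
      by (simp add: mult.assoc)
    also have "ennreal (4 * C0 * pi) * ennreal (1 / pi) = ennreal (4 * C0)"
      using C0 by (simp flip: ennreal_mult)
    finally have eq: "ennreal (4 * C0 * pi) * (\<integral>\<^sup>+z. ennreal (norm (f z) powr p) * indicator (ball a R) z \<partial>area_measure)
        = ennreal (4 * C0) * ?J" .
    have "ennreal (norm (f a) powr p * (1 - norm a)\<^sup>2) = ennreal (4 * (norm (f a) powr p * R\<^sup>2))"
      by (simp add: R_def power_divide)
    also have "\<dots> = 4 * ennreal (norm (f a) powr p * R\<^sup>2)"
      by (subst ennreal_mult) auto
    also have "\<dots> \<le> 4 * (ennreal C0 * ?J)"
      using sub sub' f \<open>0 < R\<close>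
      by (intro mult_left_mono C0) (auto intro: holomorphic_on_imp_continuous_on holomorphic_on_subset)
    also have "\<dots> = ennreal (4 * C0) * ?J"
      using C0(1) by (simp add: ennreal_mult mult.assoc)
    finally show "ennreal (norm (f a) powr p * (1 - norm a)\<^sup>2) \<le> ennreal (4 * C0 * pi) *
         (\<integral>\<^sup>+z. ennreal (norm (f z) powr p) * indicator (ball a ((1 - norm a) / 2)) z \<partial>area_measure)"
      using eq by (simp add: R_def)
  qed (use C0 in auto)
qed

lemma bergman_point_bound:
  assumes "0 < p"
  obtains C :: real where "0 < C"
    "\<And>f a. f holomorphic_on unit_disk \<Longrightarrow> a \<in> unit_disk \<Longrightarrow>
       ennreal (norm (f a) powr p * (1 - norm a)\<^sup>2) \<le> ennreal C * qmom p area_measure f"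
proof -
  obtain C :: real where C: "0 < C" "\<And>f a. f holomorphic_on unit_disk \<Longrightarrow> a \<in> unit_disk \<Longrightarrow>
       ennreal (norm (f a) powr p * (1 - norm a)\<^sup>2) \<le> ennreal C *
         (\<integral>\<^sup>+z. ennreal (norm (f z) powr p) * indicator (ball a ((1 - norm a) / 2)) z \<partial>area_measure)"
    using bergman_submean[OF assms] by blast
  show ?thesis
  proof (rule that[OF C(1)])
    fix f :: "complex \<Rightarrow> complex" and a :: complex
    assume fa: "f holomorphic_on unit_disk" "a \<in> unit_disk"
    have "(\<integral>\<^sup>+z. ennreal (norm (f z) powr p) * indicator (ball a ((1 - norm a) / 2)) z \<partial>area_measure)
      \<le> qmom p area_measure f"
      unfolding qmom_def by (intro nn_integral_mono) (auto simp: indicator_def)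
    then show "ennreal (norm (f a) powr p * (1 - norm a)\<^sup>2) \<le> ennreal C * qmom p area_measure f"
      by (intro order_trans[OF C(2)[OF fa]] mult_left_mono) auto
  qed
qed

text \<open>Point evaluations are bounded uniformly on compact sets, so a moment bound makes the
  sequence a normal family, and Fatou's lemma keeps the same bound B for the limit. This takes the
  place of weak compactness at every exponent.\<close>

lemma bergman_montel:
  assumes "0 < p" and F: "\<And>n. F n \<in> bergman_space p" and B: "\<And>n. qmom p area_measure (F n) \<le> ennreal B"
  obtains f \<tau> where "f \<in> bergman_space p" "qmom p area_measure f \<le> ennreal B" "strict_mono (\<tau> :: nat \<Rightarrow> nat)"
    "\<And>z. z \<in> unit_disk \<Longrightarrow> (\<lambda>n. F (\<tau> n) z) \<longlonglongrightarrow> f z"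
proof -
  obtain C :: real where C: "0 < C" "\<And>f a. f holomorphic_on unit_disk \<Longrightarrow> a \<in> unit_disk \<Longrightarrow>
       ennreal (norm (f a) powr p * (1 - norm a)\<^sup>2) \<le> ennreal C * qmom p area_measure f"
    using bergman_point_bound[OF \<open>0 < p\<close>] by blast
  have hol: "F n holomorphic_on unit_disk" for n using F by (auto simp: bergman_space_iff)
  \<comment> \<open>\<open>ennreal B\<close> is 0 for negative B, hence the
    \<open>max\<close>.\<close>
  have pb: "norm (F n z) powr p * (1 - norm z)\<^sup>2 \<le> C * max 0 B" if "z \<in> unit_disk" for n z
  proof -
    have "ennreal (norm (F n z) powr p * (1 - norm z)\<^sup>2) \<le> ennreal C * ennreal B"
      by (intro order_trans[OF C(2)[OF hol that]] mult_left_mono B) auto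
    also have "\<dots> = ennreal (C * max 0 B)"
      using C(1) by (simp add: ennreal_mult max_def ennreal_neg)
    finally show ?thesis using C(1) by (subst (asm) ennreal_le_iff) auto
  qed
  have bd: "\<exists>D. \<forall>h\<in>range F. \<forall>z\<in>K. norm (h z) \<le> D" if "compact K" "K \<subseteq> unit_disk" for K
  proof (cases "K = {}")
    case False
    obtain w where w: "w \<in> K" "\<And>z. z \<in> K \<Longrightarrow> norm z \<le> norm w"
      using continuous_attains_sup[OF \<open>compact K\<close> False, of norm] by (auto intro: continuous_intros)
    then have "norm w < 1" using that by auto
    have "norm (F n z) \<le> (C * max 0 B / (1 - norm w)\<^sup>2) powr (1 / p)" if "z \<in> K" for n z
    proof -
      have "z \<in> unit_disk" using that \<open>K \<subseteq> unit_disk\<close> by blast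
      have "norm (F n z) powr p * (1 - norm w)\<^sup>2 \<le> norm (F n z) powr p * (1 - norm z)\<^sup>2"
        using w(2)[OF that] \<open>norm w < 1\<close> by (intro mult_left_mono power_mono) auto
      also have "\<dots> \<le> C * max 0 B" by (rule pb) fact
      finally have "norm (F n z) powr p \<le> C * max 0 B / (1 - norm w)\<^sup>2"
        using \<open>norm w < 1\<close> by (simp add: field_simps)
      then have "(norm (F n z) powr p) powr (1 / p) \<le> (C * max 0 B / (1 - norm w)\<^sup>2) powr (1 / p)"
        using \<open>0 < p\<close> by (intro powr_mono2) auto
      then show ?thesis using \<open>0 < p\<close> by (simp add: powr_powr)
    qed
    then show ?thesis by auto
  qed auto
  obtain f \<tau> where f: "f holomorphic_on unit_disk" "strict_mono (\<tau> :: nat \<Rightarrow> nat)"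
    "\<And>z. z \<in> unit_disk \<Longrightarrow> (\<lambda>n. F (\<tau> n) z) \<longlonglongrightarrow> f z"
  proof (rule Montel[of unit_disk "range F" F])
    show "\<exists>D. \<forall>h\<in>range F. \<forall>z\<in>K. norm (h z) \<le> D" if "compact K" "K \<subseteq> unit_disk" for K
      using bd[OF that] .
  qed (use hol in auto)
  have "qmom p area_measure f \<le> ennreal B"
  proof (rule qmom_le_limit)
    show "AE z in area_measure. (\<lambda>n. F (\<tau> n) z) \<longlonglongrightarrow> f z"
      using f(3) by (intro AE_I2) simp
  qed (use F B f(1) \<open>0 < p\<close> in \<open>auto intro: bergman_measurable_area holomorphic_measurable_disk borel_measure_on_disk_area\<close>)
  moreover from this have "f \<in> bergman_space p"
    using f(1) by (auto simp: bergman_space_iff intro: le_less_trans)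
  ultimately show ?thesis using that f(2,3) by blast
qed

text \<open>Fatou's lemma for F_n - g along the Montel subsequence compares the pointwise limit f
  with g directly, so no almost everywhere convergent subsequence has to be extracted from the
  convergence in moment.\<close>

lemma bergman_limit_in_Lq:
  assumes "0 < p" "0 < q" and \<mu>: "borel_measure_on_disk \<mu>"
    and F: "\<And>n. F n \<in> bergman_space p" and B: "\<And>n. qmom p area_measure (F n) \<le> ennreal B"
    and g: "g \<in> borel_measurable \<mu>" and lim: "(\<lambda>n. qmom q \<mu> (\<lambda>z. F n z - g z)) \<longlonglongrightarrow> 0"
  obtains f where "f \<in> bergman_space p" "qmom p area_measure f \<le> ennreal B" "AE z in \<mu>. f z = g z"
proof -
  obtain f \<tau> where f: "f \<in> bergman_space p" "qmom p area_measure f \<le> ennreal B" "strict_mono (\<tau> :: nat \<Rightarrow> nat)"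
    "\<And>z. z \<in> unit_disk \<Longrightarrow> (\<lambda>n. F (\<tau> n) z) \<longlonglongrightarrow> f z"
    by (rule bergman_montel[where F = F and B = B, OF \<open>0 < p\<close> F B]) (rule that; assumption)
  note [measurable] = g bergman_measurable[OF f(1) \<mu>] bergman_measurable[OF F \<mu>]
  have "qmom q \<mu> (\<lambda>z. f z - g z) \<le> ennreal e" if "0 < e" for e
  proof (rule qmom_le_limit)
    show "AE z in \<mu>. (\<lambda>n. F (\<tau> n) z - g z) \<longlonglongrightarrow> f z - g z"
      using f(4) by (intro AE_I2 tendsto_diff) (auto simp: space_borel_measure_on_disk[OF \<mu>])
    have "(\<lambda>n. qmom q \<mu> (\<lambda>z. F (\<tau> n) z - g z)) \<longlonglongrightarrow> 0"
      using LIMSEQ_subseq_LIMSEQ[OF lim f(3)] by (simp add: o_def)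
    then have "\<forall>\<^sub>F n in sequentially. qmom q \<mu> (\<lambda>z. F (\<tau> n) z - g z) < ennreal e"
      using that by (intro order_tendstoD(2)[where a = "ennreal e"]) auto
    then show "\<forall>\<^sub>F n in sequentially. qmom q \<mu> (\<lambda>z. F (\<tau> n) z - g z) \<le> ennreal e"
      by eventually_elim simp
  qed (use \<open>0 < q\<close> in simp_all)
  then have "qmom q \<mu> (\<lambda>z. f z - g z) \<le> 0"
    using ennreal_le_epsilon[of 0 "qmom q \<mu> (\<lambda>z. f z - g z)"] by (simp only: add_0_left)
  then have "qmom q \<mu> (\<lambda>z. f z - g z) = 0"
    by (simp only: le_zero_eq)
  then have "AE z in \<mu>. f z = g z"
    by (simp add: qmom_eq_0_iff)
  with f that show ?thesis by blast
qed

section \<open>A gliding hump version of the uniform boundedness principle\<close>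

text \<open>Abstract so that it serves twice: N and M are the A^p and L^q(\<mu>) moments for
  boundedness, and the L^q(\<mu>) moment and the quotient moment of A^p for openness. If M is
  unbounded on all small N-balls, one builds balls on which M is at least k, with centres so close
  that their limit, supplied by \<open>complete\<close>, lies in all of them; this contradicts
  \<open>M_finite\<close>. \<open>L\<close> is the rate at which the radii must shrink for
  \<open>complete\<close> to apply.\<close>

lemma gliding_hump_bounded:
  fixes N M :: "('a \<Rightarrow> complex) \<Rightarrow> ennreal" and K L :: real
  assumes K: "1 \<le> K"
    and X0: "(\<lambda>z. 0) \<in> X"
    and X_add: "\<And>f g. f \<in> X \<Longrightarrow> g \<in> X \<Longrightarrow> (\<lambda>z. f z + g z) \<in> X"
    and X_diff: "\<And>f g. f \<in> X \<Longrightarrow> g \<in> X \<Longrightarrow> (\<lambda>z. f z - g z) \<in> X"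
    and N0: "N (\<lambda>z. 0) = 0"
    and N_minus: "\<And>f. f \<in> X \<Longrightarrow> N (\<lambda>z. - f z) = N f"
    and N_add: "\<And>f g. f \<in> X \<Longrightarrow> g \<in> X \<Longrightarrow> N (\<lambda>z. f z + g z) \<le> ennreal K * (N f + N g)"
    and M_finite: "\<And>f. f \<in> X \<Longrightarrow> M f < \<infinity>"
    and M_pm: "\<And>f g c. f \<in> X \<Longrightarrow> g \<in> X \<Longrightarrow> M (\<lambda>z. g z + f z) < c \<Longrightarrow> M (\<lambda>z. g z - f z) < c \<Longrightarrow> M f \<le> c + c"
    and M_lsc: "\<And>g G c. g \<in> X \<Longrightarrow> (\<And>n. G n \<in> X) \<Longrightarrow> (\<lambda>n. N (\<lambda>z. G n z - g z)) \<longlonglongrightarrow> 0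
      \<Longrightarrow> (\<And>n. M (G n) < ennreal c) \<Longrightarrow> M g \<le> ennreal c"
    and complete: "\<And>S \<rho>. (\<And>n. S n \<in> X) \<Longrightarrow> (\<And>k. 0 < \<rho> k) \<Longrightarrow> (\<And>k. \<rho> (Suc k) \<le> \<rho> k / L)
      \<Longrightarrow> (\<And>k n. k \<le> n \<Longrightarrow> N (\<lambda>z. S n z - S k z) \<le> ennreal (\<rho> k))
      \<Longrightarrow> \<exists>g\<in>X. \<forall>k. N (\<lambda>z. g z - S k z) \<le> ennreal (\<rho> k)"
    and L: "1 \<le> L"
  shows "\<exists>\<epsilon>>0. \<exists>C>0. \<forall>f\<in>X. N f \<le> ennreal \<epsilon> \<longrightarrow> M f \<le> ennreal C"
proof (rule ccontr)
  assume "\<not> ?thesis"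
  then have H: "\<exists>f\<in>X. N f \<le> ennreal \<epsilon> \<and> ennreal C < M f" if "0 < \<epsilon>" "0 < C" for \<epsilon> C
    using that by (meson not_le)
  define P where "P = (\<lambda>k (S, \<rho>). S \<in> X \<and> 0 < \<rho> \<and>
    (\<forall>h\<in>X. N h \<le> ennreal \<rho> \<longrightarrow> ennreal (real k) \<le> M (\<lambda>z. S z + h z)))"
  define Q where "Q = (\<lambda>(k::nat) (S, \<rho>) (S', \<rho>').
    N (\<lambda>z. S' z - S z) \<le> ennreal (\<rho> / (2 * K)) \<and> \<rho>' \<le> \<rho> / (2 * K) \<and> \<rho>' \<le> \<rho> / L)"
  have "\<exists>F. \<forall>k. P k (F k) \<and> Q k (F k) (F (Suc k))"
  proof (rule dependent_nat_choice)
    show "\<exists>x. P 0 x"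
      using X0 by (intro exI[of _ "(\<lambda>z. 0, 1)"]) (simp add: P_def)
  next
    fix x k assume x: "P k x"
    obtain S \<rho> where [simp]: "x = (S, \<rho>)" by (cases x)
    have S: "S \<in> X" "0 < \<rho>" using x by (auto simp: P_def)
    \<comment> \<open>By \<open>M_pm\<close>, a value of M f beyond 2 (k + 2) forces M of S + f or
      of S - f up to k + 2. The choice of sign replaces a reverse triangle inequality.\<close>
    obtain f where f: "f \<in> X" "N f \<le> ennreal (\<rho> / (2 * K))" "ennreal (2 * (real k + 2)) < M f"
      using H[of "\<rho> / (2 * K)" "2 * (real k + 2)"] S K by auto
    have notboth: "\<not> (M (\<lambda>z. S z + f z) < ennreal (real k + 2) \<and> M (\<lambda>z. S z - f z) < ennreal (real k + 2))"
    proof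
      assume "M (\<lambda>z. S z + f z) < ennreal (real k + 2) \<and> M (\<lambda>z. S z - f z) < ennreal (real k + 2)"
      then have "M f \<le> ennreal (real k + 2) + ennreal (real k + 2)"
        using M_pm[OF f(1) S(1)] by blast
      also have "\<dots> = ennreal (2 * (real k + 2))" by (simp flip: ennreal_plus)
      finally show False using f(3) by simp
    qed
    then have "\<exists>S'\<in>X. N (\<lambda>z. S' z - S z) \<le> ennreal (\<rho> / (2 * K)) \<and> ennreal (real k + 2) \<le> M S'"
    proof (cases "M (\<lambda>z. S z + f z) < ennreal (real k + 2)")
      case True
      with notboth show ?thesis
        using f S X_diff by (intro bexI[of _ "\<lambda>z. S z - f z"]) (auto simp: N_minus not_less)
    next
      case False
      then show ?thesis
        using f S X_add by (intro bexI[of _ "\<lambda>z. S z + f z"]) (auto simp: not_less)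
    qed
    then obtain S' where S': "S' \<in> X" "N (\<lambda>z. S' z - S z) \<le> ennreal (\<rho> / (2 * K))" "ennreal (real k + 2) \<le> M S'"
      by blast
    \<comment> \<open>Lower semicontinuity spreads the bound at S' to a ball: the drop from k + 2 to
      k + 1 leaves the room for a contradiction.\<close>
    have "\<exists>\<delta>>0. \<forall>h\<in>X. N h \<le> ennreal \<delta> \<longrightarrow> ennreal (real (Suc k)) \<le> M (\<lambda>z. S' z + h z)"
    proof (rule ccontr)
      assume "\<not> ?thesis"
      then have "\<exists>h\<in>X. N h \<le> ennreal (inverse (real (Suc n))) \<and> M (\<lambda>z. S' z + h z) < ennreal (real (Suc k))" for n
        by (meson not_le inverse_positive_iff_positive of_nat_0_less_iff zero_less_Suc)
      then obtain h where h: "\<And>n. h n \<in> X" "\<And>n. N (h n) \<le> ennreal (inverse (real (Suc n)))"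
        "\<And>n. M (\<lambda>z. S' z + h n z) < ennreal (real (Suc k))" by metis
      have "(\<lambda>n. N (h n)) \<longlonglongrightarrow> ennreal 0"
      proof (rule tendsto_sandwich[where f = "\<lambda>_. 0" and h = "\<lambda>n. ennreal (inverse (real (Suc n)))"])
        show "\<forall>\<^sub>F n in sequentially. N (h n) \<le> ennreal (inverse (real (Suc n)))"
          using h(2) by (intro always_eventually allI)
        show "(\<lambda>n. ennreal (inverse (real (Suc n)))) \<longlonglongrightarrow> ennreal 0"
          by (intro tendsto_ennrealI LIMSEQ_inverse_real_of_nat)
      qed (auto intro!: always_eventually tendsto_const)
      then have "(\<lambda>n. N (\<lambda>z. (S' z + h n z) - S' z)) \<longlonglongrightarrow> 0"
        by simp
      then have "M S' \<le> ennreal (real (Suc k))"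
        by (intro M_lsc[where G = "\<lambda>n z. S' z + h n z"]) (use S' h X_add in auto)
      with S'(3) have "ennreal (real k + 2) \<le> ennreal (real (Suc k))" by (rule order_trans)
      then show False by (subst (asm) ennreal_le_iff) auto
    qed
    then obtain \<delta> where \<delta>: "0 < \<delta>" "\<And>h. h \<in> X \<Longrightarrow> N h \<le> ennreal \<delta> \<Longrightarrow> ennreal (real (Suc k)) \<le> M (\<lambda>z. S' z + h z)"
      by blast
    define \<rho>' where "\<rho>' = min \<delta> (min (\<rho> / (2 * K)) (\<rho> / L))"
    have "ennreal \<rho>' \<le> ennreal \<delta>" by (simp add: \<rho>'_def ennreal_leI)
    then have "ennreal (real (Suc k)) \<le> M (\<lambda>z. S' z + h z)" if "h \<in> X" "N h \<le> ennreal \<rho>'" for h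
      using \<delta>(2)[OF that(1)] that(2) by (meson order_trans)
    moreover have "0 < \<rho>'" using \<delta>(1) S K L by (simp add: \<rho>'_def)
    ultimately have "P (Suc k) (S', \<rho>')"
      using S'(1) by (auto simp only: P_def split)
    moreover have "Q k x (S', \<rho>')"
      using S' by (auto simp: Q_def \<rho>'_def)
    ultimately show "\<exists>y. P (Suc k) y \<and> Q k x y" by blast
  qed
  then obtain F where F: "\<And>k. P k (F k)" "\<And>k. Q k (F k) (F (Suc k))" by blast
  define S where "S = (\<lambda>k. fst (F k))"
  define \<rho> where "\<rho> = (\<lambda>k. snd (F k))"
  have P: "S k \<in> X" "0 < \<rho> k" "\<And>h. h \<in> X \<Longrightarrow> N h \<le> ennreal (\<rho> k) \<Longrightarrow> ennreal (real k) \<le> M (\<lambda>z. S k z + h z)" for k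
    using F(1)[of k] by (auto simp: P_def S_def \<rho>_def split: prod.splits)
  have Q: "N (\<lambda>z. S (Suc k) z - S k z) \<le> ennreal (\<rho> k / (2 * K))" "\<rho> (Suc k) \<le> \<rho> k / (2 * K)" "\<rho> (Suc k) \<le> \<rho> k / L" for k
    using F(2)[of k] by (auto simp: Q_def S_def \<rho>_def split: prod.splits)
  \<comment> \<open>The first increment is split off, not the last, so that the constant K does not
    accumulate: the induction hypothesis at k + 1 bounds the remainder by \<rho>(k + 1) \<le>
    \<rho>(k) / (2 K), and K times the two halves gives \<rho>(k).\<close>
  have *: "N (\<lambda>z. S (k + m) z - S k z) \<le> ennreal (\<rho> k)" for k m
  proof (induction m arbitrary: k)
    case (Suc m)
    have "N (\<lambda>z. S (k + Suc m) z - S k z) = N (\<lambda>z. (S (Suc k + m) z - S (Suc k) z) + (S (Suc k) z - S k z))"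
      by simp
    also have "\<dots> \<le> ennreal K * (N (\<lambda>z. S (Suc k + m) z - S (Suc k) z) + N (\<lambda>z. S (Suc k) z - S k z))"
      by (intro N_add X_diff P)
    also have "\<dots> \<le> ennreal K * (ennreal (\<rho> k / (2 * K)) + ennreal (\<rho> k / (2 * K)))"
      using Suc[of "Suc k"] Q(2)[of k] by (intro mult_left_mono add_mono Q(1)) (auto intro: order_trans ennreal_leI)
    also have "\<dots> = ennreal (\<rho> k)"
      using K P(2)[of k] by (simp flip: ennreal_plus ennreal_mult)
    finally show ?case .
  qed (simp add: N0)
  have "\<exists>g\<in>X. \<forall>k. N (\<lambda>z. g z - S k z) \<le> ennreal (\<rho> k)"
  proof (rule complete)
    fix k n :: nat assume "k \<le> n"
    then show "N (\<lambda>z. S n z - S k z) \<le> ennreal (\<rho> k)" using *[of k "n - k"] by simp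
  qed (use P Q in auto)
  then obtain g where g: "g \<in> X" "\<And>k. N (\<lambda>z. g z - S k z) \<le> ennreal (\<rho> k)" by blast
  have "ennreal (real k) \<le> M g" for k
    using P(3)[of "\<lambda>z. g z - S k z" k] X_diff[OF g(1) P(1)] g(2) by simp
  moreover obtain m where m: "M g = ennreal m" "0 \<le> m" using M_finite[OF g(1)] by (cases "M g") auto
  moreover obtain k :: nat where "m < real k" using reals_Archimedean2 by blast
  ultimately have "ennreal (real k) \<le> ennreal m" by metis
  with \<open>m < real k\<close> m(2) show False by simp
qed

section \<open>Boundedness and openness of the embedding\<close>

text \<open>A real-valued form of the moment, for scaling and for comparing powers. It agrees with
  \<open>qmom\<close> on \<open>Lq_fun\<close>; a divergent integral has the value 0, so bounds
  carry information only there.\<close>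

definition mom :: "real \<Rightarrow> 'a measure \<Rightarrow> ('a \<Rightarrow> complex) \<Rightarrow> real" where
  "mom r M f = (\<integral>z. norm (f z) powr r \<partial>M)"

lemma mom_nonneg [simp]: "0 \<le> mom r M f"
  by (simp add: mom_def)

lemma mom_zero [simp]: "mom r M (\<lambda>z. 0) = 0"
  by (simp add: mom_def)

lemma qmom_eq_mom: "f \<in> Lq_fun r M \<Longrightarrow> qmom r M f = ennreal (mom r M f)"
  unfolding qmom_def mom_def Lq_fun_def by (intro nn_integral_eq_integral) auto

lemma mom_le_iff: "f \<in> Lq_fun r M \<Longrightarrow> 0 \<le> B \<Longrightarrow> mom r M f \<le> B \<longleftrightarrow> qmom r M f \<le> ennreal B"
  by (simp add: qmom_eq_mom)

lemma mom_scale: "mom r M (\<lambda>z. c * f z) = norm c powr r * mom r M f"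
  by (simp add: mom_def norm_mult powr_mult)

lemma bergman_Lq: "f \<in> bergman_space p \<Longrightarrow> f \<in> Lq_fun p area_measure"
  by (simp add: bergman_space_def)

lemma bergman_mom_pos:
  assumes "0 < p" "f \<in> bergman_space p" "z \<in> unit_disk" "f z \<noteq> 0"
  shows "0 < mom p area_measure f"
proof (rule ccontr)
  assume "\<not> ?thesis"
  then have "mom p area_measure f = 0" by (simp add: antisym not_less)
  then have "qmom p area_measure f = 0" using assms by (simp add: qmom_eq_mom bergman_Lq)
  moreover obtain C :: real where "\<And>f a. f holomorphic_on unit_disk \<Longrightarrow> a \<in> unit_disk \<Longrightarrow>
       ennreal (norm (f a) powr p * (1 - norm a)\<^sup>2) \<le> ennreal C * qmom p area_measure f"
    using bergman_point_bound[OF \<open>0 < p\<close>] by blast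
  ultimately have "ennreal (norm (f z) powr p * (1 - norm z)\<^sup>2) \<le> 0"
    using assms by (metis bergman_space_iff mult_zero_right)
  then show False using assms by (simp add: ennreal_eq_0_iff mult_le_0_iff not_le)
qed

lemma bergman_pointwise_limit:
  assumes "0 < p" and G: "\<And>n. G n \<in> bergman_space p" and g: "g \<in> bergman_space p"
    and lim: "(\<lambda>n. qmom p area_measure (\<lambda>z. G n z - g z)) \<longlonglongrightarrow> 0" and z: "z \<in> unit_disk"
  shows "(\<lambda>n. G n z) \<longlonglongrightarrow> g z"
proof -
  obtain C :: real where C: "0 < C" "\<And>f a. f holomorphic_on unit_disk \<Longrightarrow> a \<in> unit_disk \<Longrightarrow>
       ennreal (norm (f a) powr p * (1 - norm a)\<^sup>2) \<le> ennreal C * qmom p area_measure f"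
    using bergman_point_bound[OF \<open>0 < p\<close>] by blast
  define d where "d = (1 - norm z)\<^sup>2"
  have "0 < d" using z by (auto simp: d_def)
  define x where "x = (\<lambda>n. norm (G n z - g z))"
  have x0: "0 \<le> x n" for n by (simp add: x_def)
  have "(\<lambda>n. ennreal (x n powr p * d)) \<longlonglongrightarrow> 0"
  proof (rule tendsto_sandwich[where f = "\<lambda>_. 0" and h = "\<lambda>n. ennreal C * qmom p area_measure (\<lambda>z. G n z - g z)"])
    show "\<forall>\<^sub>F n in sequentially. ennreal (x n powr p * d) \<le> ennreal C * qmom p area_measure (\<lambda>z. G n z - g z)"
      unfolding x_def d_def using G g z
      by (intro always_eventually allI C(2)[where f = "\<lambda>z. G _ z - g z"] holomorphic_on_diff) (auto simp: bergman_space_iff)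
    show "(\<lambda>n. ennreal C * qmom p area_measure (\<lambda>z. G n z - g z)) \<longlonglongrightarrow> 0"
      using ennreal_tendsto_cmult[OF _ lim, of "ennreal C"] by simp
  qed auto
  then have "(\<lambda>n. x n powr p * d) \<longlonglongrightarrow> 0"
    using \<open>0 < d\<close> by (subst (asm) ennreal_0[symmetric], subst (asm) tendsto_ennreal_iff) auto
  from tendsto_divide[OF this tendsto_const[of d]] have "(\<lambda>n. x n powr p) \<longlonglongrightarrow> 0"
    using \<open>0 < d\<close> by simp
  then have "(\<lambda>n. (x n powr p) powr (1 / p)) \<longlonglongrightarrow> 0 powr (1 / p)"
    using \<open>0 < p\<close> by (intro tendsto_powr') auto
  then have "x \<longlonglongrightarrow> 0"
    using \<open>0 < p\<close> x0 by (simp add: powr_powr)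
  then show ?thesis
    unfolding x_def by (simp add: tendsto_norm_zero_iff LIM_zero_iff)
qed

text \<open>Homogeneity: c brings the source moment t to \<epsilon>, and s is the target moment
  before scaling. This turns a bound on a small ball into a power inequality; for openness it is
  used with p and q exchanged.\<close>

lemma mom_bound_by_scaling:
  assumes "0 < p" "0 < q" "0 < \<epsilon>" "0 < C" "0 < t"
    and "norm c = (\<epsilon> / t) powr (1 / p)" and "norm c powr q * s \<le> C"
  shows "s \<le> C * \<epsilon> powr (- (q / p)) * t powr (q / p)"
proof -
  have c: "norm c powr q = (\<epsilon> / t) powr (q / p)"
    using assms by (simp add: powr_powr)
  have "s * (\<epsilon> / t) powr (q / p) \<le> C"
    using assms(7) by (simp add: c mult.commute)
  then have "s \<le> C / (\<epsilon> / t) powr (q / p)"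
    using assms by (simp add: pos_le_divide_eq)
  also have "\<dots> = C * \<epsilon> powr (- (q / p)) * t powr (q / p)"
    using assms by (simp add: powr_divide powr_minus field_simps)
  finally show ?thesis .
qed

lemma pq_bergman_carlesonD:
  assumes "pq_bergman_carleson p q \<mu>"
  shows "borel_measure_on_disk \<mu>" "f \<in> bergman_space p \<Longrightarrow> f \<in> Lq_fun q \<mu>"
  using assms by (auto simp: pq_bergman_carleson_def)

text \<open>Only the inclusion of A^p in L^q(\<mu>) is given, so continuity has to be proved.
  Convergence in A^p implies pointwise convergence, and then Fatou's lemma makes the L^q(\<mu>)
  moment lower semicontinuous.\<close>

lemma embedding_bounded:
  assumes p: "0 < p" and q: "0 < q" and \<mu>: "pq_bergman_carleson p q \<mu>"
  obtains C where "0 < C" "\<And>f. f \<in> bergman_space p \<Longrightarrow> mom q \<mu> f \<le> C * mom p area_measure f powr (q / p)"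
proof -
  note bm = pq_bergman_carlesonD(1)[OF \<mu>] and Lq = pq_bergman_carlesonD(2)[OF \<mu>]
  note meas = bergman_measurable[OF _ bm] bergman_measurable_area
  have "\<exists>\<epsilon>>0. \<exists>C>0. \<forall>f\<in>bergman_space p. qmom p area_measure f \<le> ennreal \<epsilon> \<longrightarrow> qmom q \<mu> f \<le> ennreal C"
  proof (rule gliding_hump_bounded[where K = "2 powr p" and L = 1])
    show "1 \<le> 2 powr p" using p by (simp add: ge_one_powr_ge_zero)
    show "qmom q \<mu> f < \<infinity>" if "f \<in> bergman_space p" for f
      using Lq[OF that] by (simp add: Lq_fun_iff_qmom)
    show "qmom q \<mu> f \<le> c + c" if "f \<in> bergman_space p" "g \<in> bergman_space p"
      "qmom q \<mu> (\<lambda>z. g z + f z) < c" "qmom q \<mu> (\<lambda>z. g z - f z) < c" for f g c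
      using qmom_le_plus_minus[OF meas(1)[OF that(1)] meas(1)[OF that(2)] q] that(3,4)
      by (meson add_mono less_imp_le order_trans)
    show "qmom q \<mu> g \<le> ennreal c"
      if g: "g \<in> bergman_space p" and G: "\<And>n. G n \<in> bergman_space p"
        and lim: "(\<lambda>n. qmom p area_measure (\<lambda>z. G n z - g z)) \<longlonglongrightarrow> 0"
        and c: "\<And>n. qmom q \<mu> (G n) < ennreal c" for g G c
    proof (rule qmom_le_limit[where F = G])
      show "AE z in \<mu>. (\<lambda>n. G n z) \<longlonglongrightarrow> g z"
        using bergman_pointwise_limit[OF p G g lim]
        by (intro AE_I2) (simp add: space_borel_measure_on_disk[OF bm])
      show "\<forall>\<^sub>F n in sequentially. qmom q \<mu> (G n) \<le> ennreal c"
        using less_imp_le[OF c] by (intro always_eventually allI)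
    qed (use g G q meas in auto)
    \<comment> \<open>Completeness of A^p comes from Montel's theorem: the bounds on the differences
      pass to the pointwise limit, whatever the radii, so \<open>L = 1\<close> will do.\<close>
    show "\<exists>g\<in>bergman_space p. \<forall>k. qmom p area_measure (\<lambda>z. g z - S k z) \<le> ennreal (\<rho> k)"
      if S: "\<And>n. S n \<in> bergman_space p"
        and cauchy: "\<And>k n. k \<le> n \<Longrightarrow> qmom p area_measure (\<lambda>z. S n z - S k z) \<le> ennreal (\<rho> k)"
      for S :: "nat \<Rightarrow> complex \<Rightarrow> complex" and \<rho> :: "nat \<Rightarrow> real"
    proof -
      obtain B where B: "ennreal (2 powr p) * (ennreal (\<rho> 0) + qmom p area_measure (S 0)) = ennreal B"
        using S[of 0] by (cases "ennreal (2 powr p) * (ennreal (\<rho> 0) + qmom p area_measure (S 0))")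
          (auto simp: bergman_space_iff ennreal_mult_eq_top_iff)
      have bd: "qmom p area_measure (S n) \<le> ennreal B" for n
      proof -
        have "qmom p area_measure (S n) = qmom p area_measure (\<lambda>z. (S n z - S 0 z) + S 0 z)" by simp
        also have "\<dots> \<le> ennreal (2 powr p) * (qmom p area_measure (\<lambda>z. S n z - S 0 z) + qmom p area_measure (S 0))"
          using S p by (intro qmom_add_le meas bergman_lincomb)
        also have "\<dots> \<le> ennreal B"
          unfolding B[symmetric] by (intro mult_left_mono add_mono cauchy) auto
        finally show ?thesis .
      qed
      obtain g \<tau> where g: "g \<in> bergman_space p" "strict_mono (\<tau> :: nat \<Rightarrow> nat)"
        "\<And>z. z \<in> unit_disk \<Longrightarrow> (\<lambda>n. S (\<tau> n) z) \<longlonglongrightarrow> g z"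
        by (rule bergman_montel[where F = S and B = B, OF p S bd]) (rule that; assumption)
      have "qmom p area_measure (\<lambda>z. g z - S k z) \<le> ennreal (\<rho> k)" for k
      proof (rule qmom_le_limit[where F = "\<lambda>n z. S (\<tau> n) z - S k z"])
        show "AE z in area_measure. (\<lambda>n. S (\<tau> n) z - S k z) \<longlonglongrightarrow> g z - S k z"
          using g(3) by (intro AE_I2 tendsto_diff) auto
        show "\<forall>\<^sub>F n in sequentially. qmom p area_measure (\<lambda>z. S (\<tau> n) z - S k z) \<le> ennreal (\<rho> k)"
          using eventually_ge_at_top[of k]
        proof eventually_elim
          case (elim n)
          then show ?case using seq_suble[OF g(2), of n] by (intro cauchy) simp
        qed
      qed (use S g p meas in \<open>auto intro!: borel_measurable_diff\<close>)
      with g(1) show ?thesis by blast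
    qed
  qed (use p bergman_lincomb qmom_add_le[OF meas(2) meas(2)] in auto)
  then obtain \<epsilon> C where C: "0 < \<epsilon>" "0 < C"
    "\<And>f. f \<in> bergman_space p \<Longrightarrow> qmom p area_measure f \<le> ennreal \<epsilon> \<Longrightarrow> qmom q \<mu> f \<le> ennreal C"
    by blast
  have "mom q \<mu> f \<le> C * \<epsilon> powr (- (q / p)) * mom p area_measure f powr (q / p)" if f: "f \<in> bergman_space p" for f
  proof (cases "mom p area_measure f = 0")
    case True
    then have "f z = 0" if "z \<in> unit_disk" for z
      using bergman_mom_pos[OF p f that] by auto
    then have "mom q \<mu> f = mom q \<mu> (\<lambda>z. 0)"
      unfolding mom_def by (intro Bochner_Integration.integral_cong) (auto simp: space_borel_measure_on_disk[OF bm])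
    then show ?thesis by (simp add: C less_imp_le)
  next
    case False
    define t where "t = mom p area_measure f"
    have "0 < t" using False mom_nonneg[of p area_measure f] by (auto simp: t_def less_le)
    define c where "c = complex_of_real ((\<epsilon> / t) powr (1 / p))"
    have cf: "(\<lambda>z. c * f z) \<in> bergman_space p" using f p by (intro bergman_lincomb)
    have "mom p area_measure (\<lambda>z. c * f z) = \<epsilon>"
      using \<open>0 < t\<close> C p by (simp add: mom_scale c_def powr_powr flip: t_def)
    then have "qmom q \<mu> (\<lambda>z. c * f z) \<le> ennreal C"
      using cf C by (intro C(3)) (simp_all add: qmom_eq_mom bergman_Lq)
    then have "mom q \<mu> (\<lambda>z. c * f z) \<le> C"
      using Lq[OF cf] C by (simp add: mom_le_iff)
    then show ?thesis
      unfolding t_def[symmetric] using C \<open>0 < t\<close> p q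
      by (intro mom_bound_by_scaling[where c = c]) (simp_all add: mom_scale, simp add: c_def)
  qed
  with C show ?thesis by (intro that[of "C * \<epsilon> powr (- (q / p))"]) auto
qed

text \<open>Representatives and moments replace classes and their topology, so that the hump
  argument never handles classes; \<open>closedin_range_iff\<close> is the bridge.\<close>

definition closed_range :: "real \<Rightarrow> real \<Rightarrow> complex measure \<Rightarrow> bool" where
  "closed_range p q \<mu> \<longleftrightarrow> (\<forall>g\<in>Lq_fun q \<mu>.
     (\<forall>e>0. \<exists>f\<in>bergman_space p. qmom q \<mu> (\<lambda>z. f z - g z) \<le> ennreal e) \<longrightarrow>
     (\<exists>f\<in>bergman_space p. AE z in \<mu>. f z = g z))"

text \<open>The hump argument in the opposite direction: the completeness it asks for is now that of
  the range, and this is where closedness enters. Only some h in the class of f can be controlled,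
  since f may be altered by elements of the kernel.\<close>

lemma embedding_open:
  assumes p: "0 < p" and q: "0 < q" and \<mu>: "pq_bergman_carleson p q \<mu>" and closed: "closed_range p q \<mu>"
  obtains C where "0 < C" "\<And>f. f \<in> bergman_space p \<Longrightarrow>
    \<exists>h\<in>bergman_space p. (AE z in \<mu>. h z = f z) \<and> mom p area_measure h \<le> C * mom q \<mu> f powr (p / q)"
proof -
  note bm = pq_bergman_carlesonD(1)[OF \<mu>] and Lq = pq_bergman_carlesonD(2)[OF \<mu>]
  note meas = bergman_measurable[OF _ bm] bergman_measurable_area
  \<comment> \<open>The moment on the quotient of A^p by the kernel of the embedding.\<close>
  define M where "M = (\<lambda>f. INF h\<in>{h\<in>bergman_space p. AE z in \<mu>. h z = f z}. qmom p area_measure h)"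
  have M_le: "M f \<le> qmom p area_measure h" if "h \<in> bergman_space p" "AE z in \<mu>. h z = f z" for f h
    unfolding M_def using that by (intro INF_lower) auto
  have M_less: "\<exists>h\<in>bergman_space p. (AE z in \<mu>. h z = f z) \<and> qmom p area_measure h < c" if "M f < c" for f c
    using that unfolding M_def by (auto simp: INF_less_iff)
  have "\<exists>\<epsilon>>0. \<exists>C>0. \<forall>f\<in>bergman_space p. qmom q \<mu> f \<le> ennreal \<epsilon> \<longrightarrow> M f \<le> ennreal C"
  proof (rule gliding_hump_bounded[where K = "2 powr q" and L = "2 * 2 powr q"])
    show "1 \<le> 2 powr q" using q by (simp add: ge_one_powr_ge_zero)
    then show "1 \<le> 2 * 2 powr q" by simp
    show "M f < \<infinity>" if "f \<in> bergman_space p" for f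
      using that M_le[of f f] by (auto simp: bergman_space_iff intro: le_less_trans)
    show "M f \<le> c + c" if fg: "f \<in> bergman_space p" "g \<in> bergman_space p"
      and c: "M (\<lambda>z. g z + f z) < c" "M (\<lambda>z. g z - f z) < c" for f g c
    proof -
      obtain h1 where h1: "h1 \<in> bergman_space p" "AE z in \<mu>. h1 z = g z + f z" "qmom p area_measure h1 < c"
        using M_less[OF c(1)] by blast
      obtain h2 where h2: "h2 \<in> bergman_space p" "AE z in \<mu>. h2 z = g z - f z" "qmom p area_measure h2 < c"
        using M_less[OF c(2)] by blast
      \<comment> \<open>Half the difference of the two lifts is a lift of f, and half their sum v
        takes the role of g, so \<open>qmom_le_plus_minus\<close> can be applied in A^p
        itself.\<close>
      define u where "u = (\<lambda>z. (1/2) * (h1 z - h2 z))"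
      define v where "v = (\<lambda>z. (1/2) * (h1 z + h2 z))"
      have uv: "u \<in> bergman_space p" "v \<in> bergman_space p"
        unfolding u_def v_def using h1 h2 p by (intro bergman_lincomb; simp)+
      have "AE z in \<mu>. u z = f z"
        using h1(2) h2(2) by eventually_elim (simp add: u_def)
      then have "M f \<le> qmom p area_measure u" by (rule M_le[OF uv(1)])
      also have "\<dots> \<le> qmom p area_measure (\<lambda>z. v z + u z) + qmom p area_measure (\<lambda>z. v z - u z)"
        using uv p by (intro qmom_le_plus_minus meas)
      also have "(\<lambda>z. v z + u z) = h1"
        by (auto simp: u_def v_def field_simps)
      also have "(\<lambda>z. v z - u z) = h2"
        by (auto simp: u_def v_def field_simps)
      finally show ?thesis
        using h1(3) h2(3) by (meson add_mono less_imp_le order_trans)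
    qed
    show "M g \<le> ennreal c"
      if g: "g \<in> bergman_space p" and G: "\<And>n. G n \<in> bergman_space p"
        and lim: "(\<lambda>n. qmom q \<mu> (\<lambda>z. G n z - g z)) \<longlonglongrightarrow> 0"
        and c: "\<And>n. M (G n) < ennreal c" for g G c
    proof -
      \<comment> \<open>Lower semicontinuity of the quotient moment: lifts of the G_n with bounded
        A^p moment have a Montel limit, and it is a lift of g.\<close>
      have "\<exists>h\<in>bergman_space p. (AE z in \<mu>. h z = G n z) \<and> qmom p area_measure h < ennreal c" for n
        by (rule M_less[OF c])
      then obtain h where h: "\<And>n. h n \<in> bergman_space p" "\<And>n. AE z in \<mu>. h n z = G n z"
        "\<And>n. qmom p area_measure (h n) < ennreal c" by metis
      have "qmom q \<mu> (\<lambda>z. h n z - g z) = qmom q \<mu> (\<lambda>z. G n z - g z)" for n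
        using h(2)[of n] by (intro qmom_cong_AE) (auto elim: eventually_mono)
      then have lim': "(\<lambda>n. qmom q \<mu> (\<lambda>z. h n z - g z)) \<longlonglongrightarrow> 0" using lim by simp
      obtain f where "f \<in> bergman_space p" "qmom p area_measure f \<le> ennreal c" "AE z in \<mu>. f z = g z"
        by (rule bergman_limit_in_Lq[OF p q bm h(1) less_imp_le[OF h(3)] meas(1)[OF g] lim']) (rule that; assumption)
      then show ?thesis using M_le order_trans by blast
    qed
    show "\<exists>g\<in>bergman_space p. \<forall>k. qmom q \<mu> (\<lambda>z. g z - S k z) \<le> ennreal (\<rho> k)"
      if S: "\<And>n. S n \<in> bergman_space p" and pos: "\<And>k. 0 < \<rho> k"
        and decay: "\<And>k. \<rho> (Suc k) \<le> \<rho> k / (2 * 2 powr q)"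
        and cauchy: "\<And>k n. k \<le> n \<Longrightarrow> qmom q \<mu> (\<lambda>z. S n z - S k z) \<le> ennreal (\<rho> k)"
      for S :: "nat \<Rightarrow> complex \<Rightarrow> complex" and \<rho> :: "nat \<Rightarrow> real"
    proof -
      obtain g where g: "g \<in> Lq_fun q \<mu>" "\<And>k. qmom q \<mu> (\<lambda>z. g z - S k z) \<le> ennreal (\<rho> k)"
        by (rule Lq_complete[where S = S and \<rho> = \<rho>, OF Lq[OF S] q pos decay cauchy]) (assumption, (rule that; assumption))
      have half: "\<rho> k \<le> (1 / 2) ^ k * \<rho> 0" for k
      proof (induction k)
        case (Suc k)
        have "\<rho> (Suc k) \<le> \<rho> k / (2 * 2 powr q)" by (rule decay)
        also have "\<dots> \<le> \<rho> k / 2"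
          using pos[of k] q by (intro divide_left_mono) (auto simp: ge_one_powr_ge_zero)
        also have "\<dots> \<le> (1 / 2) ^ k * \<rho> 0 / 2" using Suc by simp
        finally show ?case by simp
      qed simp
      \<comment> \<open>The limit g exists in L^q(\<mu>) only; closedness brings it back to a
        Bergman function.\<close>
      have "\<exists>f\<in>bergman_space p. AE z in \<mu>. f z = g z"
      proof (rule closed[unfolded closed_range_def, rule_format, OF g(1)])
        fix e :: real assume "0 < e"
        have "(\<lambda>k. (1 / 2) ^ k * \<rho> 0) \<longlonglongrightarrow> 0 * \<rho> 0"
          by (intro tendsto_mult LIMSEQ_realpow_zero) auto
        then have "\<forall>\<^sub>F k in sequentially. (1 / 2) ^ k * \<rho> 0 < e"
          using \<open>0 < e\<close> by (intro order_tendstoD(2)[where a = e]) auto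
        then obtain k where "(1 / 2) ^ k * \<rho> 0 < e" using eventually_happens'[OF sequentially_bot] by blast
        then have "\<rho> k \<le> e" using half[of k] by simp
        then have "qmom q \<mu> (\<lambda>z. S k z - g z) \<le> ennreal e"
          using g(2)[of k] by (simp add: qmom_minus_commute[of q \<mu> "S k"] order_trans ennreal_leI)
        then show "\<exists>f\<in>bergman_space p. qmom q \<mu> (\<lambda>z. f z - g z) \<le> ennreal e" using S by blast
      qed
      then obtain f where f: "f \<in> bergman_space p" "AE z in \<mu>. f z = g z" by blast
      have "qmom q \<mu> (\<lambda>z. f z - S k z) = qmom q \<mu> (\<lambda>z. g z - S k z)" for k
        using f(2) by (intro qmom_cong_AE) (auto elim: eventually_mono)
      then have "qmom q \<mu> (\<lambda>z. f z - S k z) \<le> ennreal (\<rho> k)" for k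
        using g(2)[of k] by simp
      with f(1) show ?thesis by blast
    qed
  qed (use p q bergman_lincomb qmom_add_le[OF meas(1) meas(1)] in auto)
  then obtain \<epsilon> C where C: "0 < \<epsilon>" "0 < C"
    "\<And>f. f \<in> bergman_space p \<Longrightarrow> qmom q \<mu> f \<le> ennreal \<epsilon> \<Longrightarrow> M f \<le> ennreal C"
    by blast
  have "\<exists>h\<in>bergman_space p. (AE z in \<mu>. h z = f z) \<and>
      mom p area_measure h \<le> (C + 1) * \<epsilon> powr (- (p / q)) * mom q \<mu> f powr (p / q)"
    if f: "f \<in> bergman_space p" for f
  proof (cases "mom q \<mu> f = 0")
    case True
    then have "qmom q \<mu> f = 0" using Lq[OF f] by (simp add: qmom_eq_mom)
    then have "AE z in \<mu>. f z = 0" by (simp only: qmom_eq_0_iff[OF meas(1)[OF f]])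
    then have "AE z in \<mu>. 0 = f z" by eventually_elim simp
    then show ?thesis using C by (intro bexI[of _ "\<lambda>z. 0"]) auto
  next
    case False
    define s where "s = mom q \<mu> f"
    have "0 < s" using False mom_nonneg[of q \<mu> f] by (auto simp: s_def less_le)
    define c where "c = complex_of_real ((\<epsilon> / s) powr (1 / q))"
    have "c \<noteq> 0" using \<open>0 < s\<close> C by (simp add: c_def)
    have cf: "(\<lambda>z. c * f z) \<in> bergman_space p" using f p by (intro bergman_lincomb)
    have "mom q \<mu> (\<lambda>z. c * f z) = \<epsilon>"
      using \<open>0 < s\<close> C q by (simp add: mom_scale c_def powr_powr flip: s_def)
    then have "M (\<lambda>z. c * f z) \<le> ennreal C"
      using cf C by (intro C(3)) (simp_all add: qmom_eq_mom Lq)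
    \<comment> \<open>The infimum in M is not known to be attained; a strict bound produces an
      actual lift.\<close>
    also have "\<dots> < ennreal (C + 1)" using C by (intro ennreal_lessI) auto
    finally obtain h' where h': "h' \<in> bergman_space p" "AE z in \<mu>. h' z = c * f z" "qmom p area_measure h' < ennreal (C + 1)"
      using M_less by blast
    define h where "h = (\<lambda>z. inverse c * h' z)"
    have h: "h \<in> bergman_space p" unfolding h_def using h' p by (intro bergman_lincomb)
    have h'_eq: "h' = (\<lambda>z. c * h z)" using \<open>c \<noteq> 0\<close> by (simp add: h_def flip: mult.assoc)
    have "AE z in \<mu>. h z = f z"
      using h'(2) by eventually_elim (use \<open>c \<noteq> 0\<close> in \<open>simp add: h_def\<close>)
    moreover have "mom p area_measure h' \<le> C + 1"
      using h'(1) less_imp_le[OF h'(3)] C by (subst mom_le_iff) (auto simp: bergman_Lq simp del: ennreal_plus)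
    then have "norm c powr p * mom p area_measure h \<le> C + 1"
      by (simp add: h'_eq mom_scale)
    then have "mom p area_measure h \<le> (C + 1) * \<epsilon> powr (- (p / q)) * s powr (p / q)"
      using C \<open>0 < s\<close> p q by (intro mom_bound_by_scaling[where c = c]) (simp_all, simp add: c_def)
    ultimately show ?thesis using h unfolding s_def by blast
  qed
  with C show ?thesis by (intro that[of "(C + 1) * \<epsilon> powr (- (p / q))"]) auto
qed

section \<open>From the topology on classes to approximation by representatives\<close>

lemma ae_class_eq_iff:
  assumes "f \<in> borel_measurable \<mu>" "g \<in> borel_measurable \<mu>"
  shows "ae_class \<mu> f = ae_class \<mu> g \<longleftrightarrow> (AE z in \<mu>. f z = g z)"
  unfolding ae_class_def using eq_equiv_class_iff[OF equiv_ae_rel assms] assms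
  by (simp add: ae_rel_def)

text \<open>\<open>Lq_open\<close> asks for a ball around each point of the set, so openness of the
  complement says directly that each g outside the range has positive distance from it. Whether
  balls are open does not matter, and no triangle inequality enters.\<close>

lemma closedin_range_iff:
  assumes p: "0 < p" and q: "0 < q" and \<mu>: "pq_bergman_carleson p q \<mu>"
  shows "closedin (Lq_topology q \<mu>) (bergman_embedding p \<mu> ` bergman_space p) \<longleftrightarrow> closed_range p q \<mu>"
proof -
  note bm = pq_bergman_carlesonD(1)[OF \<mu>] and Lq = pq_bergman_carlesonD(2)[OF \<mu>]
  have Lqm: "f \<in> borel_measurable \<mu>" if "f \<in> Lq_fun q \<mu>" for f
    using that by (simp add: Lq_fun_def)
  have norm_less: "Lq_norm q \<mu> f < e \<longleftrightarrow> qmom q \<mu> f < ennreal (e powr q)" if "f \<in> Lq_fun q \<mu>" "0 < e" for f e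
  proof -
    have "Lq_norm q \<mu> f < e \<longleftrightarrow> mom q \<mu> f powr (1 / q) < (e powr q) powr (1 / q)"
      using that q by (simp add: Lq_norm_def mom_def powr_powr)
    also have "\<dots> \<longleftrightarrow> mom q \<mu> f < e powr q"
      using q powr_less_mono2[of "1 / q" "mom q \<mu> f" "e powr q"] powr_mono2[of "1 / q" "e powr q" "mom q \<mu> f"]
      by (auto simp: not_le[symmetric])
    finally show ?thesis using that by (simp add: qmom_eq_mom ennreal_less_iff)
  qed
  define U where "U = Lq_space q \<mu> - ae_class \<mu> ` bergman_space p"
  have U_iff: "ae_class \<mu> g \<in> U \<longleftrightarrow> \<not> (\<exists>f\<in>bergman_space p. AE z in \<mu>. f z = g z)" if "g \<in> Lq_fun q \<mu>" for g
  proof -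
    have "ae_class \<mu> g = ae_class \<mu> f \<longleftrightarrow> (AE z in \<mu>. f z = g z)" if "f \<in> bergman_space p" for f
      using ae_class_eq_iff[OF Lqm[OF Lq[OF that]] Lqm[OF \<open>g \<in> _\<close>]] by metis
    then show ?thesis using that by (auto simp: U_def Lq_space_eq_image image_iff)
  qed
  have "bergman_embedding p \<mu> ` bergman_space p = ae_class \<mu> ` bergman_space p"
    by (auto simp: bergman_embedding_def)
  moreover have "ae_class \<mu> ` bergman_space p \<subseteq> Lq_space q \<mu>"
    using Lq by (auto simp: Lq_space_eq_image)
  ultimately have "closedin (Lq_topology q \<mu>) (bergman_embedding p \<mu> ` bergman_space p) \<longleftrightarrow> Lq_open q \<mu> U"
    by (simp add: closedin_def topspace_Lq_topology openin_Lq_topology U_def)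
  also have "\<dots> \<longleftrightarrow> (\<forall>g\<in>Lq_fun q \<mu>. ae_class \<mu> g \<in> U \<longrightarrow>
      (\<exists>e>0. \<forall>h\<in>Lq_fun q \<mu>. Lq_norm q \<mu> (\<lambda>z. h z - g z) < e \<longrightarrow> ae_class \<mu> h \<in> U))"
    by (auto simp: Lq_open_def U_def)
  also have "\<dots> \<longleftrightarrow> closed_range p q \<mu>"
  proof
    assume op: "\<forall>g\<in>Lq_fun q \<mu>. ae_class \<mu> g \<in> U \<longrightarrow>
      (\<exists>e>0. \<forall>h\<in>Lq_fun q \<mu>. Lq_norm q \<mu> (\<lambda>z. h z - g z) < e \<longrightarrow> ae_class \<mu> h \<in> U)"
    show "closed_range p q \<mu>"
      unfolding closed_range_def
    proof (intro ballI impI)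
      fix g assume g: "g \<in> Lq_fun q \<mu>"
        and apx: "\<forall>e>0. \<exists>f\<in>bergman_space p. qmom q \<mu> (\<lambda>z. f z - g z) \<le> ennreal e"
      show "\<exists>f\<in>bergman_space p. AE z in \<mu>. f z = g z"
      proof (rule ccontr)
        assume "\<not> ?thesis"
        then obtain e where e: "0 < e" "\<And>h. h \<in> Lq_fun q \<mu> \<Longrightarrow> Lq_norm q \<mu> (\<lambda>z. h z - g z) < e \<Longrightarrow> ae_class \<mu> h \<in> U"
          using op g U_iff[OF g] by blast
        obtain f where f: "f \<in> bergman_space p" "qmom q \<mu> (\<lambda>z. f z - g z) \<le> ennreal (e powr q / 2)"
          using apx e(1) by (metis half_gt_zero powr_gt_zero less_irrefl)
        have "qmom q \<mu> (\<lambda>z. f z - g z) < ennreal (e powr q)"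
          using e(1) by (intro le_less_trans[OF f(2)] ennreal_lessI) auto
        then have "ae_class \<mu> f \<in> U"
          using e norm_less Lq_fun_lincomb(2)[OF Lq[OF f(1)] g q] Lq f(1) by blast
        then show False using f(1) by (auto simp: U_def)
      qed
    qed
  next
    assume cl: "closed_range p q \<mu>"
    show "\<forall>g\<in>Lq_fun q \<mu>. ae_class \<mu> g \<in> U \<longrightarrow>
      (\<exists>e>0. \<forall>h\<in>Lq_fun q \<mu>. Lq_norm q \<mu> (\<lambda>z. h z - g z) < e \<longrightarrow> ae_class \<mu> h \<in> U)"
    proof (intro ballI impI)
      fix g assume g: "g \<in> Lq_fun q \<mu>" "ae_class \<mu> g \<in> U"
      then obtain e where e: "0 < e" "\<And>f. f \<in> bergman_space p \<Longrightarrow> \<not> qmom q \<mu> (\<lambda>z. f z - g z) \<le> ennreal e"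
        using cl U_iff[OF g(1)] unfolding closed_range_def by meson
      show "\<exists>e>0. \<forall>h\<in>Lq_fun q \<mu>. Lq_norm q \<mu> (\<lambda>z. h z - g z) < e \<longrightarrow> ae_class \<mu> h \<in> U"
      proof (intro exI[of _ "e powr (1 / q)"] conjI ballI impI)
        fix h assume h: "h \<in> Lq_fun q \<mu>" "Lq_norm q \<mu> (\<lambda>z. h z - g z) < e powr (1 / q)"
        have small: "qmom q \<mu> (\<lambda>z. h z - g z) < ennreal e"
          using h(2) e(1) q norm_less[OF Lq_fun_lincomb(2)[OF h(1) g(1) q], of "e powr (1 / q)"]
          by (simp add: powr_powr)
        have "\<not> (AE z in \<mu>. f z = h z)" if "f \<in> bergman_space p" for f
        proof
          assume "AE z in \<mu>. f z = h z"
          then have "qmom q \<mu> (\<lambda>z. f z - g z) = qmom q \<mu> (\<lambda>z. h z - g z)"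
            by (intro qmom_cong_AE) (auto elim: eventually_mono)
          with e(2)[OF that] small show False by simp
        qed
        then show "ae_class \<mu> h \<in> U" using U_iff[OF h(1)] by blast
      qed (use e in simp)
    qed
  qed
  finally show ?thesis .
qed

lemma bergman_scale: "f \<in> bergman_space p \<Longrightarrow> 0 < p \<Longrightarrow> (\<lambda>z. c * f z) \<in> bergman_space p"
  using bergman_lincomb(3)[of f p f] by blast

section \<open>Sums of asymptotically disjoint bumps\<close>

lemma mom_asymp_additive:
  assumes "S \<in> Lq_fun r M" "\<And>n. u n \<in> Lq_fun r M" "0 < r"
    and "\<And>z. z \<in> space M \<Longrightarrow> (\<lambda>n. u n z) \<longlonglongrightarrow> 0"
    and "\<And>n. mom r M (u n) \<le> B" "0 < \<eta>"
  shows "\<forall>\<^sub>F n in sequentially. \<bar>mom r M (\<lambda>z. S z + u n z) - mom r M S - mom r M (u n)\<bar> < \<eta>"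
  using Lq_asymp_additive[of S r M u B \<eta>] assms unfolding mom_def by blast

text \<open>Asymptotic additivity holds for all late indices in either space, so a single next bump
  can be chosen that works for both measures at once.\<close>

lemma bump_sums:
  assumes p: "0 < p" and q: "0 < q" and \<mu>: "pq_bergman_carleson p q \<mu>" and "0 < c"
    and u: "\<And>n. u n \<in> bergman_space p" and lim: "\<And>z. z \<in> unit_disk \<Longrightarrow> (\<lambda>n. u n z) \<longlonglongrightarrow> 0"
    and mp: "\<And>n. mom p area_measure (u n) \<in> {c..B}" and mq: "\<And>n. mom q \<mu> (u n) \<in> {c..B}"
  shows "\<exists>S\<in>bergman_space p. mom p area_measure S \<in> {c / 2 * real N..(B + 1) * real N}
    \<and> mom q \<mu> S \<in> {c / 2 * real N..(B + 1) * real N}"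
proof (induction N)
  case 0
  show ?case by (intro bexI[of _ "\<lambda>z. 0"]) auto
next
  case (Suc N)
  note bm = pq_bergman_carlesonD(1)[OF \<mu>] and Lq = pq_bergman_carlesonD(2)[OF \<mu>]
  obtain S where S: "S \<in> bergman_space p"
    "mom p area_measure S \<in> {c / 2 * real N..(B + 1) * real N}" "mom q \<mu> S \<in> {c / 2 * real N..(B + 1) * real N}"
    using Suc by blast
  \<comment> \<open>An error of at most c/2 leaves each bump a contribution of at least c/2, and an
    error of at most 1 keeps it below B + 1.\<close>
  define \<eta> where "\<eta> = min (c / 2) 1"
  have \<eta>: "0 < \<eta>" "\<eta> \<le> c / 2" "\<eta> \<le> 1" using \<open>0 < c\<close> by (auto simp: \<eta>_def)
  have "\<forall>\<^sub>F n in sequentially. \<bar>mom p area_measure (\<lambda>z. S z + u n z) - mom p area_measure S - mom p area_measure (u n)\<bar> < \<eta>"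
    by (rule mom_asymp_additive[where B = B]) (use S u p lim mp \<eta> in \<open>auto simp: bergman_Lq\<close>)
  moreover have "\<forall>\<^sub>F n in sequentially. \<bar>mom q \<mu> (\<lambda>z. S z + u n z) - mom q \<mu> S - mom q \<mu> (u n)\<bar> < \<eta>"
    by (rule mom_asymp_additive[where B = B])
      (use S u q lim mq \<eta> in \<open>auto simp: Lq space_borel_measure_on_disk[OF bm]\<close>)
  ultimately have "\<forall>\<^sub>F n in sequentially.
    \<bar>mom p area_measure (\<lambda>z. S z + u n z) - mom p area_measure S - mom p area_measure (u n)\<bar> < \<eta>
    \<and> \<bar>mom q \<mu> (\<lambda>z. S z + u n z) - mom q \<mu> S - mom q \<mu> (u n)\<bar> < \<eta>"
    by (rule eventually_conj)
  then obtain n where n: "\<bar>mom p area_measure (\<lambda>z. S z + u n z) - mom p area_measure S - mom p area_measure (u n)\<bar> < \<eta>"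
    "\<bar>mom q \<mu> (\<lambda>z. S z + u n z) - mom q \<mu> S - mom q \<mu> (u n)\<bar> < \<eta>"
    using eventually_happens'[OF sequentially_bot] by blast
  have eq: "c / 2 * real (Suc N) = c / 2 * real N + c / 2" "(B + 1) * real (Suc N) = (B + 1) * real N + B + 1"
    by (simp_all add: algebra_simps)
  have "mom p area_measure (\<lambda>z. S z + u n z) \<in> {c / 2 * real (Suc N)..(B + 1) * real (Suc N)}"
    using n(1) S(2) mp[of n] \<eta> unfolding eq atLeastAtMost_iff abs_less_iff by linarith
  moreover have "mom q \<mu> (\<lambda>z. S z + u n z) \<in> {c / 2 * real (Suc N)..(B + 1) * real (Suc N)}"
    using n(2) S(3) mq[of n] \<eta> unfolding eq atLeastAtMost_iff abs_less_iff by linarith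
  moreover have "(\<lambda>z. S z + u n z) \<in> bergman_space p"
    using S u p by (intro bergman_lincomb)
  ultimately show ?case by blast
qed

lemma exponent_ge_1:
  fixes c K s :: real
  assumes "0 < c" and le: "\<And>N::nat. 0 < N \<Longrightarrow> c * real N \<le> K * real N powr s"
  shows "1 \<le> s"
proof (rule ccontr)
  assume "\<not> 1 \<le> s"
  then have "0 < 1 - s" by simp
  obtain N :: nat where N: "(\<bar>K\<bar> / c + 1) powr (1 / (1 - s)) < real N"
    using reals_Archimedean2 by blast
  then have "0 < real N" using powr_ge_zero le_less_trans by blast
  have "((\<bar>K\<bar> / c + 1) powr (1 / (1 - s))) powr (1 - s) < real N powr (1 - s)"
    using N \<open>0 < 1 - s\<close> by (intro powr_less_mono2) auto
  then have "\<bar>K\<bar> / c + 1 < real N powr (1 - s)"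
    using \<open>0 < 1 - s\<close> \<open>0 < c\<close> by (simp add: powr_powr add_nonneg_pos)
  also have "\<dots> = real N / real N powr s"
    using \<open>0 < real N\<close> by (simp add: powr_diff)
  also have "\<dots> \<le> K / c"
    using le[of N] \<open>0 < real N\<close> \<open>0 < c\<close> by (simp add: field_simps)
  also have "\<dots> \<le> \<bar>K\<bar> / c" using \<open>0 < c\<close> by (intro divide_right_mono) auto
  finally show False by simp
qed

text \<open>The first inequality rests on boundedness. The second takes a lower inequality as a
  premise, because that one is false as soon as the embedding has a kernel.\<close>

lemma bumps_imp_le:
  assumes p: "0 < p" and q: "0 < q" and \<mu>: "pq_bergman_carleson p q \<mu>" and c: "0 < c"
    and u: "\<And>n. u n \<in> bergman_space p" and lim: "\<And>z. z \<in> unit_disk \<Longrightarrow> (\<lambda>n. u n z) \<longlonglongrightarrow> 0"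
    and mp: "\<And>n. mom p area_measure (u n) \<in> {c..B}" and mq: "\<And>n. mom q \<mu> (u n) \<in> {c..B}"
  shows "p \<le> q"
    and "(\<And>f. f \<in> bergman_space p \<Longrightarrow> mom p area_measure f \<le> C * mom q \<mu> f powr (p / q)) \<Longrightarrow> 0 \<le> C \<Longrightarrow> q \<le> p"
proof -
  have "0 \<le> B" using mp[of 0] c by auto
  obtain D where D: "0 < D" "\<And>f. f \<in> bergman_space p \<Longrightarrow> mom q \<mu> f \<le> D * mom p area_measure f powr (q / p)"
    using embedding_bounded[OF p q \<mu>] by blast
  note bumps = bump_sums[OF p q \<mu> c u lim mp mq]
  have "c / 2 * real N \<le> (D * (B + 1) powr (q / p)) * real N powr (q / p)" for N
  proof -
    obtain S where S: "S \<in> bergman_space p" "mom p area_measure S \<le> (B + 1) * real N" "c / 2 * real N \<le> mom q \<mu> S"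
      using bumps[of N] by auto
    have "c / 2 * real N \<le> D * mom p area_measure S powr (q / p)"
      using S D by (meson order_trans)
    also have "\<dots> \<le> D * ((B + 1) * real N) powr (q / p)"
      using S D p q by (intro mult_left_mono powr_mono2) auto
    finally show ?thesis using \<open>0 \<le> B\<close> by (simp add: powr_mult mult.assoc)
  qed
  then have "1 \<le> q / p" using c by (intro exponent_ge_1[of "c / 2"]) auto
  then show "p \<le> q" using p by simp
  assume C: "\<And>f. f \<in> bergman_space p \<Longrightarrow> mom p area_measure f \<le> C * mom q \<mu> f powr (p / q)" "0 \<le> C"
  have "c / 2 * real N \<le> (C * (B + 1) powr (p / q)) * real N powr (p / q)" for N
  proof -
    obtain S where S: "S \<in> bergman_space p" "mom q \<mu> S \<le> (B + 1) * real N" "c / 2 * real N \<le> mom p area_measure S"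
      using bumps[of N] by auto
    have "c / 2 * real N \<le> C * mom q \<mu> S powr (p / q)"
      using S C by (meson order_trans)
    also have "\<dots> \<le> C * ((B + 1) * real N) powr (p / q)"
      using S C p q by (intro mult_left_mono powr_mono2) auto
    finally show ?thesis using \<open>0 \<le> B\<close> by (simp add: powr_mult mult.assoc)
  qed
  then have "1 \<le> p / q" using c by (intro exponent_ge_1[of "c / 2"]) auto
  then show "q \<le> p" using q by simp
qed

section \<open>The injective case\<close>

lemma bergman_point_bound_mom:
  assumes "0 < p"
  obtains C :: real where "0 < C"
    "\<And>f a. f \<in> bergman_space p \<Longrightarrow> a \<in> unit_disk \<Longrightarrow>
       norm (f a) powr p * (1 - norm a)\<^sup>2 \<le> C * mom p area_measure f"
proof -
  obtain C :: real where C: "0 < C" "\<And>f a. f holomorphic_on unit_disk \<Longrightarrow> a \<in> unit_disk \<Longrightarrow>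
       ennreal (norm (f a) powr p * (1 - norm a)\<^sup>2) \<le> ennreal C * qmom p area_measure f"
    using bergman_point_bound[OF \<open>0 < p\<close>] by blast
  show ?thesis
  proof (rule that[OF C(1)])
    fix f a assume f: "f \<in> bergman_space p" and a: "a \<in> unit_disk"
    have "ennreal (norm (f a) powr p * (1 - norm a)\<^sup>2) \<le> ennreal (C * mom p area_measure f)"
      using C(2)[of f a] f a C(1) by (simp add: bergman_space_iff[of f] qmom_eq_mom[OF bergman_Lq[OF f]] ennreal_mult)
    then show "norm (f a) powr p * (1 - norm a)\<^sup>2 \<le> C * mom p area_measure f"
      using C(1) by (subst (asm) ennreal_le_iff) auto
  qed
qed

lemma power_in_bergman: "0 < p \<Longrightarrow> (\<lambda>z. z ^ n) \<in> bergman_space p"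
  by (rule bergman_if_bounded[where B = 1])
    (auto intro!: holomorphic_intros power_le_one simp: norm_power)

text \<open>The moments of \<open>z\<^sup>n\<close> decay slower than \<open>\<rho>\<^bsup>n p\<^esup>\<close> for each \<open>\<rho> < 1\<close>, so that normalised powers
  tend to zero inside the disk.\<close>

lemma normalised_powers:
  assumes p: "0 < p"
  obtains u :: "nat \<Rightarrow> complex \<Rightarrow> complex"
  where "\<And>n. u n \<in> bergman_space p" "\<And>n. mom p area_measure (u n) = 1"
    "\<And>z. z \<in> unit_disk \<Longrightarrow> (\<lambda>n. u n z) \<longlonglongrightarrow> 0"
proof -
  define t where "t = (\<lambda>n. mom p area_measure (\<lambda>z. z ^ n))"
  define u where "u = (\<lambda>n z. complex_of_real (t n powr (- 1 / p)) * z ^ n)"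
  have tpos: "0 < t n" for n
    unfolding t_def using p by (intro bergman_mom_pos[of p _ "1/2"] power_in_bergman) auto
  have u1: "u n \<in> bergman_space p" for n
    unfolding u_def using p by (intro bergman_scale power_in_bergman)
  have u2: "mom p area_measure (u n) = 1" for n
  proof -
    have "mom p area_measure (u n) = (t n powr (- 1 / p)) powr p * t n"
      unfolding u_def by (simp add: mom_scale t_def)
    also have "(t n powr (- 1 / p)) powr p = t n powr (- 1)" using p by (subst powr_powr) simp
    also have "\<dots> * t n = 1" using tpos[of n] by (simp add: powr_minus)
    finally show ?thesis .
  qed
  obtain C :: real where C: "0 < C"
    "\<And>f a. f \<in> bergman_space p \<Longrightarrow> a \<in> unit_disk \<Longrightarrow>
       norm (f a) powr p * (1 - norm a)\<^sup>2 \<le> C * mom p area_measure f"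
    using bergman_point_bound_mom[OF p] by blast
  have u3: "(\<lambda>n. u n z) \<longlonglongrightarrow> 0" if z: "z \<in> unit_disk" for z
  proof -
    \<comment> \<open>The point bound at the real point \<rho> bounds the moment of z^n below by
      \<kappa> \<rho>^(n p). As \<rho> lies strictly between |z| and 1, the normalised power at z
      decays like (|z| / \<rho>)^n.\<close>
    define \<rho> where "\<rho> = (1 + norm z) / 2"
    have \<rho>: "0 < \<rho>" "\<rho> < 1" "norm z < \<rho>" using z by (auto simp: \<rho>_def add_pos_nonneg)
    define \<kappa> where "\<kappa> = (1 - \<rho>)\<^sup>2 / C"
    have "0 < \<kappa>" using \<rho> C by (simp add: \<kappa>_def)
    have bound: "norm (u n z) \<le> \<kappa> powr (- 1 / p) * (norm z / \<rho>) ^ n" for n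
    proof -
      have "(\<rho> ^ n) powr p * (1 - \<rho>)\<^sup>2 \<le> C * t n"
        using C(2)[OF power_in_bergman[OF p], of "of_real \<rho>" n] \<rho> by (simp add: t_def norm_power)
      then have "\<kappa> * (\<rho> ^ n) powr p \<le> t n" using C(1) by (simp add: \<kappa>_def field_simps)
      then have "t n powr (- 1 / p) \<le> (\<kappa> * (\<rho> ^ n) powr p) powr (- 1 / p)"
        using p \<rho> \<open>0 < \<kappa>\<close> by (intro powr_mono2') auto
      also have "\<dots> = \<kappa> powr (- 1 / p) * inverse (\<rho> ^ n)"
        using p \<rho> \<open>0 < \<kappa>\<close> by (simp add: powr_mult powr_powr powr_minus)
      finally have "t n powr (- 1 / p) * norm z ^ n \<le> \<kappa> powr (- 1 / p) * inverse (\<rho> ^ n) * norm z ^ n"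
        by (intro mult_right_mono) auto
      then show ?thesis
        by (simp add: u_def norm_mult norm_power power_divide field_simps)
    qed
    have "(\<lambda>n. \<kappa> powr (- 1 / p) * (norm z / \<rho>) ^ n) \<longlonglongrightarrow> \<kappa> powr (- 1 / p) * 0"
      using \<rho> by (intro tendsto_mult tendsto_const LIMSEQ_realpow_zero) auto
    then show ?thesis
      by (intro Lim_null_comparison[of "\<lambda>n. u n z"]) (use bound in auto)
  qed
  show ?thesis by (rule that[OF u1 u2 u3])
qed

lemma injective_case:
  assumes p: "0 < p" and q: "0 < q" and \<mu>: "pq_bergman_carleson p q \<mu>" and closed: "closed_range p q \<mu>"
    and inj: "\<And>f z. f \<in> bergman_space p \<Longrightarrow> AE z in \<mu>. f z = 0 \<Longrightarrow> z \<in> unit_disk \<Longrightarrow> f z = 0"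
  shows "p = q" "sampling_measure p \<mu>"
proof -
  note bm = pq_bergman_carlesonD(1)[OF \<mu>] and Lq = pq_bergman_carlesonD(2)[OF \<mu>]
  obtain C where C: "0 < C" "\<And>f. f \<in> bergman_space p \<Longrightarrow>
    \<exists>h\<in>bergman_space p. (AE z in \<mu>. h z = f z) \<and> mom p area_measure h \<le> C * mom q \<mu> f powr (p / q)"
    by (rule embedding_open[OF p q \<mu> closed]) (rule that; assumption)
  have below: "mom p area_measure f \<le> C * mom q \<mu> f powr (p / q)" if f: "f \<in> bergman_space p" for f
  proof -
    obtain h where h: "h \<in> bergman_space p" "AE z in \<mu>. h z = f z" "mom p area_measure h \<le> C * mom q \<mu> f powr (p / q)"
      using C(2)[OF f] by blast
    have "AE z in \<mu>. h z - f z = 0" using h(2) by eventually_elim simp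
    then have "h z = f z" if "z \<in> unit_disk" for z
      using inj[of "\<lambda>z. h z - f z" z] bergman_lincomb(2)[OF h(1) f p] that by simp
    then have "mom p area_measure h = mom p area_measure f"
      unfolding mom_def by (intro Bochner_Integration.integral_cong) auto
    with h(3) show ?thesis by simp
  qed
  obtain D where D: "0 < D" "\<And>f. f \<in> bergman_space p \<Longrightarrow> mom q \<mu> f \<le> D * mom p area_measure f powr (q / p)"
    using embedding_bounded[OF p q \<mu>] by blast
  obtain u where u: "\<And>n. u n \<in> bergman_space p" "\<And>n. mom p area_measure (u n) = 1"
    "\<And>z. z \<in> unit_disk \<Longrightarrow> (\<lambda>n. u n z) \<longlonglongrightarrow> 0"
    by (rule normalised_powers[OF p]) (rule that; assumption)
  \<comment> \<open>For u_n, whose A^p moment is 1, the lower inequality reads 1 \<le> C m^(p/q)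
    with m its L^q(\<mu>) moment; solved for m, this is the second entry of the minimum.\<close>
  define c where "c = min 1 ((1 / C) powr (q / p))"
  have mp: "mom p area_measure (u n) \<in> {c..max 1 D}" for n
    by (simp add: u(2) c_def)
  have mq: "mom q \<mu> (u n) \<in> {c..max 1 D}" for n
  proof -
    have "1 \<le> C * mom q \<mu> (u n) powr (p / q)" using below[OF u(1), of n] by (simp add: u(2))
    then have "1 / C \<le> mom q \<mu> (u n) powr (p / q)" using C(1) by (simp add: field_simps)
    then have "(1 / C) powr (q / p) \<le> (mom q \<mu> (u n) powr (p / q)) powr (q / p)"
      using C(1) p q by (intro powr_mono2) auto
    also have "\<dots> = mom q \<mu> (u n)" using p q by (simp add: powr_powr)
    finally have "c \<le> mom q \<mu> (u n)" by (simp add: c_def)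
    moreover have "mom q \<mu> (u n) \<le> D" using D(2)[OF u(1), of n] by (simp add: u(2))
    ultimately show ?thesis by simp
  qed
  have "0 < c" using C(1) by (simp add: c_def)
  have "p \<le> q" by (rule bumps_imp_le(1)[OF p q \<mu> \<open>0 < c\<close> u(1) u(3) mp mq])
  moreover have "q \<le> p"
    by (rule bumps_imp_le(2)[OF p q \<mu> \<open>0 < c\<close> u(1) u(3) mp mq below less_imp_le[OF C(1)]])
  ultimately show "p = q" by simp
  have "C powr (- 1 / p) * bergman_norm p f \<le> Lq_norm p \<mu> f" if f: "f \<in> bergman_space p" for f
  proof -
    have "mom p area_measure f powr (1 / p) \<le> (C * mom p \<mu> f) powr (1 / p)"
      using below[OF f] \<open>p = q\<close> p by (intro powr_mono2) auto
    also have "\<dots> = C powr (1 / p) * mom p \<mu> f powr (1 / p)" using C by (simp add: powr_mult)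
    finally show ?thesis
      using C(1) unfolding bergman_norm_def Lq_norm_def mom_def by (simp add: powr_minus field_simps)
  qed
  moreover have "bergman_carleson \<mu>"
    using \<mu> p \<open>p = q\<close> by (auto simp: bergman_carleson_def)
  ultimately show "sampling_measure p \<mu>"
    unfolding sampling_measure_def using C(1) by (intro conjI exI[of _ "C powr (- 1 / p)"]) auto
qed

section \<open>Sufficiency\<close>

text \<open>An approximating sequence is bounded in L^p(\<mu>), and sampling turns this into a bound
  in A^p, which is all that \<open>bergman_limit_in_Lq\<close> asks for.\<close>

lemma sampling_imp_closed_range:
  assumes p: "0 < p" and \<mu>: "pq_bergman_carleson p p \<mu>" and sampling: "sampling_measure p \<mu>"
  shows "closed_range p p \<mu>"
  unfolding closed_range_def
proof (intro ballI impI)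
  note bm = pq_bergman_carlesonD(1)[OF \<mu>] and Lq = pq_bergman_carlesonD(2)[OF \<mu>]
  note meas = bergman_measurable[OF _ bm]
  fix g assume g: "g \<in> Lq_fun p \<mu>"
    and apx: "\<forall>e>0. \<exists>f\<in>bergman_space p. qmom p \<mu> (\<lambda>z. f z - g z) \<le> ennreal e"
  have gm: "g \<in> borel_measurable \<mu>" using g by (simp add: Lq_fun_def)
  have "\<exists>f\<in>bergman_space p. qmom p \<mu> (\<lambda>z. f z - g z) \<le> ennreal (inverse (real (Suc n)))" for n
    using apx by simp
  then obtain F where F: "\<And>n. F n \<in> bergman_space p" "\<And>n. qmom p \<mu> (\<lambda>z. F n z - g z) \<le> ennreal (inverse (real (Suc n)))"
    by metis
  obtain c where c: "0 < c" "\<And>f. f \<in> bergman_space p \<Longrightarrow> c * bergman_norm p f \<le> Lq_norm p \<mu> f"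
    using sampling by (auto simp: sampling_measure_def)
  define B where "B = 2 powr p * (1 + mom p \<mu> g)"
  have "0 \<le> B" by (simp add: B_def)
  have bd: "qmom p area_measure (F n) \<le> ennreal (c powr (- p) * B)" for n
  proof -
    have "qmom p \<mu> (F n) = qmom p \<mu> (\<lambda>z. (F n z - g z) + g z)" by simp
    also have "\<dots> \<le> ennreal (2 powr p) * (qmom p \<mu> (\<lambda>z. F n z - g z) + qmom p \<mu> g)"
      using p gm meas[OF F(1)] by (intro qmom_add_le borel_measurable_diff) auto
    also have "\<dots> \<le> ennreal (2 powr p) * (ennreal 1 + ennreal (mom p \<mu> g))"
      using order_trans[OF F(2)[of n] ennreal_leI[of _ 1]] g
      by (intro mult_left_mono add_mono) (auto simp: qmom_eq_mom inverse_le_1_iff)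
    also have "\<dots> = ennreal B"
      by (simp add: B_def ennreal_mult)
    finally have "mom p \<mu> (F n) \<le> B" using Lq[OF F(1)] \<open>0 \<le> B\<close> by (simp add: mom_le_iff)
    then have "Lq_norm p \<mu> (F n) \<le> B powr (1 / p)"
      unfolding Lq_norm_def mom_def[symmetric] using p by (intro powr_mono2) auto
    then have "c * mom p area_measure (F n) powr (1 / p) \<le> B powr (1 / p)"
      using c(2)[OF F(1), of n] unfolding bergman_norm_def Lq_norm_def mom_def by linarith
    then have "(c * mom p area_measure (F n) powr (1 / p)) powr p \<le> (B powr (1 / p)) powr p"
      using c p by (intro powr_mono2) auto
    then have "c powr p * mom p area_measure (F n) \<le> B"
      using c p \<open>0 \<le> B\<close> by (simp add: powr_mult powr_powr)
    then have "mom p area_measure (F n) \<le> c powr (- p) * B"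
      using c by (simp add: powr_minus field_simps)
    then show ?thesis using F(1) \<open>0 \<le> B\<close> by (simp add: mom_le_iff[symmetric] bergman_Lq)
  qed
  have "(\<lambda>n. qmom p \<mu> (\<lambda>z. F n z - g z)) \<longlonglongrightarrow> ennreal 0"
  proof (rule tendsto_sandwich[where f = "\<lambda>_. 0" and h = "\<lambda>n. ennreal (inverse (real (Suc n)))"])
    show "\<forall>\<^sub>F n in sequentially. qmom p \<mu> (\<lambda>z. F n z - g z) \<le> ennreal (inverse (real (Suc n)))"
      using F(2) by (intro always_eventually allI)
    show "(\<lambda>n. ennreal (inverse (real (Suc n)))) \<longlonglongrightarrow> ennreal 0"
      by (intro tendsto_ennrealI LIMSEQ_inverse_real_of_nat)
  qed (auto intro!: always_eventually tendsto_const)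
  then have lim: "(\<lambda>n. qmom p \<mu> (\<lambda>z. F n z - g z)) \<longlonglongrightarrow> 0" by simp
  obtain f where "f \<in> bergman_space p" "AE z in \<mu>. f z = g z"
    by (rule bergman_limit_in_Lq[OF p p bm F(1) bd gm lim]) (rule that; assumption)
  then show "\<exists>f\<in>bergman_space p. AE z in \<mu>. f z = g z" by blast
qed

lemma nn_integral_atomic:
  fixes z :: "nat \<Rightarrow> complex"
  assumes "inj z" "\<And>n. {z n} \<in> sets M" "AE x in M. x \<in> range z"
  shows "(\<integral>\<^sup>+x. h x \<partial>M) = (\<Sum>n. h (z n) * emeasure M {z n})"
proof -
  have "(\<integral>\<^sup>+x. h x \<partial>M) = (\<integral>\<^sup>+x. (\<Sum>n. h (z n) * indicator {z n} x) \<partial>M)"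
  proof (rule nn_integral_cong_AE)
    show "AE x in M. h x = (\<Sum>n. h (z n) * indicator {z n} x)"
      using assms(3)
    proof eventually_elim
      case (elim x)
      then obtain m where m: "x = z m" by blast
      have "(\<Sum>n. h (z n) * indicator {z n} x) = (\<Sum>n\<in>{m}. h (z n) * indicator {z n} x)"
        using \<open>inj z\<close> by (intro suminf_finite) (auto simp: m inj_eq)
      then show ?case by (simp add: m)
    qed
  qed
  also have "\<dots> = (\<Sum>n. \<integral>\<^sup>+x. h (z n) * indicator {z n} x \<partial>M)"
    using assms(2) by (intro nn_integral_suminf) simp
  also have "\<dots> = (\<Sum>n. h (z n) * emeasure M {z n})"
    using assms(2) by (simp add: nn_integral_cmult_indicator)
  finally show ?thesis .
qed

lemma point_mass_sum_atomic:
  assumes sum: "is_point_mass_sum \<mu> a z" and "inj z" "range z \<subseteq> unit_disk"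
  shows "emeasure \<mu> {z n} = ennreal (a n)" "AE x in \<mu>. x \<in> range z"
proof -
  have bm: "borel_measure_on_disk \<mu>" using sum by (simp add: is_point_mass_sum_def)
  have E: "emeasure \<mu> A = (\<Sum>n. ennreal (a n) * indicator A (z n))" if "A \<in> sets \<mu>" for A
    using sum that by (simp add: is_point_mass_sum_def)
  have "{z n} \<in> sets \<mu>" using range_subsetD[OF assms(3), of n] by (simp add: sets_borel_measure_on_disk[OF bm])
  then have "emeasure \<mu> {z n} = (\<Sum>m. ennreal (a m) * indicator {z n} (z m))" by (rule E)
  also have "\<dots> = (\<Sum>m\<in>{n}. ennreal (a m) * indicator {z n} (z m))"
    using \<open>inj z\<close> by (intro suminf_finite) (auto simp: inj_eq)
  finally show "emeasure \<mu> {z n} = ennreal (a n)" by simp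
  have "range z \<in> sets borel"
    by (rule sets.countable) auto
  have "unit_disk - range z \<in> sets borel"
    by (rule sets.Diff[OF borel_open[OF open_ball] \<open>range z \<in> sets borel\<close>])
  then have "unit_disk - range z \<in> sets \<mu>"
    by (rule iffD2[OF sets_borel_measure_on_disk[OF bm] conjI[OF Diff_subset]])
  moreover from E[OF this] have "emeasure \<mu> (unit_disk - range z) = 0" by simp
  ultimately show "AE x in \<mu>. x \<in> range z"
    by (intro AE_I[of _ _ "unit_disk - range z"]) (auto simp: space_borel_measure_on_disk[OF bm])
qed

lemma comparable_weights_iff:
  assumes z: "\<And>n. z n \<in> unit_disk"
  shows "comparable_weights a z \<longleftrightarrow>
    (\<exists>c>0. \<exists>C. \<forall>n. c * (1 - norm (z n))\<^sup>2 \<le> a n \<and> a n \<le> C * (1 - norm (z n))\<^sup>2)"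
proof
  have d: "0 < (1 - norm (z n))\<^sup>2" for n using z[of n] by auto
  show "\<exists>c>0. \<exists>C. \<forall>n. c * (1 - norm (z n))\<^sup>2 \<le> a n \<and> a n \<le> C * (1 - norm (z n))\<^sup>2"
    if cw: "comparable_weights a z"
  proof -
    obtain c where c: "0 < ereal c" "ereal c < (INF n. ereal (a n / (1 - norm (z n))\<^sup>2))"
      using cw ereal_dense2 unfolding comparable_weights_def by blast
    obtain C where C: "(SUP n. ereal (a n / (1 - norm (z n))\<^sup>2)) < ereal C"
      using cw ereal_dense2 unfolding comparable_weights_def by blast
    have "c * (1 - norm (z n))\<^sup>2 \<le> a n \<and> a n \<le> C * (1 - norm (z n))\<^sup>2" for n
    proof -
      have "ereal c \<le> ereal (a n / (1 - norm (z n))\<^sup>2)"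
        using less_imp_le[OF c(2)] by (rule order_trans) (rule INF_lower, simp)
      moreover have "ereal (a n / (1 - norm (z n))\<^sup>2) \<le> ereal C"
        using less_imp_le[OF C] by (rule order_trans[rotated]) (rule SUP_upper, simp)
      ultimately show ?thesis using d[of n] by (simp add: pos_le_divide_eq pos_divide_le_eq)
    qed
    with c(1) show ?thesis by auto
  qed
  show "comparable_weights a z"
    if ex: "\<exists>c>0. \<exists>C. \<forall>n. c * (1 - norm (z n))\<^sup>2 \<le> a n \<and> a n \<le> C * (1 - norm (z n))\<^sup>2"
  proof -
    obtain c C where "0 < c" and *: "\<forall>n. c * (1 - norm (z n))\<^sup>2 \<le> a n \<and> a n \<le> C * (1 - norm (z n))\<^sup>2"
      using ex by blast
    then have c: "0 < c" "c * (1 - norm (z n))\<^sup>2 \<le> a n" "a n \<le> C * (1 - norm (z n))\<^sup>2" for n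
      by auto
    have "0 < ereal c" using c by simp
    also have "ereal c \<le> (INF n. ereal (a n / (1 - norm (z n))\<^sup>2))"
      using c(2) d by (intro INF_greatest) (simp add: pos_le_divide_eq)
    finally have "0 < (INF n. ereal (a n / (1 - norm (z n))\<^sup>2))" .
    moreover have "(SUP n. ereal (a n / (1 - norm (z n))\<^sup>2)) \<le> ereal C"
      using c(3) d by (intro SUP_least) (simp add: pos_divide_le_eq)
    then have "(SUP n. ereal (a n / (1 - norm (z n))\<^sup>2)) < \<infinity>" by (rule le_less_trans) simp
    ultimately show ?thesis by (simp add: comparable_weights_def)
  qed
qed

text \<open>The range is all of L^p(\<mu>): by the lower bound for the masses, the values of g at
  the points z_n form an admissible sequence for interpolation, and agreement at these points is
  agreement almost everywhere.\<close>

lemma interpolating_imp_closed_range: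
  assumes p: "0 < p" and \<mu>: "pq_bergman_carleson p p \<mu>" and interp: "interpolating_seq p z"
    and a: "\<And>n. 0 < a n" and sum: "is_point_mass_sum \<mu> a z" and comp: "comparable_weights a z"
  shows "closed_range p p \<mu>"
  unfolding closed_range_def
proof (intro ballI impI)
  note bm = pq_bergman_carlesonD(1)[OF \<mu>]
  fix g assume g: "g \<in> Lq_fun p \<mu>"
  have z: "inj z" "range z \<subseteq> unit_disk" using interp by (auto simp: interpolating_seq_def)
  then have zn: "z n \<in> unit_disk" for n by blast
  note atom = point_mass_sum_atomic[OF sum z]
  have "qmom p \<mu> g = (\<Sum>n. ennreal (norm (g (z n)) powr p) * emeasure \<mu> {z n})"
    unfolding qmom_def
    by (rule nn_integral_atomic[OF z(1) _ atom(2)]) (use zn in \<open>auto simp: sets_borel_measure_on_disk[OF bm]\<close>)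
  also have "\<dots> = (\<Sum>n. ennreal (norm (g (z n)) powr p * a n))"
    using a by (simp add: atom ennreal_mult less_imp_le)
  finally have "(\<Sum>n. ennreal (norm (g (z n)) powr p * a n)) \<noteq> top"
    using g by (auto simp: Lq_fun_iff_qmom)
  then have sm: "summable (\<lambda>n. norm (g (z n)) powr p * a n)"
    using a by (intro summable_suminf_not_top) (auto simp: less_imp_le)
  obtain c where c: "0 < c" "\<And>n. c * (1 - norm (z n))\<^sup>2 \<le> a n"
    using comp comparable_weights_iff[of z a, OF zn] by blast
  have "summable (\<lambda>n. c * (norm (g (z n)) powr p * (1 - norm (z n))\<^sup>2))"
  proof (rule summable_comparison_test'[OF sm])
    fix n
    have "norm (g (z n)) powr p * (c * (1 - norm (z n))\<^sup>2) \<le> norm (g (z n)) powr p * a n"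
      using c(2) by (intro mult_left_mono) auto
    then show "norm (c * (norm (g (z n)) powr p * (1 - norm (z n))\<^sup>2)) \<le> norm (g (z n)) powr p * a n"
      using c(1) by (simp add: mult_ac)
  qed
  then have "summable (\<lambda>n. norm (g (z n)) powr p * (1 - norm (z n))\<^sup>2)"
    using c(1) by (simp add: summable_cmult_iff)
  then have "(\<lambda>n. g (z n)) \<in> {\<lambda>n. f (z n) | f. f \<in> bergman_space p}"
    using interp by (simp add: interpolating_seq_def)
  then obtain f where f: "f \<in> bergman_space p" "(\<lambda>n. g (z n)) = (\<lambda>n. f (z n))" by blast
  have "AE x in \<mu>. f x = g x"
    using atom(2) by eventually_elim (use fun_cong[OF f(2)] in auto)
  then show "\<exists>f\<in>bergman_space p. AE z in \<mu>. f z = g z" using f(1) by blast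
qed

section \<open>Kernel functions\<close>

lemma kernel_denominator_bound:
  fixes a w :: complex
  assumes "norm a < 1" "norm w < 1"
  shows "1 - norm a \<le> norm (1 - cnj a * w)" "1 - norm w \<le> norm (1 - cnj a * w)"
proof -
  have *: "1 - norm a * norm w \<le> norm (1 - cnj a * w)"
    using norm_triangle_ineq2[of 1 "cnj a * w"] by (simp add: norm_mult)
  have "norm a * norm w \<le> norm a" "norm a * norm w \<le> norm w"
    using assms by (auto intro: mult_left_le mult_left_le_one_le)
  with * show "1 - norm a \<le> norm (1 - cnj a * w)" "1 - norm w \<le> norm (1 - cnj a * w)"
    by linarith+
qed

lemma ennreal_le_suminf: "f n \<le> (\<Sum>k. f k)" for f :: "nat \<Rightarrow> ennreal"
  using sum_le_suminf[of f "{n}"] by (simp add: summableI)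

lemma inverse_power4_dyadic:
  fixes x :: real
  assumes "1 \<le> x"
  obtains j :: nat where "x < 2 ^ Suc j" "(1 / x) ^ 4 \<le> (1 / 16) ^ j"
proof -
  obtain n where "x < 2 ^ n" using real_arch_pow[of 2 x] by auto
  then have "\<exists>n. x < 2 ^ n" by blast
  \<comment> \<open>The least such n is positive because x \<ge> 1; its predecessor j satisfies 2^j
    \<le> x.\<close>
  define n where "n = (LEAST n. x < 2 ^ n)"
  have n: "x < 2 ^ n" unfolding n_def using \<open>\<exists>n. x < 2 ^ n\<close> by (rule LeastI_ex)
  with assms have "n \<noteq> 0" by (cases n) auto
  then obtain j where j: "n = Suc j" by (cases n) auto
  have "\<not> x < 2 ^ j" using not_less_Least[of j "\<lambda>n. x < 2 ^ n"] j by (simp add: n_def)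
  then have "(2 ^ j) ^ 4 \<le> x ^ 4" by (intro power_mono) auto
  moreover have "((2::real) ^ j) ^ 4 = 16 ^ j" by (simp flip: power_mult_distrib power_mult add: mult.commute[of j] power_mult)
  ultimately have "(1 / x) ^ 4 \<le> (1 / 16) ^ j"
    using assms by (simp add: power_divide field_simps)
  with n j show ?thesis by (intro that[of j]) auto
qed

text \<open>A sum over the dyadic disks around \<open>1 / cnj a\<close> on which \<open>\<bar>1 - cnj a * w\<bar>\<close> is at most
  \<open>2\<^sup>j\<^sup>+\<^sup>1 (1 - \<bar>a\<bar>)\<close> replaces the exact evaluation of the integral by power series.\<close>

lemma kernel_integral_bound:
  fixes a :: complex
  assumes a: "norm a < 1" and s: "4 \<le> s"
  shows "(\<integral>\<^sup>+w. ennreal (((1 - norm a) / norm (1 - cnj a * w)) powr s) \<partial>area_measure)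
    \<le> ennreal (64 * (1 - norm a)\<^sup>2)"
proof -
  define d where "d = 1 - norm a"
  have d: "0 < d" "d \<le> 1" using a by (auto simp: d_def)
  define x where "x = (\<lambda>w. norm (1 - cnj a * w) / d)"
  have x1: "1 \<le> x w" if "norm w < 1" for w
    using kernel_denominator_bound(1)[OF a that] d by (simp add: x_def d_def)
  \<comment> \<open>The base is at most 1, so the exponent may be lowered to 4. This still suffices:
    the weights 16^(-j) outweigh the areas of the dyadic disks, which grow like 4^j.\<close>
  have le4: "(d / norm (1 - cnj a * w)) powr s \<le> (1 / x w) ^ 4" if "norm w < 1" for w
  proof -
    have "d / norm (1 - cnj a * w) = 1 / x w" by (simp add: x_def)
    then have "(d / norm (1 - cnj a * w)) powr s = (1 / x w) powr s" by (simp only:)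
    also have "\<dots> \<le> (1 / x w) powr 4"
      using x1[OF that] s by (intro powr_mono') auto
    also have "\<dots> = (1 / x w) ^ 4"
      using x1[OF that] by (subst powr_numeral) auto
    finally show ?thesis .
  qed
  show ?thesis
  \<comment> \<open>For |a| at most 1/2 the integrand is at most 1 and the right side at least 16.
    Otherwise the centre 1 / cnj a of the dyadic disks is available.\<close>
  proof (cases "norm a \<le> 1 / 2")
    case True
    have "(\<integral>\<^sup>+w. ennreal ((d / norm (1 - cnj a * w)) powr s) \<partial>area_measure) \<le> (\<integral>\<^sup>+w. 1 \<partial>area_measure)"
    proof (rule nn_integral_mono)
      fix w assume "w \<in> space area_measure"
      then have w: "norm w < 1" by simp
      have "(d / norm (1 - cnj a * w)) powr s \<le> (1 / x w) ^ 4" by (rule le4[OF w])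
      also have "\<dots> \<le> 1" using x1[OF w] by (intro power_le_one) auto
      finally show "ennreal ((d / norm (1 - cnj a * w)) powr s) \<le> 1" by simp
    qed
    also have "\<dots> = ennreal 1" by (simp add: emeasure_area_measure_disk)
    also have "\<dots> \<le> ennreal (64 * d\<^sup>2)"
    proof (rule ennreal_leI)
      have "(1 / 2)\<^sup>2 \<le> d\<^sup>2" using True by (intro power_mono) (auto simp: d_def)
      then show "1 \<le> 64 * d\<^sup>2" by (simp add: power2_eq_square)
    qed
    finally show ?thesis by (simp add: d_def)
  next
    case False
    define b where "b = 1 / cnj a"
    have "a \<noteq> 0" using False by auto
    \<comment> \<open>Dividing by |a| > 1/2 costs a factor 2, hence 2^(j + 2) in place of 2^(j +
      1).\<close>
    have ball: "w \<in> ball b (2 ^ (j + 2) * d)" if "x w < 2 ^ Suc j" for w j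
    proof -
      have "1 - cnj a * w = cnj a * (b - w)" using \<open>a \<noteq> 0\<close> by (simp add: b_def field_simps)
      then have "norm (1 - cnj a * w) = norm a * norm (b - w)" by (simp add: norm_mult)
      moreover have "1 / 2 * norm (b - w) \<le> norm a * norm (b - w)"
        using False by (intro mult_right_mono) auto
      moreover have "norm (1 - cnj a * w) < 2 ^ Suc j * d"
        using that d by (simp add: x_def field_simps)
      ultimately have "norm (b - w) < 2 ^ (j + 2) * d" by simp
      then show ?thesis by (simp add: dist_norm)
    qed
    let ?t = "\<lambda>j w. ennreal ((1 / 16) ^ j) * indicator (ball b (2 ^ (j + 2) * d)) w :: ennreal"
    have pw: "ennreal ((d / norm (1 - cnj a * w)) powr s) \<le> (\<Sum>j. ?t j w)" if w: "norm w < 1" for w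
    proof -
      obtain j where j: "x w < 2 ^ Suc j" "(1 / x w) ^ 4 \<le> (1 / 16) ^ j"
        using inverse_power4_dyadic[OF x1[OF w]] by blast
      have "ennreal ((d / norm (1 - cnj a * w)) powr s) \<le> ennreal ((1 / 16) ^ j)"
        using le4[OF w] j(2) by (intro ennreal_leI) linarith
      also have "\<dots> = ?t j w" using ball[OF j(1)] by simp
      also have "\<dots> \<le> (\<Sum>j. ?t j w)"
        by (rule ennreal_le_suminf)
      finally show ?thesis .
    qed
    define T where "T = (\<lambda>w. \<Sum>j. ?t j w)"
    have [measurable]: "ball b \<delta> \<in> sets borel" for \<delta> by simp
    have [measurable]: "T \<in> borel_measurable borel" unfolding T_def by measurable
    have Tm: "T \<in> borel_measurable area_measure"
      using measurable_restrict_space1[of T borel borel unit_disk] \<open>T \<in> _\<close>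
      by (subst measurable_cong_sets[OF sets_area_measure refl])
    have "(\<integral>\<^sup>+w. ennreal ((d / norm (1 - cnj a * w)) powr s) \<partial>area_measure) \<le> (\<integral>\<^sup>+w. T w \<partial>area_measure)"
      unfolding T_def using pw by (intro nn_integral_mono) simp
    also have "\<dots> = ennreal (1 / pi) * (\<integral>\<^sup>+w. T w * indicator unit_disk w \<partial>lborel)"
      by (rule nn_integral_area_measure[OF Tm])
    also have "\<dots> \<le> ennreal (1 / pi) * (\<integral>\<^sup>+w. T w \<partial>lborel)"
      by (intro mult_left_mono nn_integral_mono) (auto simp: indicator_def)
    also have "(\<integral>\<^sup>+w. T w \<partial>lborel) = (\<Sum>j. \<integral>\<^sup>+w. ?t j w \<partial>lborel)"
      unfolding T_def by (rule nn_integral_suminf) measurable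
    also have "\<dots> = (\<Sum>j. ennreal (16 * pi * d\<^sup>2 * (1 / 4) ^ j))"
    proof (rule arg_cong[where f = suminf], rule ext)
      fix j :: nat
      have "(\<integral>\<^sup>+w. ?t j w \<partial>lborel) = ennreal ((1 / 16) ^ j) * ennreal (pi * (2 ^ (j + 2) * d)\<^sup>2)"
        using d emeasure_ball_complex[of "2 ^ (j + 2) * d" b]
        by (subst nn_integral_cmult_indicator) auto
      also have "\<dots> = ennreal ((1 / 16) ^ j * (pi * (2 ^ (j + 2) * d)\<^sup>2))"
        by (simp add: ennreal_mult)
      also have "(1 / 16) ^ j * (pi * (2 ^ (j + 2) * d)\<^sup>2) = 16 * pi * d\<^sup>2 * (1 / 4) ^ j"
      proof -
        have "((2::real) ^ (j + 2))\<^sup>2 = 16 * 4 ^ j"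
          by (simp add: power_add power_mult_distrib flip: power_mult) (simp add: power_mult mult.commute[of j])
        moreover have "(16::real) ^ j = 4 ^ j * 4 ^ j" by (simp flip: power_mult_distrib)
        ultimately show ?thesis by (simp add: power_mult_distrib power_divide)
      qed
      finally show "(\<integral>\<^sup>+w. ?t j w \<partial>lborel) = ennreal (16 * pi * d\<^sup>2 * (1 / 4) ^ j)" .
    qed
    also have "\<dots> = ennreal (16 * pi * d\<^sup>2 * (4 / 3))"
    proof -
      have "(\<lambda>j. (1 / 4 :: real) ^ j) sums (4 / 3)" using geometric_sums[of "1 / 4 :: real"] by simp
      from sums_mult[OF this, of "16 * pi * d\<^sup>2"] show ?thesis
        by (intro suminf_ennreal_eq) auto
    qed
    also have "ennreal (1 / pi) * \<dots> = ennreal (64 / 3 * d\<^sup>2)"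
      by (subst ennreal_mult[symmetric]) auto
    also have "\<dots> \<le> ennreal (64 * d\<^sup>2)"
      using zero_le_power2[of d] by (intro ennreal_leI) linarith
    finally show ?thesis by (simp add: d_def)
  qed
qed

text \<open>A power of the Szego kernel at a, scaled to have modulus at most 1 in the disk and at
  least 2^(-m) at a. If m p \<ge> 4, its A^p moment is at most 64 (1 - |a|)^2, comparable to the
  area of a disk of radius 1 - |a|.\<close>

definition peak :: "nat \<Rightarrow> complex \<Rightarrow> complex \<Rightarrow> complex" where
  "peak m a w = (complex_of_real (1 - norm a) / (1 - cnj a * w)) ^ m"

lemma peak_bounds:
  assumes a: "a \<in> unit_disk"
  shows "w \<in> unit_disk \<Longrightarrow> norm (peak m a w) \<le> ((1 - norm a) / (1 - norm w)) ^ m"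
    and "(1 / 2) ^ m \<le> norm (peak m a a)"
    and "0 < p \<Longrightarrow> peak m a \<in> bergman_space p"
    and "0 < p \<Longrightarrow> 4 \<le> real m * p \<Longrightarrow> mom p area_measure (peak m a) \<le> 64 * (1 - norm a)\<^sup>2"
proof -
  have a1: "norm a < 1" using a by simp
  have np: "norm (peak m a w) = ((1 - norm a) / norm (1 - cnj a * w)) ^ m" for w
    using a1 by (simp add: peak_def norm_power norm_divide del: of_real_diff)
  have pos: "0 < norm (1 - cnj a * w)" if "w \<in> unit_disk" for w
  proof -
    have "1 - norm a \<le> norm (1 - cnj a * w)"
      by (rule kernel_denominator_bound(1)) (use that a1 in simp_all)
    with a1 show ?thesis by linarith
  qed
  show "norm (peak m a w) \<le> ((1 - norm a) / (1 - norm w)) ^ m" if w: "w \<in> unit_disk"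
    unfolding np using kernel_denominator_bound(2)[OF a1, of w] a1 w
    by (intro power_mono divide_left_mono mult_pos_pos pos) auto
  have eq: "norm (1 - cnj a * a) = (1 - norm a) * (1 + norm a)"
  proof -
    have "1 - cnj a * a = complex_of_real (1 - (norm a)\<^sup>2)"
      by (simp only: of_real_diff of_real_1 complex_norm_square mult.commute)
    then have "norm (1 - cnj a * a) = \<bar>1 - (norm a)\<^sup>2\<bar>" by (simp only: norm_of_real)
    also have "\<dots> = 1 - (norm a)\<^sup>2" using a1 by (simp add: abs_square_le_1)
    finally show ?thesis by (simp add: power2_eq_square algebra_simps)
  qed
  have "(1 - norm a) / ((1 - norm a) * (1 + norm a)) = 1 / (1 + norm a)"
    using a1 by simp
  moreover have "1 / 2 \<le> 1 / (1 + norm a)"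
    using a1 by (intro divide_left_mono) (auto simp: add_pos_nonneg)
  ultimately have "1 / 2 \<le> (1 - norm a) / ((1 - norm a) * (1 + norm a))" by (simp only:)
  then show "(1 / 2) ^ m \<le> norm (peak m a a)"
    unfolding np eq by (intro power_mono) auto
  have hol: "peak m a holomorphic_on unit_disk"
    unfolding peak_def using pos by (intro holomorphic_intros) fastforce
  have le1: "norm (peak m a w) \<le> 1" if "w \<in> unit_disk" for w
    unfolding np using kernel_denominator_bound(1)[OF a1, of w] that a1 pos[OF that]
    by (intro power_le_one) (auto simp: divide_le_eq_1)
  show A: "peak m a \<in> bergman_space p" if "0 < p"
    by (rule bergman_if_bounded[OF hol le1 that])
  show "mom p area_measure (peak m a) \<le> 64 * (1 - norm a)\<^sup>2" if p: "0 < p" "4 \<le> real m * p"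
  proof -
    have "0 < m" using p by (cases m) auto
    have "qmom p area_measure (peak m a)
        = (\<integral>\<^sup>+w. ennreal (((1 - norm a) / norm (1 - cnj a * w)) powr (real m * p)) \<partial>area_measure)"
      unfolding qmom_def
    proof (rule nn_integral_cong)
      fix w assume "w \<in> space area_measure"
      then have xpos: "0 < (1 - norm a) / norm (1 - cnj a * w)" using a1 pos by simp
      then show "ennreal (norm (peak m a w) powr p) = ennreal (((1 - norm a) / norm (1 - cnj a * w)) powr (real m * p))"
        unfolding np by (simp only: powr_realpow[OF xpos, symmetric] powr_powr)
    qed
    also have "\<dots> \<le> ennreal (64 * (1 - norm a)\<^sup>2)"
      by (rule kernel_integral_bound[OF a1 p(2)])
    finally show ?thesis using A[OF p(1)] by (simp add: mom_le_iff bergman_Lq)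
  qed
qed

section \<open>Measures carried by a zero set\<close>

lemma AE_atom:
  assumes "AE x in M. P x" "{y} \<in> sets M" "emeasure M {y} \<noteq> 0"
  shows "P y"
proof (rule ccontr)
  assume "\<not> P y"
  obtain N where N: "{x \<in> space M. \<not> P x} \<subseteq> N" "emeasure M N = 0" "N \<in> sets M"
    using AE_E[OF assms(1)] by blast
  have "{y} \<subseteq> N" using \<open>\<not> P y\<close> N(1) sets.sets_into_space[OF assms(2)] by blast
  then have "emeasure M {y} \<le> emeasure M N" using N(3) by (rule emeasure_mono)
  with N(2) assms(3) show False by simp
qed

lemma carleson_finite_measure:
  assumes p: "0 < p" and q: "0 < q" and \<mu>: "pq_bergman_carleson p q \<mu>"
  shows "emeasure \<mu> (space \<mu>) < \<infinity>"
proof -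
  have "(\<lambda>z. 1) \<in> bergman_space p" using power_in_bergman[OF p, of 0] by simp
  then have "(\<lambda>z. 1) \<in> Lq_fun q \<mu>" by (rule pq_bergman_carlesonD(2)[OF \<mu>])
  then show ?thesis by (simp add: Lq_fun_iff_qmom qmom_def)
qed

text \<open>A nonconstant function has finitely many zeros in each smaller closed disk, hence
  countably many in all, and a measure carried by a countable set is carried by its points of
  positive mass. Without finite support there are infinitely many of them, and the same finiteness
  drives them to the boundary.\<close>

lemma zero_set_atoms:
  assumes p: "0 < p" and q: "0 < q" and \<mu>: "pq_bergman_carleson p q \<mu>" and nfs: "\<not> finitely_supported \<mu>"
    and f: "f holomorphic_on unit_disk" and AEf: "AE z in \<mu>. f z = 0" and nz: "w \<in> unit_disk" "f w \<noteq> 0"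
  obtains z :: "nat \<Rightarrow> complex" and a :: "nat \<Rightarrow> real"
  where "\<not> f constant_on unit_disk" "inj z" "\<And>n. z n \<in> unit_disk" "\<And>n. f (z n) = 0" "\<And>n. 0 < a n"
    "\<And>n. emeasure \<mu> {z n} = ennreal (a n)" "AE x in \<mu>. x \<in> range z" "(\<lambda>n. norm (z n)) \<longlonglongrightarrow> 1"
proof -
  note bm = pq_bergman_carlesonD(1)[OF \<mu>]
  note sp = space_borel_measure_on_disk[OF bm]
  have sing: "{x} \<in> sets \<mu>" if "x \<in> unit_disk" for x
    using that by (simp add: sets_borel_measure_on_disk[OF bm])
  have null_ex: "emeasure \<mu> (unit_disk - F) = 0" if "AE x in \<mu>. x \<in> F" for F
    using emeasure_eq_0_AE[of "\<lambda>x. x \<notin> F" \<mu>] that by (simp add: sp set_diff_eq)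
  \<comment> \<open>A nonzero constant would make \<mu> null, and so carried by the empty
    set.\<close>
  have nconst: "\<not> f constant_on unit_disk"
  proof
    assume "f constant_on unit_disk"
    then have "f x \<noteq> 0" if "x \<in> unit_disk" for x
      using nz that unfolding constant_on_def by metis
    then have "AE x in \<mu>. x \<in> {}"
      using AEf AE_space by (auto elim!: eventually_elim2 simp: sp)
    then have "emeasure \<mu> (unit_disk - {}) = 0" by (rule null_ex)
    then show False using nfs unfolding finitely_supported_def by blast
  qed
  define Z where "Z = {x \<in> unit_disk. f x = 0}"
  have fin: "finite {x \<in> cball 0 r. f x = 0}" if "r < 1" for r
    using that nconst by (intro holomorphic_compact_finite_zeros[OF f]) auto
  have "Z \<subseteq> (\<Union>n. {x \<in> cball 0 (1 - 1 / real (Suc n)). f x = 0})"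
  proof
    fix x assume x: "x \<in> Z"
    then have "0 < 1 - norm x" by (auto simp: Z_def)
    then obtain n where "inverse (real (Suc n)) < 1 - norm x" using reals_Archimedean by blast
    then show "x \<in> (\<Union>n. {x \<in> cball 0 (1 - 1 / real (Suc n)). f x = 0})"
      using x by (auto simp: Z_def inverse_eq_divide intro!: exI[of _ n])
  qed
  then have cZ: "countable Z"
  proof (rule countable_subset, intro countable_UN)
    show "countable {x \<in> cball 0 (1 - 1 / real (Suc n)). f x = 0}" for n
      by (rule countable_finite[OF fin]) simp
  qed simp
  define E where "E = {x \<in> Z. emeasure \<mu> {x} \<noteq> 0}"
  have cE: "countable E" using cZ by (auto simp: E_def intro: countable_subset)
  have "emeasure \<mu> (Z - E) = 0"
  proof -
    have "(\<Union>x\<in>Z - E. {x}) \<in> null_sets \<mu>"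
      using cZ sing by (intro null_sets_UN') (auto simp: E_def Z_def null_sets_def)
    then show ?thesis by (simp add: null_sets_def)
  qed
  have Zsub: "Z - E \<in> sets \<mu>"
    by (rule sets.countable) (use sing cZ in \<open>auto simp: Z_def\<close>)
  have AE_E: "AE x in \<mu>. x \<in> E"
  proof -
    have "AE x in \<mu>. x \<notin> Z - E"
      using \<open>emeasure \<mu> (Z - E) = 0\<close> Zsub by (intro AE_not_in) (simp add: null_sets_def)
    then show ?thesis using AEf AE_space
      by eventually_elim (auto simp: Z_def sp)
  qed
  have "E \<subseteq> unit_disk" by (auto simp: E_def Z_def)
  have "infinite E"
  proof
    assume "finite E"
    moreover have "emeasure \<mu> (unit_disk - E) = 0"
      by (rule null_ex[OF AE_E])
    ultimately show False using nfs \<open>E \<subseteq> unit_disk\<close> unfolding finitely_supported_def by blast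
  qed
  define z where "z = from_nat_into E"
  have bij: "bij_betw z UNIV E" unfolding z_def using cE \<open>infinite E\<close> by (rule bij_betw_from_nat_into)
  then have z: "inj z" "range z = E" by (auto simp: bij_betw_def)
  have zE: "z n \<in> E" for n using z(2) by blast
  have zn: "z n \<in> unit_disk" "f (z n) = 0" "emeasure \<mu> {z n} \<noteq> 0" for n
    using zE[of n] by (auto simp: E_def Z_def)
  have em: "emeasure \<mu> {z n} = ennreal (measure \<mu> {z n})" for n
  proof -
    have "emeasure \<mu> {z n} \<le> emeasure \<mu> (space \<mu>)" by (rule emeasure_space)
    also have "\<dots> < \<infinity>" by (rule carleson_finite_measure[OF p q \<mu>])
    finally show ?thesis by (intro emeasure_eq_ennreal_measure) simp
  qed
  have "0 < measure \<mu> {z n}" for n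
    using zn(3)[of n] em[of n] measure_nonneg[of \<mu> "{z n}"] by (auto simp: less_le)
  moreover have "(\<lambda>n. norm (z n)) \<longlonglongrightarrow> 1"
  proof (rule order_tendstoI)
    fix r :: real assume "r < 1"
    have "{n. \<not> r < norm (z n)} \<subseteq> z -` {x \<in> cball 0 r. f x = 0}" using zn(2) by auto
    moreover have "finite (z -` {x \<in> cball 0 r. f x = 0})"
      using fin[OF \<open>r < 1\<close>] z(1) by (intro finite_vimageI) auto
    ultimately show "\<forall>\<^sub>F n in sequentially. r < norm (z n)"
      unfolding cofinite_eq_sequentially[symmetric] eventually_cofinite by (rule finite_subset)
  next
    fix r :: real assume "1 < r"
    then show "\<forall>\<^sub>F n in sequentially. norm (z n) < r"
      using zn(1) by (intro always_eventually allI) (auto intro: less_trans)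
  qed
  ultimately show ?thesis
    using AE_E z zn em nconst by (intro that[of z "\<lambda>n. measure \<mu> {z n}"]) auto
qed

text \<open>Division by the full power (w - \<xi>)^n removes the zero at \<xi> and no other. The
  quotient is bounded on the disk of radius r/2 by compactness, and outside this disk the divisor is
  bounded below, so the moment stays finite.\<close>

lemma bergman_divide_zero:
  assumes p: "0 < p" and f: "f \<in> bergman_space p" and nconst: "\<not> f constant_on unit_disk"
    and \<xi>: "\<xi> \<in> unit_disk" "f \<xi> = 0"
  obtains h where "h \<in> bergman_space p" "h \<xi> = 1" "\<And>w. f w = 0 \<Longrightarrow> w \<noteq> \<xi> \<Longrightarrow> h w = 0"
proof -
  have fh: "f holomorphic_on unit_disk" using f by (simp add: bergman_space_iff)
  obtain g r n where g: "0 < n" "0 < r" "ball \<xi> r \<subseteq> unit_disk" "g holomorphic_on ball \<xi> r"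
    "\<And>w. w \<in> ball \<xi> r \<Longrightarrow> f w = (w - \<xi>) ^ n * g w" "\<And>w. w \<in> ball \<xi> r \<Longrightarrow> g w \<noteq> 0"
    by (rule holomorphic_factor_zero_nonconstant[OF fh open_ball connected_ball \<xi> nconst]) (rule that; assumption)
  \<comment> \<open>The value at \<xi> is that of the zero-free factor g, which removes the
    singularity and makes h \<xi> nonzero.\<close>
  define h where "h = (\<lambda>w. if w = \<xi> then g \<xi> else f w / (w - \<xi>) ^ n)"
  have hg: "h w = g w" if "w \<in> ball \<xi> r" for w
    using g(5)[OF that] by (auto simp: h_def)
  have "h holomorphic_on (unit_disk - {\<xi>}) \<union> ball \<xi> r"
  proof (rule holomorphic_on_Un)
    have "(\<lambda>w. f w / (w - \<xi>) ^ n) holomorphic_on unit_disk - {\<xi>}"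
      using fh by (intro holomorphic_intros) (auto intro: holomorphic_on_subset)
    then show "h holomorphic_on unit_disk - {\<xi>}"
      by (rule holomorphic_transform) (simp add: h_def)
    show "h holomorphic_on ball \<xi> r"
      by (rule holomorphic_transform[OF g(4)]) (simp add: hg)
  qed auto
  also have "(unit_disk - {\<xi>}) \<union> ball \<xi> r = unit_disk" using g(2,3) by auto
  finally have hh: "h holomorphic_on unit_disk" .
  have "compact (h ` cball \<xi> (r / 2))"
    using g(2,3) by (intro compact_continuous_image holomorphic_on_imp_continuous_on holomorphic_on_subset[OF hh])
      (auto simp: subset_iff)
  then obtain B where B: "\<And>w. w \<in> cball \<xi> (r / 2) \<Longrightarrow> norm (h w) \<le> B"
    using compact_imp_bounded bounded_iff by (metis imageI)
  define K where "K = 1 / (r / 2) ^ n"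
  have hm: "h \<in> borel_measurable area_measure"
    by (rule holomorphic_measurable_disk[OF hh borel_measure_on_disk_area])
  have [measurable]: "f \<in> borel_measurable area_measure" by (rule bergman_measurable_area[OF f])
  have "qmom p area_measure h \<le> (\<integral>\<^sup>+w. ennreal (B powr p) + ennreal (norm (of_real K * f w) powr p) \<partial>area_measure)"
    unfolding qmom_def
  proof (rule nn_integral_mono)
    fix w assume "w \<in> space area_measure"
    have "norm (h w) powr p \<le> B powr p + norm (of_real K * f w) powr p"
    proof (cases "w \<in> cball \<xi> (r / 2)")
      case True
      then have "norm (h w) powr p \<le> B powr p" using B p by (intro powr_mono2) auto
      then show ?thesis by (simp add: add_increasing2)
    next
      case False
      then have far: "r / 2 \<le> norm (w - \<xi>)" by (simp add: dist_norm norm_minus_commute)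
      then have "(r / 2) ^ n \<le> norm (w - \<xi>) ^ n" using g(2) by (intro power_mono) auto
      moreover have "w \<noteq> \<xi>" using far g(2) by auto
      ultimately have "norm (h w) \<le> norm (f w) / (r / 2) ^ n"
        using g(2) by (auto simp: h_def norm_divide norm_power intro!: divide_left_mono mult_pos_pos)
      also have "\<dots> = norm (of_real K * f w)"
        using g(2) by (simp add: K_def norm_mult norm_divide norm_power)
      finally have "norm (h w) powr p \<le> norm (of_real K * f w) powr p"
        using p by (intro powr_mono2) auto
      then show ?thesis by (simp add: add_increasing)
    qed
    then show "ennreal (norm (h w) powr p) \<le> ennreal (B powr p) + ennreal (norm (of_real K * f w) powr p)"
      by (simp flip: ennreal_plus)
  qed
  also have "\<dots> = ennreal (B powr p) + qmom p area_measure (\<lambda>w. of_real K * f w)"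
    unfolding qmom_def by (subst nn_integral_add) (auto simp: emeasure_area_measure_disk)
  also have "\<dots> < \<infinity>"
    using bergman_scale[OF f p, of "of_real K"] by (auto simp: bergman_space_iff)
  finally have "h \<in> bergman_space p" using hh by (simp add: bergman_space_iff)
  moreover have "h \<xi> \<noteq> 0" using g(2,6) by (simp add: h_def)
  moreover have "h w = 0" if "f w = 0" "w \<noteq> \<xi>" for w using that by (simp add: h_def)
  ultimately show ?thesis
    using bergman_scale[OF _ p, of h "1 / h \<xi>"] by (intro that[of "\<lambda>w. 1 / h \<xi> * h w"]) auto
qed

section \<open>Closed range on an atomic measure\<close>

lemma bergman_sum:
  assumes "0 < p" "\<And>i. i \<in> I \<Longrightarrow> f i \<in> bergman_space p"
  shows "(\<lambda>z. \<Sum>i\<in>I. c i * f i z) \<in> bergman_space p"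
  using assms(2)
proof (induction I rule: infinite_finite_induct)
  case (insert x F)
  then show ?case
    using bergman_lincomb(1)[OF bergman_scale[of "f x" p "c x"] insert.IH] \<open>0 < p\<close> by simp
qed auto

text \<open>The function whose zeros carry \<mu> survives only through \<open>point\<close>, which
  separates each atom from all the others. The exponents stay apart until their equality is proved
  inside.\<close>

locale atomic_embedding =
  fixes p q :: real and \<mu> :: "complex measure" and z :: "nat \<Rightarrow> complex" and a :: "nat \<Rightarrow> real"
  assumes p: "0 < p" and q: "0 < q" and carleson: "pq_bergman_carleson p q \<mu>"
    and closed: "closed_range p q \<mu>"
    and inj_z: "inj z" and z_disk: "\<And>n. z n \<in> unit_disk" and a_pos: "\<And>n. 0 < a n"
    and atom: "\<And>n. emeasure \<mu> {z n} = ennreal (a n)" and AE_range: "AE x in \<mu>. x \<in> range z"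
    and boundary: "(\<lambda>n. norm (z n)) \<longlonglongrightarrow> 1"
    and point: "\<And>n. \<exists>e\<in>bergman_space p. e (z n) = 1 \<and> (\<forall>m. m \<noteq> n \<longrightarrow> e (z m) = 0)"
begin

definition d :: "nat \<Rightarrow> real" where "d n = 1 - norm (z n)"

lemma d_pos: "0 < d n"
  using z_disk[of n] by (auto simp: d_def)

lemma d_lim: "d \<longlonglongrightarrow> 0"
  using tendsto_diff[OF tendsto_const[of 1] boundary] by (simp add: d_def[abs_def])

lemmas bm = pq_bergman_carlesonD(1)[OF carleson]
lemmas Lq = pq_bergman_carlesonD(2)[OF carleson]

lemma sing: "{z n} \<in> sets \<mu>"
  using z_disk[of n] by (simp add: sets_borel_measure_on_disk[OF bm])

lemma qmom_atomic: "qmom r \<mu> g = (\<Sum>n. ennreal (norm (g (z n)) powr r * a n))"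
  unfolding qmom_def
  by (subst nn_integral_atomic[OF inj_z sing AE_range]) (simp add: atom ennreal_mult a_pos less_imp_le)

lemma eq_at_atoms: "AE x in \<mu>. f x = g x \<Longrightarrow> f (z n) = g (z n)"
  using a_pos[of n] by (intro AE_atom[of "\<lambda>x. f x = g x"]) (auto simp: sing atom ennreal_eq_0_iff)

lemma surjective:
  assumes g: "g \<in> Lq_fun q \<mu>"
  shows "\<exists>f\<in>bergman_space p. \<forall>n. f (z n) = g (z n)"
proof -
  obtain e where e: "\<And>n. e n \<in> bergman_space p" "\<And>n. e n (z n) = 1" "\<And>n m. m \<noteq> n \<Longrightarrow> e n (z m) = 0"
    using point by metis
  define s where "s = (\<lambda>n. norm (g (z n)) powr q * a n)"
  have s0: "0 \<le> s n" for n using a_pos[of n] by (simp add: s_def)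
  have "(\<Sum>n. ennreal (s n)) \<noteq> top"
    using g by (auto simp: Lq_fun_iff_qmom qmom_atomic s_def)
  then have sm: "summable s" using s0 by (intro summable_suminf_not_top) auto
  have "\<exists>f\<in>bergman_space p. AE x in \<mu>. f x = g x"
  proof (rule closed[unfolded closed_range_def, rule_format, OF g])
    fix \<epsilon> :: real assume "0 < \<epsilon>"
    then obtain N where N: "norm (\<Sum>i. s (i + N)) < \<epsilon>"
      using suminf_exist_split[OF _ sm] by blast
    \<comment> \<open>A Bergman function that realises the truncation of g to the first N atoms; its
      distance to g is the tail of a convergent series.\<close>
    define f where "f = (\<lambda>x. \<Sum>n<N. g (z n) * e n x)"
    have fz: "f (z m) = (if m < N then g (z m) else 0)" for m
    proof -
      have "f (z m) = (\<Sum>n<N. if n = m then g (z m) else 0)"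
        unfolding f_def by (intro sum.cong) (auto simp: e)
      then show ?thesis by (simp add: sum.delta)
    qed
    define t where "t = (\<lambda>n. if n < N then 0 else s n)"
    have tm: "summable t"
      by (rule summable_comparison_test'[OF sm, of 0]) (use s0 in \<open>auto simp: t_def\<close>)
    have "norm (f (z n) - g (z n)) powr q * a n = t n" for n
      by (simp add: fz t_def s_def)
    then have "qmom q \<mu> (\<lambda>x. f x - g x) = (\<Sum>n. ennreal (t n))"
      by (simp add: qmom_atomic)
    also have "\<dots> = ennreal (suminf t)"
      using s0 tm by (intro suminf_ennreal2) (auto simp: t_def)
    also have "suminf t = (\<Sum>n. t (n + N)) + (\<Sum>n<N. t n)"
      by (rule suminf_split_initial_segment[OF tm])
    also have "\<dots> = (\<Sum>n. s (n + N))" by (simp add: t_def)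
    also have "ennreal \<dots> \<le> ennreal \<epsilon>" using N by (intro ennreal_leI) auto
    finally have "qmom q \<mu> (\<lambda>x. f x - g x) \<le> ennreal \<epsilon>" .
    moreover have "f \<in> bergman_space p" unfolding f_def using p e by (intro bergman_sum)
    ultimately show "\<exists>f\<in>bergman_space p. qmom q \<mu> (\<lambda>x. f x - g x) \<le> ennreal \<epsilon>" by blast
  qed
  then show ?thesis using eq_at_atoms by blast
qed

section \<open>Two-sided estimates for the masses of the atoms\<close>

lemma lift_bound:
  obtains C where "0 < C" "\<And>f. f \<in> bergman_space p \<Longrightarrow>
    \<exists>h\<in>bergman_space p. (\<forall>n. h (z n) = f (z n)) \<and> mom p area_measure h \<le> C * mom q \<mu> f powr (p / q)"
proof -
  obtain C where C: "0 < C" "\<And>f. f \<in> bergman_space p \<Longrightarrow>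
    \<exists>h\<in>bergman_space p. (AE z in \<mu>. h z = f z) \<and> mom p area_measure h \<le> C * mom q \<mu> f powr (p / q)"
    by (rule embedding_open[OF p q carleson closed]) (rule that; assumption)
  show ?thesis
  proof (rule that[OF C(1)])
    fix f assume "f \<in> bergman_space p"
    from C(2)[OF this] show "\<exists>h\<in>bergman_space p. (\<forall>n. h (z n) = f (z n)) \<and>
      mom p area_measure h \<le> C * mom q \<mu> f powr (p / q)"
      using eq_at_atoms by blast
  qed
qed

lemma mom_ge_term:
  assumes "f \<in> bergman_space p"
  shows "norm (f (z n)) powr q * a n \<le> mom q \<mu> f"
proof -
  have "ennreal (norm (f (z n)) powr q * a n) \<le> qmom q \<mu> f"
    unfolding qmom_atomic by (rule ennreal_le_suminf)
  then show ?thesis using Lq[OF assms] by (simp add: qmom_eq_mom)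
qed

lemma weights_lower: "\<exists>c>0. \<forall>n. c * ((d n)\<^sup>2) powr (q / p) \<le> a n"
proof -
  obtain C where C: "0 < C" "\<And>f. f \<in> bergman_space p \<Longrightarrow>
    \<exists>h\<in>bergman_space p. (\<forall>n. h (z n) = f (z n)) \<and> mom p area_measure h \<le> C * mom q \<mu> f powr (p / q)"
    by (rule lift_bound) (rule that; assumption)
  obtain K :: real where K: "0 < K" "\<And>f a. f \<in> bergman_space p \<Longrightarrow> a \<in> unit_disk \<Longrightarrow>
       norm (f a) powr p * (1 - norm a)\<^sup>2 \<le> K * mom p area_measure f"
    using bergman_point_bound_mom[OF p] by blast
  have "(1 / (K * C)) powr (q / p) * ((d n)\<^sup>2) powr (q / p) \<le> a n" for n
  proof -
    obtain e where e: "e \<in> bergman_space p" "e (z n) = 1" "\<And>m. m \<noteq> n \<Longrightarrow> e (z m) = 0"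
      using point[of n] by blast
    \<comment> \<open>A single atom contributes, so the L^q(\<mu>) moment of e is the mass
      \<open>a n\<close>. A lift h is also 1 at z_n, so the point bound for h gives (d n)^2 \<le> K
      C a_n^(p/q).\<close>
    have "qmom q \<mu> e = (\<Sum>m\<in>{n}. ennreal (norm (e (z m)) powr q * a m))"
      unfolding qmom_atomic using e by (intro suminf_finite) auto
    then have "mom q \<mu> e = a n"
      using Lq[OF e(1)] e(2) a_pos[of n] by (simp add: qmom_eq_mom)
    then obtain h where h: "h \<in> bergman_space p" "h (z n) = 1" "mom p area_measure h \<le> C * a n powr (p / q)"
      using C(2)[OF e(1)] e(2) by auto
    have "(d n)\<^sup>2 \<le> K * mom p area_measure h"
      using K(2)[OF h(1) z_disk[of n]] by (simp add: h(2) d_def)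
    also have "\<dots> \<le> K * (C * a n powr (p / q))" using h(3) K(1) by (intro mult_left_mono) auto
    finally have "1 / (K * C) * (d n)\<^sup>2 \<le> a n powr (p / q)" using K C by (simp add: field_simps)
    then have "(1 / (K * C) * (d n)\<^sup>2) powr (q / p) \<le> (a n powr (p / q)) powr (q / p)"
      using K C p q by (intro powr_mono2) auto
    also have "\<dots> = a n" using p q a_pos[of n] by (simp add: powr_powr)
    also have "(1 / (K * C) * (d n)\<^sup>2) powr (q / p) = (1 / (K * C)) powr (q / p) * ((d n)\<^sup>2) powr (q / p)"
      using K C by (subst powr_mult) auto
    finally show ?thesis .
  qed
  moreover have "0 < (1 / (K * C)) powr (q / p)" using K C by simp
  ultimately show ?thesis by blast
qed

lemma ex_peak_exponent:
  obtains m :: nat where "4 \<le> real m * p"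
proof -
  obtain m :: nat where "4 / p < real m" using reals_Archimedean2 by blast
  then have "4 \<le> real m * p" using p by (simp add: field_simps)
  then show ?thesis by (rule that)
qed

lemma weights_upper: "\<exists>C>0. \<forall>n. a n \<le> C * ((d n)\<^sup>2) powr (q / p)"
proof -
  obtain m where m: "4 \<le> real m * p" by (rule ex_peak_exponent)
  obtain D where D: "0 < D" "\<And>f. f \<in> bergman_space p \<Longrightarrow> mom q \<mu> f \<le> D * mom p area_measure f powr (q / p)"
    using embedding_bounded[OF p q carleson] by blast
  define \<kappa> where "\<kappa> = ((1 / 2 :: real) ^ m) powr q"
  have "0 < \<kappa>" by (simp add: \<kappa>_def)
  have "a n \<le> (D * 64 powr (q / p) / \<kappa>) * ((d n)\<^sup>2) powr (q / p)" for n
  proof -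
    note pk = peak_bounds[OF z_disk[of n], where m = m]
    have "\<kappa> * a n \<le> norm (peak m (z n) (z n)) powr q * a n"
      unfolding \<kappa>_def using pk(2) q a_pos[of n] by (intro mult_right_mono powr_mono2) auto
    also have "\<dots> \<le> mom q \<mu> (peak m (z n))" by (rule mom_ge_term[OF pk(3)[OF p]])
    also have "\<dots> \<le> D * mom p area_measure (peak m (z n)) powr (q / p)" by (rule D(2)[OF pk(3)[OF p]])
    also have "\<dots> \<le> D * (64 * (d n)\<^sup>2) powr (q / p)"
      using pk(4)[OF p m] D(1) p q by (intro mult_left_mono powr_mono2) (auto simp: d_def)
    also have "\<dots> = D * 64 powr (q / p) * ((d n)\<^sup>2) powr (q / p)" by (simp add: powr_mult)
    finally show ?thesis using \<open>0 < \<kappa>\<close> by (simp add: field_simps)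
  qed
  moreover have "0 < D * 64 powr (q / p) / \<kappa>" using D \<open>0 < \<kappa>\<close> by simp
  ultimately show ?thesis by blast
qed

section \<open>Equality of the exponents in the atomic case\<close>

lemma p_le_q: "p \<le> q"
proof -
  obtain m where m: "4 \<le> real m * p" by (rule ex_peak_exponent)
  obtain D where D: "0 < D" "\<And>f. f \<in> bergman_space p \<Longrightarrow> mom q \<mu> f \<le> D * mom p area_measure f powr (q / p)"
    using embedding_bounded[OF p q carleson] by blast
  obtain c where c: "0 < c" "\<And>n. c * ((d n)\<^sup>2) powr (q / p) \<le> a n" using weights_lower by blast
  \<comment> \<open>The factor d_n^(-2/p) brings the A^p moment down to order 1. At z_n it makes
    |u_n|^q at least of order d_n^(-2q/p), which cancels the power of d_n in the lower bound for
    \<open>a n\<close>.\<close>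
  define u where "u = (\<lambda>n x. complex_of_real (d n powr (- (2 / p))) * peak m (z n) x)"
  have u: "u n \<in> bergman_space p" for n
    unfolding u_def using p by (intro bergman_scale peak_bounds(3) z_disk)
  have sq: "(d n)\<^sup>2 = d n powr 2" for n using d_pos[of n] by simp
  have up: "mom p area_measure (u n) \<le> 64" for n
  proof -
    have "mom p area_measure (u n) = (d n powr (- (2 / p))) powr p * mom p area_measure (peak m (z n))"
      by (simp add: u_def mom_scale)
    also have "(d n powr (- (2 / p))) powr p = d n powr (- 2)" using p by (subst powr_powr) simp
    also have "\<dots> * mom p area_measure (peak m (z n)) \<le> d n powr (- 2) * (64 * (d n)\<^sup>2)"
      using peak_bounds(4)[OF z_disk[of n] p m] by (intro mult_left_mono) (auto simp: d_def)
    also have "\<dots> = 64 * (d n powr (- 2) * d n powr 2)" by (simp only: sq mult.left_commute)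
    also have "\<dots> = 64" using d_pos[of n] by (simp only: powr_add[symmetric]) simp
    finally show ?thesis .
  qed
  have uq: "mom q \<mu> (u n) \<le> D * 64 powr (q / p)" for n
    using up[of n] D(1) p q by (intro order_trans[OF D(2)[OF u]] mult_left_mono powr_mono2) auto
  define c1 where "c1 = c * ((1 / 2) ^ m) powr q"
  have "0 < c1" using c by (simp add: c1_def)
  have lq: "c1 \<le> mom q \<mu> (u n)" for n
  proof -
    have "(1 / 2) ^ m * d n powr (- (2 / p)) \<le> norm (u n (z n))"
      using peak_bounds(2)[OF z_disk[of n], of m]
      by (simp add: u_def norm_mult mult.commute[of "d n powr _"] mult_right_mono)
    then have 1: "((1 / 2) ^ m * d n powr (- (2 / p))) powr q \<le> norm (u n (z n)) powr q"
      using q by (intro powr_mono2) auto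
    have "((d n)\<^sup>2) powr (q / p) = d n powr (2 * q / p)"
      by (simp only: sq powr_powr) simp
    moreover have "((1 / 2) ^ m * d n powr (- (2 / p))) powr q = ((1 / 2) ^ m) powr q * d n powr (- (2 * q / p))"
      by (simp add: powr_mult powr_powr)
    moreover have "d n powr (- (2 * q / p)) * d n powr (2 * q / p) = 1"
      using d_pos[of n] by (simp only: powr_add[symmetric]) simp
    ultimately have "c1 = ((1 / 2) ^ m * d n powr (- (2 / p))) powr q * (c * ((d n)\<^sup>2) powr (q / p))"
      by (simp add: c1_def)
    also have "\<dots> \<le> norm (u n (z n)) powr q * a n"
      using 1 c by (intro mult_mono) auto
    also have "\<dots> \<le> mom q \<mu> (u n)" by (rule mom_ge_term[OF u])
    finally show ?thesis .
  qed
  \<comment> \<open>Boundedness read backwards: an L^q(\<mu>) moment bounded below forces the same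
    in A^p, which spares a lower estimate of the kernel integral.\<close>
  have lp: "(c1 / D) powr (p / q) \<le> mom p area_measure (u n)" for n
  proof -
    have "c1 \<le> D * mom p area_measure (u n) powr (q / p)" by (rule order_trans[OF lq D(2)[OF u]])
    then have "c1 / D \<le> mom p area_measure (u n) powr (q / p)" using D(1) by (simp add: field_simps)
    then have "(c1 / D) powr (p / q) \<le> (mom p area_measure (u n) powr (q / p)) powr (p / q)"
      using D(1) \<open>0 < c1\<close> p q by (intro powr_mono2) auto
    then show ?thesis using p q by (simp add: powr_powr)
  qed
  have lim: "(\<lambda>n. u n w) \<longlonglongrightarrow> 0" if w: "w \<in> unit_disk" for w
  proof -
    \<comment> \<open>At a fixed w the kernel decays like d_n^m while the normalisation grows like
      d_n^(-2/p); m p \<ge> 4 makes the first prevail.\<close>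
    define s where "s = real m - 2 / p"
    have "0 < s" using m p by (simp add: s_def field_simps)
    have le: "norm (u n w) \<le> (1 / (1 - norm w)) ^ m * d n powr s" for n
    proof -
      have "norm (u n w) \<le> d n powr (- (2 / p)) * (d n / (1 - norm w)) ^ m"
        using peak_bounds(1)[OF z_disk[of n] w, of m] unfolding u_def d_def[symmetric] norm_mult
        by (intro mult_mono) auto
      also have "\<dots> = (1 / (1 - norm w)) ^ m * (d n powr (- (2 / p)) * d n powr real m)"
        using d_pos[of n] by (simp add: power_divide powr_realpow)
      also have "d n powr (- (2 / p)) * d n powr real m = d n powr s"
        by (simp add: s_def flip: powr_add)
      finally show ?thesis .
    qed
    have "(\<lambda>n. d n powr s) \<longlonglongrightarrow> 0 powr s"
      using \<open>0 < s\<close> less_imp_le[OF d_pos] by (intro tendsto_powr' d_lim tendsto_const) auto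
    from tendsto_mult[OF tendsto_const this, of "(1 / (1 - norm w)) ^ m"]
    have "(\<lambda>n. (1 / (1 - norm w)) ^ m * d n powr s) \<longlonglongrightarrow> 0" by simp
    then show ?thesis by (rule Lim_null_comparison[rotated]) (simp add: le)
  qed
  define c2 where "c2 = min c1 ((c1 / D) powr (p / q))"
  define B where "B = max 64 (D * 64 powr (q / p))"
  have "0 < c2" using \<open>0 < c1\<close> D(1) by (simp add: c2_def)
  then show ?thesis
  proof (rule bumps_imp_le(1)[OF p q carleson _ u lim])
    show "mom p area_measure (u n) \<in> {c2..B}" for n
      using lp[of n] up[of n] by (auto simp: c2_def B_def min_le_iff_disj le_max_iff_disj)
    show "mom q \<mu> (u n) \<in> {c2..B}" for n
      using lq[of n] uq[of n] by (auto simp: c2_def B_def min_le_iff_disj le_max_iff_disj)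
  qed
qed

text \<open>If the disks for j < k met, a comparison of the moduli of the centres alone would give
  d(\<tau> j) < 3 d(\<tau> k). Shrinking d by a factor of more than 3 at each step therefore
  separates all of them.\<close>

lemma separated_subsequence:
  obtains \<tau> :: "nat \<Rightarrow> nat" where "inj \<tau>"
    "\<And>j k. j \<noteq> k \<Longrightarrow> ball (z (\<tau> j)) (d (\<tau> j) / 2) \<inter> ball (z (\<tau> k)) (d (\<tau> k) / 2) = {}"
proof -
  \<comment> \<open>Only the relation between successive indices matters, so the state predicate is
    \<open>True\<close>. The indices need not increase; injectivity follows from the strict decrease
    of d.\<close>
  have "\<exists>\<tau>. \<forall>k. True \<and> d (\<tau> (Suc k)) < d (\<tau> k) / 3"
  proof (rule dependent_nat_choice)
    fix x and k :: nat
    have "\<forall>\<^sub>F y in sequentially. d y < d x / 3"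
      using d_pos[of x] by (intro order_tendstoD(2)[OF d_lim]) auto
    then show "\<exists>y. True \<and> d y < d x / 3" using eventually_happens'[OF sequentially_bot] by blast
  qed simp
  then obtain \<tau> where \<tau>: "\<And>k. d (\<tau> (Suc k)) < d (\<tau> k) / 3" by blast
  have less: "d (\<tau> k) < d (\<tau> j) / 3" if "j < k" for j k
    using that
  proof (induction rule: less_Suc_induct)
    case (2 i j k)
    then show ?case using d_pos[of "\<tau> j"] by simp
  qed (rule \<tau>)
  have disj: "ball (z (\<tau> j)) (d (\<tau> j) / 2) \<inter> ball (z (\<tau> k)) (d (\<tau> k) / 2) = {}" if "j < k" for j k
  proof -
    have False if w: "norm (z (\<tau> j) - w) < d (\<tau> j) / 2" "norm (z (\<tau> k) - w) < d (\<tau> k) / 2" for w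
    proof -
      have "norm w \<le> norm (z (\<tau> j)) + norm (z (\<tau> j) - w)"
        using norm_triangle_sub[of w "z (\<tau> j)"] by (simp add: norm_minus_commute)
      moreover have "norm (z (\<tau> k)) \<le> norm w + norm (z (\<tau> k) - w)"
        using norm_triangle_sub[of "z (\<tau> k)" w] by simp
      moreover have "norm (z (\<tau> i)) = 1 - d (\<tau> i)" for i by (simp add: d_def)
      ultimately show False
        using w less[OF \<open>j < k\<close>] by (simp add: field_simps)
    qed
    then show ?thesis by (auto simp: dist_norm)
  qed
  show ?thesis
  proof (rule that)
    show "inj \<tau>"
    proof (rule linorder_injI)
      fix j k :: nat assume "j < k"
      then show "\<tau> j \<noteq> \<tau> k" using less[of j k] d_pos[of "\<tau> j"] by auto
    qed
    show "ball (z (\<tau> j)) (d (\<tau> j) / 2) \<inter> ball (z (\<tau> k)) (d (\<tau> k) / 2) = {}" if "j \<noteq> k" for j k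
      using disj[of j k] disj[of k j] that by (cases "j < k") auto
  qed
qed

text \<open>The sub-mean-value property makes every function with the prescribed values at N
  separated atoms pay a fixed amount on each of N disjoint disks. So the lift of g, of which only
  the values are known, has A^p moment at least of order N, while the L^q(\<mu>) moment of g is at
  most of order N.\<close>

lemma q_le_p: "q \<le> p"
proof -
  obtain C where C: "0 < C" "\<And>f. f \<in> bergman_space p \<Longrightarrow>
    \<exists>h\<in>bergman_space p. (\<forall>n. h (z n) = f (z n)) \<and> mom p area_measure h \<le> C * mom q \<mu> f powr (p / q)"
    by (rule lift_bound) (rule that; assumption)
  obtain K where K: "0 < K" "\<And>n. a n \<le> K * ((d n)\<^sup>2) powr (q / p)" using weights_upper by blast
  obtain \<tau> :: "nat \<Rightarrow> nat" where \<tau>: "inj \<tau>"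
    "\<And>j k. j \<noteq> k \<Longrightarrow> ball (z (\<tau> j)) (d (\<tau> j) / 2) \<inter> ball (z (\<tau> k)) (d (\<tau> k) / 2) = {}"
    by (rule separated_subsequence) (rule that; assumption)
  obtain L :: real where L: "0 < L" "\<And>f a. f holomorphic_on unit_disk \<Longrightarrow> a \<in> unit_disk \<Longrightarrow>
       ennreal (norm (f a) powr p * (1 - norm a)\<^sup>2) \<le> ennreal L *
         (\<integral>\<^sup>+w. ennreal (norm (f w) powr p) * indicator (ball a ((1 - norm a) / 2)) w \<partial>area_measure)"
    using bergman_submean[OF p] by blast
  obtain e where e: "\<And>n. e n \<in> bergman_space p" "\<And>n. e n (z n) = 1" "\<And>n m. m \<noteq> n \<Longrightarrow> e n (z m) = 0"
    using point by metis
  have sq: "(d n)\<^sup>2 = d n powr 2" for n using d_pos[of n] by simp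
  have main: "1 * real N \<le> (L * C * K powr (p / q)) * real N powr (p / q)" for N :: nat
  proof -
    \<comment> \<open>With these values v^p d^2 = 1, and v^q a \<le> K by the upper bound for the
      masses: each atom costs at most K in L^q(\<mu>) and forces a moment of at least 1/L over its
      disk.\<close>
    define v where "v = (\<lambda>n. d n powr (- (2 / p)))"
    define g where "g = (\<lambda>x. \<Sum>k<N. complex_of_real (v (\<tau> k)) * e (\<tau> k) x)"
    have g: "g \<in> bergman_space p" unfolding g_def using p e by (intro bergman_sum)
    have g\<tau>: "g (z (\<tau> k)) = complex_of_real (v (\<tau> k))" if "k < N" for k
    proof -
      have "g (z (\<tau> k)) = (\<Sum>i<N. if i = k then complex_of_real (v (\<tau> k)) else 0)"
        unfolding g_def using \<tau>(1) by (intro sum.cong) (auto simp: e inj_eq)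
      then show ?thesis using that by (simp add: sum.delta)
    qed
    have g0: "g (z n) = 0" if "n \<notin> \<tau> ` {..<N}" for n
      unfolding g_def using that by (intro sum.neutral) (auto simp: e image_iff)
    have "qmom q \<mu> g = (\<Sum>n\<in>\<tau> ` {..<N}. ennreal (norm (g (z n)) powr q * a n))"
      unfolding qmom_atomic using g0 q by (intro suminf_finite) auto
    also have "\<dots> = (\<Sum>k<N. ennreal (norm (g (z (\<tau> k))) powr q * a (\<tau> k)))"
      using \<tau>(1) by (subst sum.reindex) (auto intro: inj_on_subset)
    also have "\<dots> \<le> (\<Sum>k<N. ennreal K)"
    proof (intro sum_mono ennreal_leI)
      fix k assume "k \<in> {..<N}"
      then have "norm (g (z (\<tau> k))) powr q * a (\<tau> k) = v (\<tau> k) powr q * a (\<tau> k)"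
        by (simp add: g\<tau> v_def)
      also have "\<dots> \<le> v (\<tau> k) powr q * (K * ((d (\<tau> k))\<^sup>2) powr (q / p))"
        using K by (intro mult_left_mono) auto
      also have "v (\<tau> k) powr q = d (\<tau> k) powr (- (2 * q / p))"
        by (simp add: v_def powr_powr)
      also have "((d (\<tau> k))\<^sup>2) powr (q / p) = d (\<tau> k) powr (2 * q / p)"
        by (simp only: sq powr_powr) simp
      also have "d (\<tau> k) powr (- (2 * q / p)) * (K * d (\<tau> k) powr (2 * q / p))
          = K * (d (\<tau> k) powr (- (2 * q / p)) * d (\<tau> k) powr (2 * q / p))" by simp
      also have "\<dots> = K" using d_pos[of "\<tau> k"] by (simp only: powr_add[symmetric]) simp
      finally show "norm (g (z (\<tau> k))) powr q * a (\<tau> k) \<le> K" .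
    qed
    also have "\<dots> = ennreal (real N * K)" using K by (simp add: ennreal_of_nat_eq_real_of_nat ennreal_mult)
    finally have mg: "mom q \<mu> g \<le> real N * K" using Lq[OF g] K by (simp add: mom_le_iff)
    obtain h where h: "h \<in> bergman_space p" "\<And>n. h (z n) = g (z n)"
      "mom p area_measure h \<le> C * mom q \<mu> g powr (p / q)"
      using C(2)[OF g] by blast
    have hh: "h holomorphic_on unit_disk" using h(1) by (simp add: bergman_space_iff)
    note [measurable] = bergman_measurable_area[OF h(1)]
    define b where "b = (\<lambda>k. ball (z (\<tau> k)) (d (\<tau> k) / 2))"
    have "b k \<subseteq> unit_disk" for k
      unfolding b_def using d_pos[of "\<tau> k"] z_disk[of "\<tau> k"]
      by (subst ball_subset_ball_iff) (auto simp: d_def dist_norm field_simps)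
    then have [measurable]: "b k \<in> sets area_measure" for k
      by (simp add: sets_borel_measure_on_disk[OF borel_measure_on_disk_area]) (simp add: b_def)
    have one: "1 \<le> ennreal L * (\<integral>\<^sup>+w. ennreal (norm (h w) powr p) * indicator (b k) w \<partial>area_measure)" if "k < N" for k
    proof -
      have "norm (h (z (\<tau> k))) powr p * (1 - norm (z (\<tau> k)))\<^sup>2 = v (\<tau> k) powr p * (d (\<tau> k))\<^sup>2"
        using that by (simp add: h g\<tau> v_def d_def)
      also have "v (\<tau> k) powr p = d (\<tau> k) powr (- 2)" unfolding v_def using p by (subst powr_powr) simp
      also have "\<dots> * (d (\<tau> k))\<^sup>2 = 1" unfolding sq using d_pos[of "\<tau> k"] by (simp only: powr_add[symmetric]) simp
      finally show ?thesis using L(2)[OF hh z_disk[of "\<tau> k"]] by (simp add: b_def d_def)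
    qed
    have "ennreal (real N) = (\<Sum>k<N. 1)" by (simp add: ennreal_of_nat_eq_real_of_nat)
    also have "\<dots> \<le> (\<Sum>k<N. ennreal L * (\<integral>\<^sup>+w. ennreal (norm (h w) powr p) * indicator (b k) w \<partial>area_measure))"
      using one by (intro sum_mono) auto
    also have "\<dots> = ennreal L * (\<integral>\<^sup>+w. (\<Sum>k<N. ennreal (norm (h w) powr p) * indicator (b k) w) \<partial>area_measure)"
      by (subst nn_integral_sum) (auto simp: sum_distrib_left)
    also have "\<dots> \<le> ennreal L * qmom p area_measure h"
      unfolding qmom_def
    proof (intro mult_left_mono nn_integral_mono)
      fix w
      have "disjoint_family_on b {..<N}"
        unfolding disjoint_family_on_def b_def using \<tau>(2) by blast
      then have "(\<Sum>k<N. indicator (b k) w) = (indicator (\<Union>k<N. b k) w :: ennreal)"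
        by (subst indicator_UN_disjoint) auto
      also have "\<dots> \<le> 1" by (simp add: indicator_def)
      finally have "ennreal (norm (h w) powr p) * (\<Sum>k<N. indicator (b k) w) \<le> ennreal (norm (h w) powr p) * 1"
        by (intro mult_left_mono) auto
      then show "(\<Sum>k<N. ennreal (norm (h w) powr p) * indicator (b k) w) \<le> ennreal (norm (h w) powr p)"
        by (simp add: sum_distrib_left)
    qed simp
    also have "\<dots> = ennreal (L * mom p area_measure h)"
      using L(1) by (simp add: qmom_eq_mom bergman_Lq h(1) ennreal_mult)
    finally have "real N \<le> L * mom p area_measure h"
      using L(1) by (subst (asm) ennreal_le_iff) auto
    also have "\<dots> \<le> L * (C * mom q \<mu> g powr (p / q))"
      using h(3) L(1) by (intro mult_left_mono) auto
    also have "\<dots> \<le> L * (C * (real N * K) powr (p / q))"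
      using mg L(1) C(1) p q by (intro mult_left_mono powr_mono2) auto
    finally show ?thesis using K(1) by (simp add: powr_mult mult_ac)
  qed
  then have "1 \<le> p / q" by (intro exponent_ge_1[of 1]) auto
  then show ?thesis using q by simp
qed

section \<open>Form of the measure in the atomic case\<close>

lemma exponents_eq: "p = q"
  using p_le_q q_le_p by simp

lemma weights_comparable: "comparable_weights a z"
proof -
  obtain c where "0 < c" "\<And>n. c * ((d n)\<^sup>2) powr (q / p) \<le> a n" using weights_lower by blast
  moreover obtain C where "0 < C" "\<And>n. a n \<le> C * ((d n)\<^sup>2) powr (q / p)" using weights_upper by blast
  ultimately have "0 < c" "\<forall>n. c * (d n)\<^sup>2 \<le> a n \<and> a n \<le> C * (d n)\<^sup>2"
    using p by (simp_all flip: exponents_eq)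
  then show ?thesis
    using comparable_weights_iff[of z a, OF z_disk] unfolding d_def by blast
qed

lemma point_mass_sum: "is_point_mass_sum \<mu> a z"
  unfolding is_point_mass_sum_def
proof (intro conjI ballI bm)
  fix A assume A: "A \<in> sets \<mu>"
  have "emeasure \<mu> A = (\<integral>\<^sup>+x. indicator A x \<partial>\<mu>)" using A by simp
  also have "\<dots> = (\<Sum>n. indicator A (z n) * ennreal (a n))"
    by (subst nn_integral_atomic[OF inj_z sing AE_range]) (simp add: atom)
  finally show "emeasure \<mu> A = (\<Sum>n. ennreal (a n) * indicator A (z n))"
    by (simp add: mult.commute)
qed

lemma interpolating: "interpolating_seq p z"
  unfolding interpolating_seq_def
proof (intro conjI inj_z set_eqI iffI)
  show "range z \<subseteq> unit_disk" using z_disk by blast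
  obtain c C where c: "0 < c" "\<And>n. c * (1 - norm (z n))\<^sup>2 \<le> a n" "\<And>n. a n \<le> C * (1 - norm (z n))\<^sup>2"
    using weights_comparable comparable_weights_iff[of z a, OF z_disk] by blast
  fix w
  show "w \<in> {w. summable (\<lambda>n. norm (w n) powr p * (1 - norm (z n))\<^sup>2)}"
    if wf: "w \<in> {\<lambda>n. f (z n) |f. f \<in> bergman_space p}"
  proof -
    obtain f where f: "f \<in> bergman_space p" "w = (\<lambda>n. f (z n))" using wf by blast
    have "(\<Sum>n. ennreal (norm (f (z n)) powr q * a n)) \<noteq> top"
      using Lq[OF f(1)] by (auto simp: Lq_fun_iff_qmom qmom_atomic)
    then have sm: "summable (\<lambda>n. norm (f (z n)) powr q * a n)"
      using a_pos by (intro summable_suminf_not_top) (auto simp: less_imp_le)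
    have "summable (\<lambda>n. c * (norm (f (z n)) powr p * (1 - norm (z n))\<^sup>2))"
    proof (rule summable_comparison_test'[OF sm])
      fix n
      have "norm (f (z n)) powr p * (c * (1 - norm (z n))\<^sup>2) \<le> norm (f (z n)) powr p * a n"
        using c(2) by (intro mult_left_mono) auto
      then show "norm (c * (norm (f (z n)) powr p * (1 - norm (z n))\<^sup>2)) \<le> norm (f (z n)) powr q * a n"
        using c(1) by (simp add: mult_ac flip: exponents_eq)
    qed
    then show ?thesis using c(1) f(2) by (simp add: summable_cmult_iff)
  qed
  show "w \<in> {\<lambda>n. f (z n) |f. f \<in> bergman_space p}"
    if "w \<in> {w. summable (\<lambda>n. norm (w n) powr p * (1 - norm (z n))\<^sup>2)}"
  proof -
    have sm: "summable (\<lambda>n. norm (w n) powr p * (1 - norm (z n))\<^sup>2)" using that by simp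
    \<comment> \<open>The sequence w becomes a function on the disk, zero off the atoms. It differs
      from a constant at countably many points only, which makes it measurable.\<close>
    define g where "g = (\<lambda>x. if x \<in> range z then w (inv z x) else 0)"
    have gz: "g (z n) = w n" for n using inj_z by (simp add: g_def)
    have gm: "g \<in> borel_measurable \<mu>"
    proof (rule measurable_discrete_difference[where X = "range z"])
      show "(\<lambda>x. 0) \<in> borel_measurable \<mu>" by simp
    qed (auto simp: g_def sing)
    have "summable (\<lambda>n. norm (w n) powr p * a n)"
    proof (rule summable_comparison_test'[OF summable_mult[OF sm, of C]])
      fix n
      have "norm (w n) powr p * a n \<le> norm (w n) powr p * (C * (1 - norm (z n))\<^sup>2)"
        using c(3) by (intro mult_left_mono) auto
      then show "norm (norm (w n) powr p * a n) \<le> C * (norm (w n) powr p * (1 - norm (z n))\<^sup>2)"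
        using a_pos[of n] by (simp add: mult_ac)
    qed
    then have "(\<Sum>n. ennreal (norm (w n) powr p * a n)) = ennreal (\<Sum>n. norm (w n) powr p * a n)"
      using a_pos by (intro suminf_ennreal2) (auto simp: less_imp_le)
    then have "qmom q \<mu> g < \<infinity>" by (simp add: qmom_atomic gz flip: exponents_eq)
    then have "g \<in> Lq_fun q \<mu>" using gm by (simp add: Lq_fun_iff_qmom)
    then obtain f where "f \<in> bergman_space p" "\<And>n. f (z n) = w n"
      using surjective gz by metis
    then show ?thesis by (auto intro!: exI[of _ f])
  qed
qed

end

section \<open>Assembly of the two cases\<close>

lemma noninjective_case:
  assumes p: "0 < p" and q: "0 < q" and \<mu>: "pq_bergman_carleson p q \<mu>" and closed: "closed_range p q \<mu>"
    and nfs: "\<not> finitely_supported \<mu>"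
    and f: "f \<in> bergman_space p" "AE z in \<mu>. f z = 0" and w: "w \<in> unit_disk" "f w \<noteq> 0"
  shows "p = q \<and> (\<exists>z a. interpolating_seq p z \<and> (\<forall>n. 0 < a n) \<and>
        is_point_mass_sum \<mu> a z \<and> comparable_weights a z)"
proof -
  have hol: "f holomorphic_on unit_disk" using f(1) by (simp add: bergman_space_iff)
  obtain z a where z: "\<not> f constant_on unit_disk" "inj z" "\<And>n. z n \<in> unit_disk" "\<And>n. f (z n) = 0" "\<And>n. 0 < a n"
    "\<And>n. emeasure \<mu> {z n} = ennreal (a n)" "AE x in \<mu>. x \<in> range z" "(\<lambda>n. norm (z n)) \<longlonglongrightarrow> 1"
    by (rule zero_set_atoms[OF p q \<mu> nfs hol f(2) w]) (rule that; assumption)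
  interpret atomic_embedding p q \<mu> z a
  proof
    show "\<exists>e\<in>bergman_space p. e (z n) = 1 \<and> (\<forall>m. m \<noteq> n \<longrightarrow> e (z m) = 0)" for n
    proof -
      obtain h where "h \<in> bergman_space p" "h (z n) = 1" "\<And>w. f w = 0 \<Longrightarrow> w \<noteq> z n \<Longrightarrow> h w = 0"
        by (rule bergman_divide_zero[OF p f(1) z(1) z(3)[of n] z(4)[of n]]) (rule that; assumption)
      then show ?thesis using z(2,4) by (auto simp: inj_eq)
    qed
  qed (use p q \<mu> closed z in auto)
  show ?thesis
    using exponents_eq interpolating a_pos point_mass_sum weights_comparable by blast
qed

theorem theorem1p3:
  fixes p q :: real and \<mu> :: "complex measure"
  assumes "0 < p" and "0 < q"
    and "pq_bergman_carleson p q \<mu>"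
    and "\<not> finitely_supported \<mu>"
  shows "closedin (Lq_topology q \<mu>) (bergman_embedding p \<mu> ` bergman_space p) \<longleftrightarrow>
    p = q \<and>
    (sampling_measure p \<mu> \<or>
     (\<exists>z a. interpolating_seq p z \<and> (\<forall>n. 0 < a n) \<and>
        is_point_mass_sum \<mu> a z \<and> comparable_weights a z))"
  unfolding closedin_range_iff[OF assms(1-3)]
proof
  assume closed: "closed_range p q \<mu>"
  show "p = q \<and> (sampling_measure p \<mu> \<or> (\<exists>z a. interpolating_seq p z \<and> (\<forall>n. 0 < a n) \<and>
        is_point_mass_sum \<mu> a z \<and> comparable_weights a z))"
  proof (cases "\<forall>f\<in>bergman_space p. (AE z in \<mu>. f z = 0) \<longrightarrow> (\<forall>z\<in>unit_disk. f z = 0)")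
    case True
    then show ?thesis using injective_case[OF assms(1-3) closed] by blast
  next
    case False
    then show ?thesis using noninjective_case[OF assms(1-3) closed assms(4)] by blast
  qed
next
  assume "p = q \<and> (sampling_measure p \<mu> \<or> (\<exists>z a. interpolating_seq p z \<and> (\<forall>n. 0 < a n) \<and>
        is_point_mass_sum \<mu> a z \<and> comparable_weights a z))"
  then show "closed_range p q \<mu>"
    using assms sampling_imp_closed_range interpolating_imp_closed_range by blast
qed

end
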